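(* Let $T$ be a complex torus and let $G\subset \mathrm{Aut}_0(T)$ be a finite group. Then the biholomorphism classes of flat Kähler manifolds of the form $T/\tilde G$, where $\tilde G\subset\mathrm{Aut}(T)$ is a subgroup acting freely on $T$ which $\pi$ maps isomorphically onto $G$, correspond bijectively to the orbits of special cohomology classes of $H^1(G,T)$ under the action $*$ of $N_{\mathrm{Aut}_0(T)}(G)$.
   Context: For a complex torus $T$, $\mathrm{Aut}(T)$ is the group of biholomorphic self-maps of $T$, and $\mathrm{Aut}_0(T)$ is the group of biholomorphic group homomorphisms $T\to T$. There is a short exact sequence $0\to T\to\mathrm{Aut}(T)\xrightarrow{\pi}\mathrm{Aut}_0(T)\to1$, where $T$ acts by translations and $\pi$ takes the linear part. A subgroup $\tilde G\subset\mathrm{Aut}(T)$ mapped isomorphically by $\pi$ onto $G$ has the form $\tilde G=\{x\mapsto gx+z(g) : g\in G\}$ for a 1-cocycle $z\colon G\to T$, i.e. $z(gh)=z(g)+g\,z(h)$, and so determines a class in $H^1(G,T)$. If $T=V/L$ with $V$ a complex vector space and $L$ a lattice, then $H^1(G,T)\cong H^2(G,L)$. A class in $H^1(G,T)$ is special if the corresponding class in $H^2(G,L)$ defines a torsion-free extension of $G$ by $L$; equivalently, if the corresponding group $\tilde G$ acts freely on $T$. A flat Kähler manifold is a compact flat manifold $\mathbb{R}^{2n}/\Gamma$ ($\Gamma\subset O(2n)\ltimes\mathbb{R}^{2n}$ discrete, cocompact, torsion-free) with the complex structure induced by a matrix $J\in\mathrm{GL}(2n,\mathbb{R})$ with $J^2=-1$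 commuting with the linear parts of all elements of $\Gamma$. $N_{\mathrm{Aut}_0(T)}(G)$ is the normalizer of $G$ in $\mathrm{Aut}_0(T)$; it acts on $H^1(G,T)$ by the action $*$ induced from the action on 1-cocycles $(n*f)(a)=n\,f(n^{-1}an)$, for $n\in N_{\mathrm{Aut}_0(T)}(G)$, $a\in G$, $f\colon G\to T$ a 1-cocycle. *)

theory Defs
  imports
    "HOL-Analysis.Analysis"
    "HOL-Algebra.Bij"
    "HOL-Algebra.Group_Action"
begin

section \<open>Complex manifolds and their quotients\<close>

text \<open>A complex manifold of dimension \<open>CARD('n)\<close> is presented by its underlying topological space and
  an atlas of charts; a chart is a pair of an open set and a coordinate map defined on it.\<close>

record ('p, 'n::finite) cmanifold =
  mtop :: "'p topology"
  atlas :: "('p set \<times> ('p \<Rightarrow> complex ^ 'n)) set"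

definition complex_linear :: "(complex ^ 'n \<Rightarrow> complex ^ 'm) \<Rightarrow> bool" where
  "complex_linear A \<longleftrightarrow> Vector_Spaces.linear (*s) (*s) A"

text \<open>Holomorphy in several variables, as complex differentiability at every point.  It is only used
  for open sets.\<close>

definition holomorphic_vec_on :: "(complex ^ 'n \<Rightarrow> complex ^ 'm) \<Rightarrow> (complex ^ 'n) set \<Rightarrow> bool" where
  "holomorphic_vec_on f S \<longleftrightarrow> (\<forall>x\<in>S. \<exists>D. complex_linear D \<and> (f has_derivative D) (at x))"

definition holomorphic_map ::
    "('p, 'n::finite) cmanifold \<Rightarrow> ('q, 'm::finite) cmanifold \<Rightarrow> ('p \<Rightarrow> 'q) \<Rightarrow> bool" where
  "holomorphic_map M N f \<longleftrightarrow>
     continuous_map (mtop M) (mtop N) f \<and>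
     (\<forall>(U, \<phi>) \<in> atlas M. \<forall>(W, \<psi>) \<in> atlas N.
        holomorphic_vec_on (\<psi> \<circ> f \<circ> inv_into U \<phi>) (\<phi> ` {x \<in> U. f x \<in> W}))"

definition biholomorphic_map ::
    "('p, 'n::finite) cmanifold \<Rightarrow> ('q, 'm::finite) cmanifold \<Rightarrow> ('p \<Rightarrow> 'q) \<Rightarrow> bool" where
  "biholomorphic_map M N f \<longleftrightarrow>
     bij_betw f (topspace (mtop M)) (topspace (mtop N)) \<and>
     holomorphic_map M N f \<and>
     holomorphic_map N M (inv_into (topspace (mtop M)) f)"

definition biholomorphic ::
    "('p, 'n::finite) cmanifold \<Rightarrow> ('q, 'm::finite) cmanifold \<Rightarrow> bool" where
  "biholomorphic M N \<longleftrightarrow> (\<exists>f. biholomorphic_map M N f)"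

definition biholomorphism_classes ::
    "('p, 'n::finite) cmanifold set \<Rightarrow> ('p, 'n) cmanifold set set" where
  "biholomorphism_classes S = S // {(M, N) \<in> S \<times> S. biholomorphic M N}"

definition orbit_of :: "('p \<Rightarrow> 'p) set \<Rightarrow> 'p \<Rightarrow> 'p set" where
  "orbit_of H x = (\<lambda>h. h x) ` H"

definition quotient_top :: "'p topology \<Rightarrow> ('p \<Rightarrow> 'q) \<Rightarrow> 'q topology" where
  "quotient_top X q =
     topology (\<lambda>U. U \<subseteq> q ` topspace X \<and> openin X {x \<in> topspace X. q x \<in> U})"

text \<open>The quotient of \<open>M\<close> by a group \<open>H\<close> of transformations (acting freely and properly
  discontinuously in all uses below).  Its points are the orbits; its charts are the charts of \<open>M\<close>
  composed with the local inverses of the projection.\<close>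

definition quotient_manifold ::
    "('p, 'n::finite) cmanifold \<Rightarrow> ('p \<Rightarrow> 'p) set \<Rightarrow> ('p set, 'n) cmanifold" where
  "quotient_manifold M H =
     \<lparr> mtop = quotient_top (mtop M) (orbit_of H),
       atlas = {(orbit_of H ` U', \<phi> \<circ> inv_into U' (orbit_of H)) | U' U \<phi>.
                  (U, \<phi>) \<in> atlas M \<and> U' \<subseteq> U \<and> openin (mtop M) U' \<and> inj_on (orbit_of H) U'} \<rparr>"

definition complex_space :: "(complex ^ 'n, 'n::finite) cmanifold" where
  "complex_space = \<lparr> mtop = euclidean, atlas = {(UNIV, id)} \<rparr>"


section \<open>Group cohomology in degrees one and two\<close>

text \<open>\<open>M\<close> is an abelian group, written multiplicatively as usual in \<open>HOL-Algebra\<close>, on which \<open>G\<close> acts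
  through \<open>act\<close>.  Cochains are extensional functions.\<close>

definition pointwise_group :: "'a set \<Rightarrow> ('m, 'r) monoid_scheme \<Rightarrow> ('a \<Rightarrow> 'm) set \<Rightarrow> ('a \<Rightarrow> 'm) monoid" where
  "pointwise_group S M C =
     \<lparr> carrier = C, mult = (\<lambda>f g. \<lambda>a\<in>S. f a \<otimes>\<^bsub>M\<^esub> g a), one = (\<lambda>a\<in>S. \<one>\<^bsub>M\<^esub>) \<rparr>"

definition cocycles1 ::
    "('g, 's) monoid_scheme \<Rightarrow> ('m, 'r) monoid_scheme \<Rightarrow> ('g \<Rightarrow> 'm \<Rightarrow> 'm) \<Rightarrow> ('g \<Rightarrow> 'm) monoid" where
  "cocycles1 G M act = pointwise_group (carrier G) M
     {z \<in> carrier G \<rightarrow>\<^sub>E carrier M.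
        \<forall>g\<in>carrier G. \<forall>h\<in>carrier G. z (g \<otimes>\<^bsub>G\<^esub> h) = z g \<otimes>\<^bsub>M\<^esub> act g (z h)}"

definition coboundaries1 ::
    "('g, 's) monoid_scheme \<Rightarrow> ('m, 'r) monoid_scheme \<Rightarrow> ('g \<Rightarrow> 'm \<Rightarrow> 'm) \<Rightarrow> ('g \<Rightarrow> 'm) set" where
  "coboundaries1 G M act = (\<lambda>m. \<lambda>g\<in>carrier G. act g m \<otimes>\<^bsub>M\<^esub> inv\<^bsub>M\<^esub> m) ` carrier M"

definition cohomology1 ::
    "('g, 's) monoid_scheme \<Rightarrow> ('m, 'r) monoid_scheme \<Rightarrow> ('g \<Rightarrow> 'm \<Rightarrow> 'm) \<Rightarrow> ('g \<Rightarrow> 'm) set monoid" where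
  "cohomology1 G M act = cocycles1 G M act Mod coboundaries1 G M act"

definition class1 ::
    "('g, 's) monoid_scheme \<Rightarrow> ('m, 'r) monoid_scheme \<Rightarrow> ('g \<Rightarrow> 'm \<Rightarrow> 'm) \<Rightarrow> ('g \<Rightarrow> 'm) \<Rightarrow> ('g \<Rightarrow> 'm) set" where
  "class1 G M act z = coboundaries1 G M act #>\<^bsub>cocycles1 G M act\<^esub> z"

definition cocycles2 ::
    "('g, 's) monoid_scheme \<Rightarrow> ('m, 'r) monoid_scheme \<Rightarrow> ('g \<Rightarrow> 'm \<Rightarrow> 'm) \<Rightarrow> ('g \<times> 'g \<Rightarrow> 'm) monoid" where
  "cocycles2 G M act = pointwise_group (carrier G \<times> carrier G) M
     {c \<in> carrier G \<times> carrier G \<rightarrow>\<^sub>E carrier M.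
        \<forall>g\<in>carrier G. \<forall>h\<in>carrier G. \<forall>k\<in>carrier G.
          act g (c (h, k)) \<otimes>\<^bsub>M\<^esub> c (g, h \<otimes>\<^bsub>G\<^esub> k) = c (g \<otimes>\<^bsub>G\<^esub> h, k) \<otimes>\<^bsub>M\<^esub> c (g, h)}"

definition coboundary2 ::
    "('g, 's) monoid_scheme \<Rightarrow> ('m, 'r) monoid_scheme \<Rightarrow> ('g \<Rightarrow> 'm \<Rightarrow> 'm) \<Rightarrow> ('g \<Rightarrow> 'm) \<Rightarrow> 'g \<times> 'g \<Rightarrow> 'm" where
  "coboundary2 G M act b = restrict
     (\<lambda>(g, h). act g (b h) \<otimes>\<^bsub>M\<^esub> inv\<^bsub>M\<^esub> (b (g \<otimes>\<^bsub>G\<^esub> h)) \<otimes>\<^bsub>M\<^esub> b g) (carrier G \<times> carrier G)"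

definition cohomology2 ::
    "('g, 's) monoid_scheme \<Rightarrow> ('m, 'r) monoid_scheme \<Rightarrow> ('g \<Rightarrow> 'm \<Rightarrow> 'm) \<Rightarrow> ('g \<times> 'g \<Rightarrow> 'm) set monoid" where
  "cohomology2 G M act =
     cocycles2 G M act Mod (coboundary2 G M act ` (carrier G \<rightarrow>\<^sub>E carrier M))"

text \<open>The extension of \<open>G\<close> by \<open>M\<close> defined by a 2-cocycle \<open>c\<close>.  Cocycles are not assumed to be
  normalized, so the neutral element is \<open>(c(1,1)\<^sup>-\<^sup>1, 1)\<close>.\<close>

definition extension ::
    "('g, 's) monoid_scheme \<Rightarrow> ('m, 'r) monoid_scheme \<Rightarrow> ('g \<Rightarrow> 'm \<Rightarrow> 'm) \<Rightarrow> ('g \<times> 'g \<Rightarrow> 'm) \<Rightarrow> ('m \<times> 'g) monoid" where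
  "extension G M act c =
     \<lparr> carrier = carrier M \<times> carrier G,
       mult = (\<lambda>(l, g) (m, h). (l \<otimes>\<^bsub>M\<^esub> act g m \<otimes>\<^bsub>M\<^esub> c (g, h), g \<otimes>\<^bsub>G\<^esub> h)),
       one = (inv\<^bsub>M\<^esub> (c (\<one>\<^bsub>G\<^esub>, \<one>\<^bsub>G\<^esub>)), \<one>\<^bsub>G\<^esub>) \<rparr>"

definition torsion_free :: "('a, 'r) monoid_scheme \<Rightarrow> bool" where
  "torsion_free G \<longleftrightarrow>
     (\<forall>x\<in>carrier G. \<forall>k::nat. 0 < k \<and> x [^]\<^bsub>G\<^esub> k = \<one>\<^bsub>G\<^esub> \<longrightarrow> x = \<one>\<^bsub>G\<^esub>)"


section \<open>Complex tori and their automorphisms\<close>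

definition vector_group :: "('a::ab_group_add) monoid" where
  "vector_group = \<lparr> carrier = UNIV, mult = (+), one = 0 \<rparr>"

definition is_lattice :: "(complex ^ 'n::finite) set \<Rightarrow> bool" where
  "is_lattice L \<longleftrightarrow> subgroup L vector_group \<and> discrete L \<and> span L = UNIV"

text \<open>The complex torus \<open>T = V/L\<close> with \<open>V = complex ^ 'n\<close>, as a group and as a complex manifold.
  In both guises its points are the cosets of \<open>L\<close>.\<close>

definition torus :: "(complex ^ 'n::finite) set \<Rightarrow> (complex ^ 'n) set monoid" where
  "torus L = vector_group Mod L"

definition torus_manifold :: "(complex ^ 'n::finite) set \<Rightarrow> ((complex ^ 'n) set, 'n) cmanifold" where
  "torus_manifold L = quotient_manifold complex_space ((\<lambda>l x. l + x) ` L)"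

lemma openin_quotient_top:
  "openin (quotient_top X q) U \<longleftrightarrow> U \<subseteq> q ` topspace X \<and> openin X {x \<in> topspace X. q x \<in> U}"
proof -
  have "istopology (\<lambda>U. U \<subseteq> q ` topspace X \<and> openin X {x \<in> topspace X. q x \<in> U})"
    unfolding istopology_def
  proof (intro conjI allI impI, goal_cases)
    case (2 S T)
    have "{x \<in> topspace X. q x \<in> S \<inter> T} = {x \<in> topspace X. q x \<in> S} \<inter> {x \<in> topspace X. q x \<in> T}"
      by auto
    with 2 show ?case by auto
  next
    case (4 K)
    have "{x \<in> topspace X. q x \<in> \<Union>K} = (\<Union>S\<in>K. {x \<in> topspace X. q x \<in> S})"
      by auto
    with 4 show ?case by auto
  qed auto
  then show ?thesis
    unfolding quotient_top_def by simp
qed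

lemma topspace_quotient_top: "topspace (quotient_top X q) = q ` topspace X"
proof -
  have "{x \<in> topspace X. q x \<in> q ` topspace X} = topspace X" by auto
  then have "openin (quotient_top X q) (q ` topspace X)"
    by (simp add: openin_quotient_top)
  then show ?thesis
    by (metis openin_quotient_top openin_subset openin_topspace subset_antisym)
qed

lemma topspace_torus_manifold: "topspace (mtop (torus_manifold L)) = carrier (torus L)"
  by (auto simp: torus_manifold_def torus_def quotient_manifold_def complex_space_def
      topspace_quotient_top carrier_FactGroup vector_group_def r_coset_def orbit_of_def image_image)

type_synonym 'n torus_map = "(complex ^ 'n) set \<Rightarrow> (complex ^ 'n) set"

text \<open>\<open>Aut(T)\<close>.  Self-maps of \<open>T\<close> are extensional functions, and the group law is that of
  \<^const>\<open>BijGroup\<close>, i.e. composition.\<close>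

definition torus_Aut :: "(complex ^ 'n::finite) set \<Rightarrow> 'n torus_map monoid" where
  "torus_Aut L = (BijGroup (carrier (torus L)))
     \<lparr> carrier := {f \<in> Bij (carrier (torus L)). biholomorphic_map (torus_manifold L) (torus_manifold L) f} \<rparr>"

definition torus_Aut0 :: "(complex ^ 'n::finite) set \<Rightarrow> 'n torus_map monoid" where
  "torus_Aut0 L = (torus_Aut L)
     \<lparr> carrier := {f \<in> carrier (torus_Aut L). f \<in> hom (torus L) (torus L)} \<rparr>"

text \<open>The map \<open>\<pi>\<close>: if \<open>f x = g x + t\<close> with \<open>g\<close> a homomorphism, then \<open>g x = f x - f 0\<close>.\<close>

definition linear_part :: "(complex ^ 'n::finite) set \<Rightarrow>
    'n torus_map \<Rightarrow> 'n torus_map" where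
  "linear_part L f = (\<lambda>x\<in>carrier (torus L). f x \<otimes>\<^bsub>torus L\<^esub> inv\<^bsub>torus L\<^esub> (f \<one>\<^bsub>torus L\<^esub>))"

text \<open>The groups \<open>G~ \<subseteq> Aut(T)\<close> that act freely on \<open>T\<close> and are mapped isomorphically onto \<open>G\<close> by
  \<open>\<pi>\<close>.\<close>

definition acts_freely_on_torus ::
    "(complex ^ 'n::finite) set \<Rightarrow> 'n torus_map set \<Rightarrow> bool" where
  "acts_freely_on_torus L H \<longleftrightarrow>
     (\<forall>f\<in>H. f \<noteq> \<one>\<^bsub>torus_Aut L\<^esub> \<longrightarrow> (\<forall>x\<in>carrier (torus L). f x \<noteq> x))"

definition free_lifts :: "(complex ^ 'n::finite) set \<Rightarrow>
    'n torus_map set \<Rightarrow> 'n torus_map set set" where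
  "free_lifts L G =
     {H. subgroup H (torus_Aut L) \<and> acts_freely_on_torus L H \<and>
         linear_part L \<in> iso ((torus_Aut L)\<lparr>carrier := H\<rparr>) ((torus_Aut0 L)\<lparr>carrier := G\<rparr>)}"

definition torus_quotient :: "(complex ^ 'n::finite) set \<Rightarrow>
    'n torus_map set \<Rightarrow> ((complex ^ 'n) set set, 'n) cmanifold" where
  "torus_quotient L H = quotient_manifold (torus_manifold L) H"


section \<open>Flat Kaehler manifolds\<close>

text \<open>\<open>O(m) \<ltimes> \<real>\<^sup>m\<close>, where \<open>(A, a)\<close> acts by \<open>x \<mapsto> A x + a\<close>.\<close>

type_synonym 'm motion = "(real ^ 'm ^ 'm) \<times> (real ^ 'm)"

definition motion_group :: "('m::finite) motion monoid" where
  "motion_group =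
     \<lparr> carrier = {(A, a). orthogonal_matrix A},
       mult = (\<lambda>(A, a) (B, b). (A ** B, A *v b + a)),
       one = (mat 1, 0) \<rparr>"

definition motion :: "'m motion \<Rightarrow> real ^ 'm \<Rightarrow> real ^ 'm::finite" where
  "motion = (\<lambda>(A, a) x. A *v x + a)"

text \<open>\<open>\<real>\<^sup>2\<^sup>n\<close> with the complex structure given by \<open>J\<close>: the charts are the complex linear isomorphisms
  from \<open>(\<real>\<^sup>2\<^sup>n, J)\<close> to \<open>complex ^ 'n\<close>.\<close>

definition real_space_with :: "real ^ ('n + 'n) ^ ('n + 'n) \<Rightarrow> (real ^ ('n + 'n), 'n::finite) cmanifold" where
  "real_space_with J =
     \<lparr> mtop = euclidean,
       atlas = {(UNIV, h) | h. linear h \<and> bij h \<and> (\<forall>v. h (J *v v) = \<i> *s h v)} \<rparr>"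

definition flat_kaehler_model ::
    "('n + 'n) motion set \<Rightarrow> real ^ ('n + 'n) ^ ('n + 'n)
      \<Rightarrow> ((real ^ ('n + 'n)) set, 'n::finite) cmanifold" where
  "flat_kaehler_model \<Gamma> J = quotient_manifold (real_space_with J) (motion ` \<Gamma>)"

definition flat_kaehler_manifold :: "('p, 'n::finite) cmanifold \<Rightarrow> bool" where
  "flat_kaehler_manifold M \<longleftrightarrow>
     (\<exists>(\<Gamma> :: ('n + 'n) motion set) (J :: real ^ ('n + 'n) ^ ('n + 'n)).
        subgroup \<Gamma> motion_group \<and> discrete \<Gamma> \<and>
        torsion_free (motion_group\<lparr>carrier := \<Gamma>\<rparr>) \<and>
        compact_space (mtop (flat_kaehler_model \<Gamma> J)) \<and>
        invertible J \<and> J ** J = - mat 1 \<and>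
        (\<forall>(A, a)\<in>\<Gamma>. A ** J = J ** A) \<and>
        biholomorphic M (flat_kaehler_model \<Gamma> J))"

definition flat_kaehler_quotients :: "(complex ^ 'n::finite) set \<Rightarrow>
    'n torus_map set \<Rightarrow> ((complex ^ 'n) set set, 'n) cmanifold set" where
  "flat_kaehler_quotients L G =
     {M. flat_kaehler_manifold M \<and> (\<exists>H\<in>free_lifts L G. M = torus_quotient L H)}"


section \<open>Special cohomology classes\<close>

text \<open>\<open>G\<close> acts on \<open>T\<close> tautologically, and on \<open>V\<close> and \<open>L\<close> through the complex linear maps lifting its
  elements.\<close>

definition linear_lift :: "(complex ^ 'n::finite) set \<Rightarrow>
    'n torus_map \<Rightarrow> complex ^ 'n \<Rightarrow> complex ^ 'n" where
  "linear_lift L g =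
     (THE A. complex_linear A \<and> (\<forall>x. g (L #>\<^bsub>vector_group\<^esub> x) = L #>\<^bsub>vector_group\<^esub> A x))"

definition torus_H1 :: "(complex ^ 'n::finite) set \<Rightarrow> 'n torus_map set \<Rightarrow>
    ('n torus_map \<Rightarrow> (complex ^ 'n) set) set monoid" where
  "torus_H1 L G = cohomology1 ((torus_Aut0 L)\<lparr>carrier := G\<rparr>) (torus L) (\<lambda>g t. g t)"

definition lattice_H2 :: "(complex ^ 'n::finite) set \<Rightarrow> 'n torus_map set \<Rightarrow>
    ('n torus_map \<times> 'n torus_map \<Rightarrow> complex ^ 'n)
      set monoid" where
  "lattice_H2 L G = cohomology2 ((torus_Aut0 L)\<lparr>carrier := G\<rparr>)
     (vector_group\<lparr>carrier := L\<rparr>) (linear_lift L)"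

text \<open>The isomorphism \<open>H\<^sup>1(G,T) \<rightarrow> H\<^sup>2(G,L)\<close> is the connecting homomorphism of \<open>0 \<rightarrow> L \<rightarrow> V \<rightarrow> T \<rightarrow> 0\<close>:
  lift a cocycle to a \<open>V\<close>-valued cochain and take its coboundary.\<close>

definition connecting_map :: "(complex ^ 'n::finite) set \<Rightarrow> 'n torus_map set \<Rightarrow>
    ('n torus_map \<Rightarrow> (complex ^ 'n) set) set \<Rightarrow>
    ('n torus_map \<times> 'n torus_map \<Rightarrow> complex ^ 'n) set"
  where
  "connecting_map L G C =
     (THE D. D \<in> carrier (lattice_H2 L G) \<and>
        (\<exists>z\<in>C. \<exists>b \<in> G \<rightarrow>\<^sub>E UNIV. (\<forall>g\<in>G. L #>\<^bsub>vector_group\<^esub> b g = z g) \<and>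
           coboundary2 ((torus_Aut0 L)\<lparr>carrier := G\<rparr>) vector_group (linear_lift L) b \<in> D))"

text \<open>The isomorphism type of the extension does not depend on the cocycle representing the class.\<close>

definition special_classes :: "(complex ^ 'n::finite) set \<Rightarrow> 'n torus_map set \<Rightarrow>
    ('n torus_map \<Rightarrow> (complex ^ 'n) set) set set" where
  "special_classes L G =
     {C \<in> carrier (torus_H1 L G). \<forall>c \<in> connecting_map L G C.
        torsion_free (extension ((torus_Aut0 L)\<lparr>carrier := G\<rparr>)
          (vector_group\<lparr>carrier := L\<rparr>) (linear_lift L) c)}"

definition normalizer_group :: "(complex ^ 'n::finite) set \<Rightarrow>
    'n torus_map set \<Rightarrow> 'n torus_map monoid" where
  "normalizer_group L G = (torus_Aut0 L)\<lparr>carrier := normalizer (torus_Aut0 L) G\<rparr>"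

definition star :: "(complex ^ 'n::finite) set \<Rightarrow> 'n torus_map set \<Rightarrow>
    'n torus_map \<Rightarrow>
    ('n torus_map \<Rightarrow> (complex ^ 'n) set) \<Rightarrow>
    'n torus_map \<Rightarrow> (complex ^ 'n) set" where
  "star L G n f =
     (\<lambda>a\<in>G. n (f (inv\<^bsub>torus_Aut0 L\<^esub> n \<otimes>\<^bsub>torus_Aut0 L\<^esub> a \<otimes>\<^bsub>torus_Aut0 L\<^esub> n)))"

definition star_class :: "(complex ^ 'n::finite) set \<Rightarrow> 'n torus_map set \<Rightarrow>
    'n torus_map \<Rightarrow>
    ('n torus_map \<Rightarrow> (complex ^ 'n) set) set \<Rightarrow>
    ('n torus_map \<Rightarrow> (complex ^ 'n) set) set" where
  "star_class L G n C = star L G n ` C"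

text \<open>The class in \<open>H\<^sup>1(G,T)\<close> of the cocycle \<open>z\<close> with \<open>H = {x \<mapsto> g x + z(g) | g \<in> G}\<close>.\<close>

definition lift_cocycle :: "(complex ^ 'n::finite) set \<Rightarrow> 'n torus_map set \<Rightarrow>
    'n torus_map set \<Rightarrow>
    'n torus_map \<Rightarrow> (complex ^ 'n) set" where
  "lift_cocycle L G H =
     (\<lambda>g\<in>G. THE t. t \<in> carrier (torus L) \<and> (\<lambda>x\<in>carrier (torus L). g x \<otimes>\<^bsub>torus L\<^esub> t) \<in> H)"

definition lift_class :: "(complex ^ 'n::finite) set \<Rightarrow> 'n torus_map set \<Rightarrow>
    'n torus_map set \<Rightarrow>
    ('n torus_map \<Rightarrow> (complex ^ 'n) set) set" where
  "lift_class L G H =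
     class1 ((torus_Aut0 L)\<lparr>carrier := G\<rparr>) (torus L) (\<lambda>g t. g t) (lift_cocycle L G H)"

end

theory Submission
  imports
    Defs
    "HOL-Complex_Analysis.Cauchy_Integral_Formula"
    "HOL-Algebra.Multiplicative_Group"
begin

text \<open>
  Write \<open>T = V/L\<close>, and for a cocycle \<open>z\<close> let \<open>\<Gamma>(z)\<close> be the group of all lifts to \<open>V\<close> of the maps
  \<open>x \<mapsto> g x + z(g)\<close> (the constant \<open>deck\<close>).  If these maps act freely on \<open>T\<close>, then \<open>V\<close> is the universal
  cover of the quotient and \<open>\<Gamma>(z)\<close> is its deck group.  Two such quotients, for \<open>z\<close> and \<open>z'\<close>, are therefore
  biholomorphic iff some biholomorphic map \<open>F\<close> of \<open>V\<close> conjugates \<open>\<Gamma>(z)\<close> to \<open>\<Gamma>(z')\<close>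
  (\<open>biholomorphic_map_lifts\<close>, \<open>biholomorphic_if_conjugate\<close>).

  Since \<open>\<pi>\<close> is injective on the acting group, the only translations in \<open>\<Gamma>(z)\<close> are those by \<open>L\<close>.  They can be
  recognized from the group structure alone: they are the elements that commute with every \<open>|G|\<close>-th power
  (\<open>shifts_iff_commute\<close>).  So \<open>F\<close> normalizes \<open>L\<close>, and by Liouville's theorem it is affine,
  \<open>F x = A x + t\<close> (\<open>entire_periodic_imp_affine\<close>).  Comparing linear parts, \<open>A\<close> induces an element \<open>n\<close> of the
  normalizer of \<open>G\<close>; comparing translation parts, \<open>n * z\<close> and \<open>z'\<close> differ by the coboundary of \<open>t\<close>.
  Both steps can be reversed (\<open>conjugate_iff_star\<close>), so biholomorphism classes correspond to orbits of
  classes of cocycles with a free action.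

  These classes are the special ones: \<open>\<Gamma>(z)\<close> is the extension of \<open>G\<close> by \<open>L\<close> defined by the image of the
  class of \<open>z\<close> in \<open>H\<^sup>2(G,L)\<close> (\<open>torsion_free_extension_iff\<close>), and an element of \<open>\<Gamma>(z)\<close> has a fixed point
  iff it has finite order (\<open>deck_torsion_free_iff\<close>): the centroid of a finite orbit is fixed, and the
  \<open>|G|\<close>-th power of an element with a fixed point is a translation with a fixed point.

  Finally, each quotient is a flat Kaehler manifold: in coordinates that are orthonormal for a
  \<open>G\<close>-invariant inner product, \<open>\<Gamma>(z)\<close> consists of rigid motions, and multiplication by \<open>\<i>\<close> becomes a matrix
  \<open>J\<close> commuting with their linear parts (\<open>flat_kaehler_torus_quotient\<close>).  The same coordinates make
  \<open>\<Gamma>(z)\<close> a group of isometries, for which the covering \<open>V \<rightarrow> V/\<Gamma>(z)\<close> is constructed inside a space of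
  functions (\<open>covering_space_orbit_dist\<close>); this is what allows maps to be lifted to \<open>V\<close>.
\<close>


section \<open>Quotients of Euclidean space by isometric deck groups\<close>

lemma mem_orbit_of: "y \<in> orbit_of H x \<longleftrightarrow> (\<exists>h\<in>H. y = h x)"
  by (auto simp: orbit_of_def)

text \<open>The lower bound for the displacement of \<open>x\<close> expresses freeness and proper discontinuity at once.\<close>

locale isometric_deck_group =
  fixes \<Delta> :: "('e::euclidean_space \<Rightarrow> 'e) set"
  assumes id_mem: "id \<in> \<Delta>"
    and comp_mem: "\<gamma> \<in> \<Delta> \<Longrightarrow> \<delta> \<in> \<Delta> \<Longrightarrow> \<gamma> \<circ> \<delta> \<in> \<Delta>"
    and left_inverse: "\<gamma> \<in> \<Delta> \<Longrightarrow> \<exists>\<delta>\<in>\<Delta>. \<delta> \<circ> \<gamma> = id"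
    and isometric: "\<gamma> \<in> \<Delta> \<Longrightarrow> dist (\<gamma> x) (\<gamma> y) = dist x y"
    and displaces: "\<exists>r>0. \<forall>\<gamma>\<in>\<Delta>. \<gamma> \<noteq> id \<longrightarrow> r \<le> dist x (\<gamma> x)"
begin

lemma two_sided_inverse:
  assumes "\<gamma> \<in> \<Delta>"
  obtains \<delta> where "\<delta> \<in> \<Delta>" "\<And>x. \<delta> (\<gamma> x) = x" "\<And>x. \<gamma> (\<delta> x) = x"
proof -
  obtain \<delta> where d: "\<delta> \<in> \<Delta>" "\<delta> \<circ> \<gamma> = id" using left_inverse[OF assms] by blast
  obtain \<epsilon> where e: "\<epsilon> \<in> \<Delta>" "\<epsilon> \<circ> \<delta> = id" using left_inverse[OF d(1)] by blast
  have "\<epsilon> = \<gamma>"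
    by (metis comp_assoc comp_id d(2) e(2) id_comp)
  then show ?thesis using that[OF d(1)] d(2) e(2)
    by (metis comp_apply id_apply)
qed

lemma orbit_of_image: "\<gamma> \<in> \<Delta> \<Longrightarrow> orbit_of \<Delta> (\<gamma> x) = orbit_of \<Delta> x"
proof -
  assume g: "\<gamma> \<in> \<Delta>"
  obtain \<delta> where d: "\<delta> \<in> \<Delta>" "\<And>x. \<delta> (\<gamma> x) = x" "\<And>x. \<gamma> (\<delta> x) = x"
    using two_sided_inverse[OF g] by blast
  show ?thesis
  proof (intro Set.set_eqI iffI)
    fix y assume "y \<in> orbit_of \<Delta> (\<gamma> x)"
    then obtain \<eta> where "\<eta> \<in> \<Delta>" "y = (\<eta> \<circ> \<gamma>) x" by (auto simp: mem_orbit_of)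
    then show "y \<in> orbit_of \<Delta> x"
      using comp_mem[OF _ g] by (metis mem_orbit_of)
  next
    fix y assume "y \<in> orbit_of \<Delta> x"
    then obtain \<eta> where "\<eta> \<in> \<Delta>" "y = (\<eta> \<circ> \<delta>) (\<gamma> x)" using d(2) by (auto simp: mem_orbit_of)
    then show "y \<in> orbit_of \<Delta> (\<gamma> x)"
      using comp_mem[OF _ d(1)] by (metis mem_orbit_of)
  qed
qed

lemma displacement_forces_equal:
  assumes r: "\<forall>\<gamma>\<in>\<Delta>. \<gamma> \<noteq> id \<longrightarrow> r \<le> dist x (\<gamma> x)"
    and "\<gamma> \<in> \<Delta>" "\<delta> \<in> \<Delta>" "dist (\<gamma> x) (\<delta> x) < r"
  shows "\<gamma> = \<delta>"
proof -
  obtain \<eta> where e: "\<eta> \<in> \<Delta>" "\<And>x. \<eta> (\<gamma> x) = x" "\<And>x. \<gamma> (\<eta> x) = x"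
    using two_sided_inverse[OF assms(2)] by blast
  have "dist x ((\<eta> \<circ> \<delta>) x) = dist (\<gamma> x) (\<delta> x)"
    by (metis assms(2) comp_apply e(3) isometric)
  moreover have "\<eta> \<circ> \<delta> \<in> \<Delta>" using e assms comp_mem by blast
  ultimately have "\<eta> \<circ> \<delta> = id" using r assms(4) by force
  then show ?thesis
    by (metis (no_types, opaque_lifting) comp_apply e(3) ext id_apply)
qed

text \<open>The orbit space is realized inside the Banach space of bounded continuous functions: an orbit
  goes to the distance to it, truncated so as to be bounded.  This makes the quotient a subset of a
  normed space, where the lifting theorem for covering spaces applies.\<close>

definition orbit_dist :: "'e \<Rightarrow> 'e \<Rightarrow>\<^sub>C real" where
  "orbit_dist x = Bcontfun (\<lambda>z. min 1 (infdist z (orbit_of \<Delta> x)))"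

lemma orbit_dist_apply: "apply_bcontfun (orbit_dist x) z = min 1 (infdist z (orbit_of \<Delta> x))"
proof -
  have "(\<lambda>z. min 1 (infdist z (orbit_of \<Delta> x))) \<in> bcontfun"
  proof (rule bcontfun_normI[where b = 1])
    show "continuous_on UNIV (\<lambda>z. min 1 (infdist z (orbit_of \<Delta> x)))"
      by (intro continuous_on_min continuous_on_infdist continuous_on_const continuous_on_id)
    show "norm (min 1 (infdist z (orbit_of \<Delta> x))) \<le> 1" for z
      using infdist_nonneg[of z "orbit_of \<Delta> x"] by simp
  qed
  then show ?thesis
    by (simp add: orbit_dist_def Bcontfun_inverse)
qed

lemma orbit_of_nonempty: "orbit_of \<Delta> x \<noteq> {}"
  using id_mem by (auto simp: orbit_of_def)

lemma orbit_dist_image: "\<gamma> \<in> \<Delta> \<Longrightarrow> orbit_dist (\<gamma> x) = orbit_dist x"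
  by (simp add: orbit_dist_def orbit_of_image)

lemma infdist_orbit_le: "infdist z (orbit_of \<Delta> y) \<le> infdist z (orbit_of \<Delta> x) + dist x y"
proof -
  have "infdist z (orbit_of \<Delta> y) - dist x y \<le> dist z a" if a: "a \<in> orbit_of \<Delta> x" for a
  proof -
    obtain \<delta> where d: "\<delta> \<in> \<Delta>" "a = \<delta> x" using a[unfolded mem_orbit_of] by blast
    have "infdist z (orbit_of \<Delta> y) \<le> dist z (\<delta> y)"
      by (rule infdist_le) (use d in \<open>auto simp: orbit_of_def\<close>)
    also have "\<dots> \<le> dist z (\<delta> x) + dist (\<delta> x) (\<delta> y)" by (rule dist_triangle)
    also have "\<dots> = dist z a + dist x y" using d isometric by simp
    finally show ?thesis by simp
  qed
  then have "infdist z (orbit_of \<Delta> y) - dist x y \<le> infdist z (orbit_of \<Delta> x)"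
    unfolding infdist_notempty[OF orbit_of_nonempty, of z x]
    by (intro cINF_greatest orbit_of_nonempty) auto
  then show ?thesis by simp
qed

lemma dist_orbit_dist_le: "dist (orbit_dist x) (orbit_dist y) \<le> dist x y"
proof (rule dist_bound)
  fix z
  show "dist (apply_bcontfun (orbit_dist x) z) (apply_bcontfun (orbit_dist y) z) \<le> dist x y"
    using infdist_orbit_le[of z x y] infdist_orbit_le[of z y x]
    by (auto simp: orbit_dist_apply dist_real_def dist_commute min_def abs_if)
qed

text \<open>Evaluate the two functions at \<open>x\<close>, whose distance to its own orbit is \<open>0\<close>; the truncation at \<open>1\<close>
  is invisible because \<open>s \<le> 1\<close>.\<close>

lemma close_orbit_dist:
  assumes "dist (orbit_dist x) (orbit_dist y) < s" "s \<le> 1"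
  obtains \<gamma> where "\<gamma> \<in> \<Delta>" "dist x (\<gamma> y) < s"
proof -
  have "x \<in> orbit_of \<Delta> x" using id_mem by (metis mem_orbit_of id_apply)
  then have "infdist x (orbit_of \<Delta> x) = 0" by simp
  moreover have "dist (apply_bcontfun (orbit_dist x) x) (apply_bcontfun (orbit_dist y) x) < s"
    by (rule dist_fun_lt_imp_dist_val_lt[OF assms(1)])
  ultimately have "infdist x (orbit_of \<Delta> y) < s"
    using assms(2) by (auto simp: orbit_dist_apply dist_real_def min_def split: if_splits)
  then obtain a where "a \<in> orbit_of \<Delta> y" "dist x a < s"
    unfolding infdist_notempty[OF orbit_of_nonempty]
    by (subst (asm) cINF_less_iff) (auto simp: orbit_of_nonempty)
  then show ?thesis using that by (auto simp: orbit_of_def)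
qed

text \<open>If the functions agree, then \<open>y\<close> has deck images arbitrarily close to \<open>x\<close>.  Distinct images of \<open>y\<close> have a
  minimal distance, so one of these images is \<open>x\<close> itself.\<close>

lemma orbit_dist_eq_iff: "orbit_dist x = orbit_dist y \<longleftrightarrow> (\<exists>\<gamma>\<in>\<Delta>. y = \<gamma> x)"
proof
  assume eq: "orbit_dist x = orbit_dist y"
  obtain r where r: "r > 0" "\<forall>\<gamma>\<in>\<Delta>. \<gamma> \<noteq> id \<longrightarrow> r \<le> dist y (\<gamma> y)" using displaces by blast
  have ex: "\<exists>\<gamma>\<in>\<Delta>. dist x (\<gamma> y) < s" if "s > 0" for s
    using close_orbit_dist[of x y "min 1 s"] eq that by auto
  obtain \<gamma> where g: "\<gamma> \<in> \<Delta>" "dist x (\<gamma> y) < r/2" using ex[of "r/2"] r by auto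
  have "dist x (\<gamma> y) = 0"
  proof (rule ccontr)
    assume ne: "dist x (\<gamma> y) \<noteq> 0"
    then obtain \<delta> where d: "\<delta> \<in> \<Delta>" "dist x (\<delta> y) < min (dist x (\<gamma> y)) (r/2)"
      using ex[of "min (dist x (\<gamma> y)) (r/2)"] r by auto
    have "dist (\<gamma> y) (\<delta> y) < r"
      using g(2) d(2) dist_triangle[of "\<gamma> y" "\<delta> y" x] by (auto simp: dist_commute)
    then have "\<gamma> = \<delta>" using displacement_forces_equal[OF r(2) g(1) d(1)] by blast
    then show False using d by simp
  qed
  moreover obtain \<delta> where d: "\<delta> \<in> \<Delta>" "\<And>x. \<delta> (\<gamma> x) = x" "\<And>x. \<gamma> (\<delta> x) = x"
    using two_sided_inverse[OF g(1)] by blast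
  ultimately have "y = \<delta> x" by simp
  then show "\<exists>\<gamma>\<in>\<Delta>. y = \<gamma> x" using d(1) by blast
next
  assume "\<exists>\<gamma>\<in>\<Delta>. y = \<gamma> x"
  then show "orbit_dist x = orbit_dist y" using orbit_dist_image by auto
qed

lemma continuous_orbit_dist: "continuous_on S orbit_dist"
proof (clarsimp simp: continuous_on_iff)
  fix x e assume "x \<in> S" "(0::real) < e"
  then show "\<exists>d>0. \<forall>x'\<in>S. dist x' x < d \<longrightarrow> dist (orbit_dist x') (orbit_dist x) < e"
    using dist_orbit_dist_le le_less_trans by blast
qed

lemma ball_orbit_dist:
  assumes "s \<le> 1"
  shows "orbit_dist ` ball x s = range orbit_dist \<inter> ball (orbit_dist x) s"
proof (intro Set.set_eqI iffI)
  fix f assume "f \<in> orbit_dist ` ball x s"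
  then show "f \<in> range orbit_dist \<inter> ball (orbit_dist x) s"
    using dist_orbit_dist_le le_less_trans by fastforce
next
  fix f assume "f \<in> range orbit_dist \<inter> ball (orbit_dist x) s"
  then obtain y where y: "f = orbit_dist y" "dist (orbit_dist x) (orbit_dist y) < s" by auto
  from close_orbit_dist[OF y(2) assms] obtain \<gamma> where "\<gamma> \<in> \<Delta>" "dist x (\<gamma> y) < s" by blast
  then show "f \<in> orbit_dist ` ball x s"
    using y(1) orbit_dist_image[of \<gamma> y] by (metis imageI mem_ball)
qed

lemma open_orbit_dist:
  assumes "open U"
  shows "openin (top_of_set (range orbit_dist)) (orbit_dist ` U)"
proof (subst openin_contains_ball, intro conjI ballI)
  fix f assume "f \<in> orbit_dist ` U"
  then obtain x where x: "x \<in> U" "f = orbit_dist x" by auto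
  then obtain e where e: "e > 0" "ball x e \<subseteq> U" using assms openE by blast
  have "ball (orbit_dist x) (min e 1) \<inter> range orbit_dist = orbit_dist ` ball x (min e 1)"
    by (subst ball_orbit_dist) auto
  also have "\<dots> \<subseteq> orbit_dist ` U" using e(2) by auto
  finally show "\<exists>e>0. ball f e \<inter> range orbit_dist \<subseteq> orbit_dist ` U"
    using e(1) x(2) by (intro exI[of _ "min e 1"]) auto
qed auto

lemma isometry_ball: "\<gamma> \<in> \<Delta> \<Longrightarrow> \<gamma> ` ball x s = ball (\<gamma> x) s"
proof -
  assume g: "\<gamma> \<in> \<Delta>"
  obtain \<delta> where d: "\<delta> \<in> \<Delta>" "\<And>x. \<delta> (\<gamma> x) = x" "\<And>x. \<gamma> (\<delta> x) = x"
    using two_sided_inverse[OF g] by blast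
  show ?thesis
  proof (intro Set.set_eqI iffI)
    fix y assume "y \<in> ball (\<gamma> x) s"
    then have "\<delta> y \<in> ball x s" using isometric[OF g, of x "\<delta> y"] d by auto
    then show "y \<in> \<gamma> ` ball x s" using d(3) by (metis imageI)
  qed (use isometric[OF g] in auto)
qed

text \<open>The preimage of the image of a small ball is the disjoint union of the translates of the ball, and
  \<open>orbit_dist\<close> is open and injective on each of them.\<close>

theorem covering_space_orbit_dist: "covering_space UNIV orbit_dist (range orbit_dist)"
proof
  fix f assume "f \<in> range orbit_dist"
  then obtain x where f: "f = orbit_dist x" by auto
  obtain r where r: "r > 0" "\<forall>\<gamma>\<in>\<Delta>. \<gamma> \<noteq> id \<longrightarrow> r \<le> dist x (\<gamma> x)" using displaces by blast
  \<comment> \<open>Balls of radius \<open>r/2\<close> about the points of the orbit are disjoint; \<open>s \<le> 1\<close> is needed because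
    \<open>orbit_dist\<close> only sees distances up to \<open>1\<close>.\<close>
  define s where "s = min 1 (r/4)"
  have s: "s > 0" "s \<le> 1" "4 * s \<le> r" using r by (auto simp: s_def)
  let ?T = "orbit_dist ` ball x s" and ?v = "(\<lambda>\<gamma>. ball (\<gamma> x) s) ` \<Delta>"
  have "f \<in> ?T" using f s by auto
  moreover have "openin (top_of_set (range orbit_dist)) ?T" by (simp add: open_orbit_dist)
  moreover have "\<Union>?v = UNIV \<inter> orbit_dist -` ?T"
  proof (intro Set.set_eqI iffI)
    fix y assume "y \<in> \<Union>?v"
    then obtain \<gamma> where g: "\<gamma> \<in> \<Delta>" "y \<in> \<gamma> ` ball x s" using isometry_ball by auto
    then show "y \<in> UNIV \<inter> orbit_dist -` ?T" using orbit_dist_image[OF g(1)] by auto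
  next
    fix y assume "y \<in> UNIV \<inter> orbit_dist -` ?T"
    then obtain u where "u \<in> ball x s" "orbit_dist u = orbit_dist y" by auto
    then obtain \<gamma> where "\<gamma> \<in> \<Delta>" "y = \<gamma> u" by (auto simp: orbit_dist_eq_iff)
    then show "y \<in> \<Union>?v" using isometry_ball[of \<gamma> x s] \<open>u \<in> ball x s\<close> by blast
  qed
  moreover have "\<forall>u\<in>?v. openin (top_of_set UNIV) u" by auto
  moreover have "pairwise disjnt ?v"
  proof (rule pairwiseI)
    fix u u' assume "u \<in> ?v" "u' \<in> ?v" and ne: "u \<noteq> u'"
    then obtain \<gamma> \<delta> where gd: "\<gamma> \<in> \<Delta>" "\<delta> \<in> \<Delta>" "u = ball (\<gamma> x) s" "u' = ball (\<delta> x) s" by blast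
    show "disjnt u u'"
    proof (rule ccontr)
      assume "\<not> disjnt u u'"
      then obtain y where "y \<in> u" "y \<in> u'" by (auto simp: disjnt_def)
      then have "dist (\<gamma> x) (\<delta> x) < r"
        using gd(3,4) s dist_triangle[of "\<gamma> x" "\<delta> x" y] by (auto simp: dist_commute)
      then show False using displacement_forces_equal[OF r(2) gd(1,2)] gd(3,4) ne by simp
    qed
  qed
  moreover have "\<forall>u\<in>?v. \<exists>q. homeomorphism u ?T orbit_dist q"
  proof
    fix u assume u: "u \<in> ?v"
    from u obtain \<gamma> where g: "\<gamma> \<in> \<Delta>" "u = ball (\<gamma> x) s" by blast
    have img: "orbit_dist ` u = ?T"
      using isometry_ball[OF g(1), of x s] g orbit_dist_image[OF g(1)] by (metis (no_types, lifting) image_cong image_image)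
    have inj: "inj_on orbit_dist u"
    proof (rule inj_onI)
      fix y y' assume y: "y \<in> u" "y' \<in> u" "orbit_dist y = orbit_dist y'"
      then obtain \<delta> where d: "\<delta> \<in> \<Delta>" "y' = \<delta> y" by (auto simp: orbit_dist_eq_iff)
      have "dist (\<gamma> x) (\<delta> (\<gamma> x)) \<le> dist (\<gamma> x) y' + dist y' (\<delta> (\<gamma> x))" by (rule dist_triangle)
      also have "dist y' (\<delta> (\<gamma> x)) = dist y (\<gamma> x)" using d isometric by simp
      finally have "dist (\<gamma> x) ((\<delta> \<circ> \<gamma>) x) < r"
        using y(1,2) g(2) s by (auto simp: dist_commute)
      then have "\<gamma> = \<delta> \<circ> \<gamma>"
        using displacement_forces_equal[OF r(2) g(1) comp_mem[OF d(1) g(1)]] by blast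
      then have fixed: "\<delta> (\<gamma> w) = \<gamma> w" for w by (metis comp_apply)
      obtain \<eta> where "\<eta> \<in> \<Delta>" "\<And>x. \<eta> (\<gamma> x) = x" "\<And>x. \<gamma> (\<eta> x) = x"
        using two_sided_inverse[OF g(1)] by blast
      then show "y = y'" using d fixed[of "\<eta> y"] by simp
    qed
    have "openin (top_of_set ?T) (orbit_dist ` U)" if U: "openin (top_of_set u) U" for U
    proof -
      have "open U" "U \<subseteq> u"
        using U g(2) by (auto simp: openin_open_eq)
      then have "openin (top_of_set (range orbit_dist)) (orbit_dist ` U)" "orbit_dist ` U \<subseteq> ?T"
        using open_orbit_dist image_mono[of U u orbit_dist] unfolding img by auto
      then show ?thesis by (rule openin_subset_trans) auto
    qed
    then show "\<exists>q. homeomorphism u ?T orbit_dist q"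
      using homeomorphism_injective_open_map[OF continuous_orbit_dist img inj] by blast
  qed
  ultimately show "\<exists>T. f \<in> T \<and> openin (top_of_set (range orbit_dist)) T \<and>
      (\<exists>v. \<Union>v = UNIV \<inter> orbit_dist -` T \<and> (\<forall>u\<in>v. openin (top_of_set UNIV) u) \<and>
        pairwise disjnt v \<and> (\<forall>u\<in>v. \<exists>q. homeomorphism u T orbit_dist q))"
    by (intro exI[of _ ?T] exI[of _ ?v] conjI)
qed (auto simp: continuous_orbit_dist)

lemma lift_to_cover:
  fixes f :: "'v::euclidean_space \<Rightarrow> 'e \<Rightarrow>\<^sub>C real"
  assumes "continuous_on UNIV f" "range f \<subseteq> range orbit_dist"
  obtains F where "continuous_on UNIV F" "\<And>x. orbit_dist (F x) = f x"
proof -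
  have "simply_connected (UNIV :: 'v set)" "locally path_connected (UNIV :: 'v set)"
    by (auto simp: convex_imp_simply_connected convex_imp_locally_path_connected)
  moreover have "f \<in> UNIV \<rightarrow> range orbit_dist" using assms(2) by auto
  ultimately show ?thesis
    by (rule covering_space_lift[OF covering_space_orbit_dist _ _ assms(1)]) (use that in simp)
qed

text \<open>Pick the deck transformation that is right at one point; by uniqueness of lifts it is right everywhere.\<close>

lemma lifts_differ_by_deck:
  fixes F F' :: "'v::euclidean_space \<Rightarrow> 'e"
  assumes "continuous_on UNIV F" "continuous_on UNIV F'" "\<And>x. orbit_dist (F x) = orbit_dist (F' x)"
  obtains \<gamma> where "\<gamma> \<in> \<Delta>" "\<And>x. F' x = \<gamma> (F x)"
proof -
  obtain \<gamma> where g: "\<gamma> \<in> \<Delta>" "F' 0 = \<gamma> (F 0)" using assms(3)[of 0] by (auto simp: orbit_dist_eq_iff)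
  have cg: "continuous_on UNIV \<gamma>"
    using isometric[OF g(1)] by (auto simp: continuous_on_iff)
  have cF: "continuous_on UNIV (\<lambda>x. \<gamma> (F x))"
    using continuous_on_compose2[OF cg assms(1)] by auto
  have cq: "continuous_on UNIV (\<lambda>x. orbit_dist (F x))"
    using continuous_on_compose2[OF continuous_orbit_dist assms(1), of UNIV] by simp
  have "F' x = \<gamma> (F x)" for x
  proof (rule covering_space_lift_unique[where f = "\<lambda>x. orbit_dist (F x)" and T = UNIV and a = 0])
    show "covering_space UNIV orbit_dist (range orbit_dist)" by (rule covering_space_orbit_dist)
  qed (use g(2) cq cF assms orbit_dist_image[OF g(1)] in auto)
  then show ?thesis using that g by blast
qed

end


section \<open>Manifolds uniformized by a vector space\<close>

lemma complex_linear_iff: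
  "complex_linear A \<longleftrightarrow> (\<forall>x y. A (x + y) = A x + A y) \<and> (\<forall>c x. A (c *s x) = c *s A x)"
  unfolding complex_linear_def
  by (auto simp: Vector_Spaces.linear_iff vec.vector_space_axioms)

abbreviation entire :: "(complex ^ 'n \<Rightarrow> complex ^ 'm) \<Rightarrow> bool" where
  "entire f \<equiv> holomorphic_vec_on f UNIV"

lemma complex_linear_compose: "complex_linear A \<Longrightarrow> complex_linear B \<Longrightarrow> complex_linear (A \<circ> B)"
  by (simp add: complex_linear_iff)

lemma entire_compose: "entire (g \<circ> f)" if g: "entire g" and f: "entire f"
  unfolding holomorphic_vec_on_def
proof
  fix x
  obtain D where D: "complex_linear D" "(f has_derivative D) (at x)"
    using f unfolding holomorphic_vec_on_def by blast
  obtain E where E: "complex_linear E" "(g has_derivative E) (at (f x))"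
    using g unfolding holomorphic_vec_on_def by blast
  show "\<exists>D. complex_linear D \<and> (g \<circ> f has_derivative D) (at x)"
    using complex_linear_compose[OF E(1) D(1)] diff_chain_at[OF D(2) E(2)] by blast
qed

lemma entire_continuous: "entire f \<Longrightarrow> continuous_on UNIV f"
  unfolding holomorphic_vec_on_def
  by (auto intro!: continuous_at_imp_continuous_on dest: has_derivative_continuous)

lemma entire_id: "entire id"
proof -
  have "complex_linear id" by (simp add: complex_linear_iff)
  then show ?thesis
    unfolding holomorphic_vec_on_def using has_derivative_id by blast
qed

text \<open>Charts are only required to be sections of \<open>p\<close> up to an automorphism \<open>\<tau>\<close> of the vector space,
  since the atlas of a linear space contains all complex linear coordinates.\<close>

definition uniformized ::
    "('p, 'n::finite) cmanifold \<Rightarrow> (complex ^ 'n \<Rightarrow> 'p) \<Rightarrow> (complex ^ 'n \<Rightarrow> complex ^ 'n) set \<Rightarrow> bool" where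
  "uniformized M p \<Gamma> \<longleftrightarrow>
     (\<forall>U. openin (mtop M) U \<longleftrightarrow> U \<subseteq> range p \<and> open (p -` U)) \<and>
     (\<forall>(W, \<psi>) \<in> atlas M. open (\<psi> ` W) \<and>
        (\<exists>\<tau> \<sigma>. entire \<tau> \<and> entire \<sigma> \<and> (\<forall>x. \<sigma> (\<tau> x) = x) \<and> (\<forall>x. \<tau> (\<sigma> x) = x) \<and>
           (\<forall>w\<in>W. p (\<tau> (\<psi> w)) = w))) \<and>
     (\<forall>x. \<exists>(W, \<psi>) \<in> atlas M. x \<in> \<psi> ` W \<and> (\<forall>w\<in>W. p (\<psi> w) = w)) \<and>
     (\<forall>\<gamma>\<in>\<Gamma>. entire \<gamma>) \<and>
     (\<forall>x y. p x = p y \<longleftrightarrow> (\<exists>\<gamma>\<in>\<Gamma>. y = \<gamma> x))"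

context
  fixes M :: "('p, 'n::finite) cmanifold" and p \<Gamma>
  assumes uniformized: "uniformized M p \<Gamma>"
begin

lemmas uniformized_conjuncts =
  uniformized[unfolded uniformized_def, THEN conjunct1]
  uniformized[unfolded uniformized_def, THEN conjunct2, THEN conjunct1]
  uniformized[unfolded uniformized_def, THEN conjunct2, THEN conjunct2, THEN conjunct1]
  uniformized[unfolded uniformized_def, THEN conjunct2, THEN conjunct2, THEN conjunct2]

lemma uniformized_openin: "openin (mtop M) U \<longleftrightarrow> U \<subseteq> range p \<and> open (p -` U)"
  using uniformized_conjuncts(1) by blast

lemma uniformized_chart:
  assumes "(W, \<psi>) \<in> atlas M"
  obtains \<tau> \<sigma> where "open (\<psi> ` W)" "entire \<tau>" "entire \<sigma>" "\<And>x. \<sigma> (\<tau> x) = x" "\<And>x. \<tau> (\<sigma> x) = x"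
    "\<And>w. w \<in> W \<Longrightarrow> p (\<tau> (\<psi> w)) = w"
proof -
  note c = bspec[OF uniformized_conjuncts(2) assms, unfolded prod.case]
  obtain \<tau> \<sigma> where t: "entire \<tau> \<and> entire \<sigma> \<and> (\<forall>x. \<sigma> (\<tau> x) = x) \<and> (\<forall>x. \<tau> (\<sigma> x) = x) \<and>
      (\<forall>w\<in>W. p (\<tau> (\<psi> w)) = w)"
    using conjunct2[OF c] by (elim exE) (rule that)
  show ?thesis
    by (rule that[of \<tau> \<sigma>]) (use t conjunct1[OF c] in simp_all)
qed

lemma uniformized_section:
  obtains W \<psi> where "(W, \<psi>) \<in> atlas M" "x \<in> \<psi> ` W" "\<And>w. w \<in> W \<Longrightarrow> p (\<psi> w) = w" "open (\<psi> ` W)"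
proof -
  obtain c where c: "c \<in> atlas M" "case c of (W, \<psi>) \<Rightarrow> x \<in> \<psi> ` W \<and> (\<forall>w\<in>W. p (\<psi> w) = w)"
    by (rule bexE[OF spec[OF uniformized_conjuncts(3), of x]])
  obtain W \<psi> where "c = (W, \<psi>)" by (cases c)
  then show ?thesis using that[of W \<psi>] c uniformized_chart[of W \<psi>] by auto
qed

lemma uniformized_eq_iff: "p x = p y \<longleftrightarrow> (\<exists>\<gamma>\<in>\<Gamma>. y = \<gamma> x)"
  using uniformized_conjuncts(4) by simp

lemma uniformized_entire: "\<gamma> \<in> \<Gamma> \<Longrightarrow> entire \<gamma>"
  using uniformized_conjuncts(4) by simp

lemma uniformized_topspace: "topspace (mtop M) = range p"
proof
  show "topspace (mtop M) \<subseteq> range p"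
    using openin_topspace[of "mtop M"] by (simp only: uniformized_openin)
  show "range p \<subseteq> topspace (mtop M)"
    by (rule openin_subset) (simp add: uniformized_openin vimage_def)
qed

end

lemma entire_eventually:
  assumes "entire f" "open S" "f x \<in> S"
  shows "\<forall>\<^sub>F y in nhds x. f y \<in> S"
proof -
  have "open (f -` S)"
    using entire_continuous[OF assms(1)] assms(2) by (simp add: open_vimage)
  then show ?thesis
    using eventually_nhds_in_open[of "f -` S" x] assms(3) by auto
qed

text \<open>A chart composed with the projection is, near each point, a deck transformation followed by a
  coordinate change: two points over the same point differ by a deck transformation, and the same one
  works nearby because the image of the chart is open.\<close>

lemma chart_projection_local:
  assumes u: "uniformized M p \<Gamma>" and c: "(W, \<psi>) \<in> atlas M" and y: "p y \<in> W"
  obtains \<eta> where "entire \<eta>" "\<forall>\<^sub>F y' in nhds y. \<psi> (p y') = \<eta> y'"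
proof -
  obtain \<tau> \<sigma> where t: "open (\<psi> ` W)" "entire \<tau>" "entire \<sigma>" "\<And>x. \<sigma> (\<tau> x) = x" "\<And>x. \<tau> (\<sigma> x) = x"
    "\<And>w. w \<in> W \<Longrightarrow> p (\<tau> (\<psi> w)) = w"
    using uniformized_chart[OF u c] by blast
  have "p y = p (\<tau> (\<psi> (p y)))" using t(6) y by simp
  then obtain \<gamma> where g: "\<gamma> \<in> \<Gamma>" "\<tau> (\<psi> (p y)) = \<gamma> y"
    using uniformized_eq_iff[OF u] by blast
  have e: "entire (\<sigma> \<circ> \<gamma>)" using entire_compose t(3) uniformized_entire[OF u g(1)] by blast
  have "(\<sigma> \<circ> \<gamma>) y \<in> \<psi> ` W" using g(2) t(4) y by (metis comp_apply imageI)
  then have "\<forall>\<^sub>F y' in nhds y. (\<sigma> \<circ> \<gamma>) y' \<in> \<psi> ` W"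
    by (rule entire_eventually[OF e t(1)])
  then have "\<forall>\<^sub>F y' in nhds y. \<psi> (p y') = (\<sigma> \<circ> \<gamma>) y'"
  proof (rule eventually_mono)
    fix y' assume "(\<sigma> \<circ> \<gamma>) y' \<in> \<psi> ` W"
    then obtain w where w: "w \<in> W" "\<sigma> (\<gamma> y') = \<psi> w" by auto
    then have "w = p (\<gamma> y')" using t(6)[OF w(1)] t(5)[of "\<gamma> y'"] by simp
    also have "\<dots> = p y'" using uniformized_eq_iff[OF u, of y' "\<gamma> y'"] g(1) by auto
    finally show "\<psi> (p y') = (\<sigma> \<circ> \<gamma>) y'" using w(2) by simp
  qed
  then show ?thesis using that e by blast
qed

lemma uniformized_continuous_map:
  assumes "uniformized M p \<Gamma>"
  shows "continuous_map euclidean (mtop M) p"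
  by (auto simp: continuous_map_def uniformized_topspace[OF assms] uniformized_openin[OF assms] vimage_def)

text \<open>In charts, \<open>f\<close> is \<open>F\<close> composed with coordinate changes and deck transformations.\<close>

lemma holomorphic_map_descends:
  assumes u: "uniformized M p \<Gamma>" and u': "uniformized M' p' \<Gamma>'"
    and F: "entire F" and f: "\<And>x. p' (F x) = f (p x)"
  shows "holomorphic_map M M' f"
  unfolding holomorphic_map_def
proof (intro conjI ballI, goal_cases)
  case 1
  have "open (p -` {m \<in> range p. f m \<in> U})" if "open (p' -` U)" for U
  proof -
    have "p -` {m \<in> range p. f m \<in> U} = F -` (p' -` U)" using f by auto
    then show ?thesis using open_vimage[OF that entire_continuous[OF F]] by simp
  qed
  moreover have "f (p x) \<in> range p'" for x by (simp flip: f)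
  ultimately show ?case
    unfolding continuous_map_def uniformized_topspace[OF u] uniformized_topspace[OF u']
      uniformized_openin[OF u] uniformized_openin[OF u'] by auto
next
  case (2 chart)
  obtain W \<phi> where c: "chart = (W, \<phi>)" by force
  have "holomorphic_vec_on (\<psi> \<circ> f \<circ> inv_into W \<phi>) (\<phi> ` {x \<in> W. f x \<in> W'})"
    if c': "(W', \<psi>) \<in> atlas M'" for W' \<psi>
    unfolding holomorphic_vec_on_def
  proof
    fix v assume "v \<in> \<phi> ` {x \<in> W. f x \<in> W'}"
    then obtain w where w: "w \<in> W" "f w \<in> W'" "v = \<phi> w" by auto
    obtain \<tau> \<sigma> where t: "open (\<phi> ` W)" "entire \<tau>" "entire \<sigma>" "\<And>x. \<sigma> (\<tau> x) = x" "\<And>x. \<tau> (\<sigma> x) = x"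
      "\<And>w. w \<in> W \<Longrightarrow> p (\<tau> (\<phi> w)) = w"
      using uniformized_chart[OF u] 2 c by blast
    have inv: "inv_into W \<phi> x = p (\<tau> x)" if "x \<in> \<phi> ` W" for x
      using that t(6) inv_into_f_f[of \<phi> W] by (metis f_inv_into_f inv_into_into)
    have "p' (F (\<tau> v)) \<in> W'" using w f t(6) by simp
    then obtain \<eta> where e: "entire \<eta>" "\<forall>\<^sub>F y in nhds (F (\<tau> v)). \<psi> (p' y) = \<eta> y"
      using chart_projection_local[OF u' c'] by blast
    obtain S where S: "open S" "F (\<tau> v) \<in> S" "\<And>y. y \<in> S \<Longrightarrow> \<psi> (p' y) = \<eta> y"
      using e(2) unfolding eventually_nhds by blast
    have eF: "entire (F \<circ> \<tau>)" using entire_compose[OF F t(2)] .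
    have "\<forall>\<^sub>F x in nhds v. (F \<circ> \<tau>) x \<in> S"
      by (rule entire_eventually[OF eF S(1)]) (use S in auto)
    moreover have "\<forall>\<^sub>F x in nhds v. x \<in> \<phi> ` W"
      by (rule eventually_nhds_in_open[OF t(1)]) (use w in auto)
    ultimately have ev: "\<forall>\<^sub>F x in nhds v. (\<eta> \<circ> (F \<circ> \<tau>)) x = (\<psi> \<circ> f \<circ> inv_into W \<phi>) x"
    proof eventually_elim
      case (elim x)
      then show ?case using S(3) inv f by (metis comp_apply)
    qed
    obtain D where D: "complex_linear D" "((\<eta> \<circ> (F \<circ> \<tau>)) has_derivative D) (at v)"
      using entire_compose[OF e(1) eF] unfolding holomorphic_vec_on_def by blast
    have "((\<psi> \<circ> f \<circ> inv_into W \<phi>) has_derivative D) (at v)"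
      by (rule has_derivative_transform_eventually[OF D(2)])
         (use ev eventually_nhds_x_imp_x[OF ev] in \<open>auto simp: eventually_at_filter elim: eventually_mono\<close>)
    then show "\<exists>D. complex_linear D \<and> (\<psi> \<circ> f \<circ> inv_into W \<phi> has_derivative D) (at v)"
      using D(1) by blast
  qed
  then show ?case using c by auto
qed

text \<open>Near a point, \<open>F\<close> is the expression of \<open>f\<close> in charts that invert the projections there.\<close>

lemma lift_of_holomorphic_map:
  assumes u: "uniformized M p \<Gamma>" and u': "uniformized M' p' \<Gamma>'"
    and F: "continuous_on UNIV F" and f: "\<And>x. p' (F x) = f (p x)"
    and hol: "holomorphic_map M M' f"
  shows "entire F"
  unfolding holomorphic_vec_on_def
proof
  fix x
  obtain W \<phi> where c: "(W, \<phi>) \<in> atlas M" "x \<in> \<phi> ` W" "\<And>w. w \<in> W \<Longrightarrow> p (\<phi> w) = w" "open (\<phi> ` W)"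
    using uniformized_section[OF u, of x] by blast
  obtain W' \<psi> where c': "(W', \<psi>) \<in> atlas M'" "F x \<in> \<psi> ` W'" "\<And>w. w \<in> W' \<Longrightarrow> p' (\<psi> w) = w"
      "open (\<psi> ` W')"
    using uniformized_section[OF u', of "F x"] by blast
  have inv: "inv_into W \<phi> x = p x" if "x \<in> \<phi> ` W" for x
    using that c(3) by (metis f_inv_into_f inv_into_into)
  have sec: "\<psi> (p' y) = y" if "y \<in> \<psi> ` W'" for y
    using that c'(3) by auto
  have "f (p x) \<in> W'" using c'(2,3) f by (metis imageE)
  then have "x \<in> \<phi> ` {w \<in> W. f w \<in> W'}" using c(2,3) by auto
  moreover have "holomorphic_vec_on (\<psi> \<circ> f \<circ> inv_into W \<phi>) (\<phi> ` {w \<in> W. f w \<in> W'})"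
    using hol c(1) c'(1) unfolding holomorphic_map_def by blast
  ultimately obtain D where D: "complex_linear D" "((\<psi> \<circ> f \<circ> inv_into W \<phi>) has_derivative D) (at x)"
    unfolding holomorphic_vec_on_def by blast
  have "\<forall>\<^sub>F y in nhds x. y \<in> \<phi> ` W"
    by (rule eventually_nhds_in_open[OF c(4) c(2)])
  moreover have "\<forall>\<^sub>F y in nhds x. y \<in> F -` (\<psi> ` W')"
    by (rule eventually_nhds_in_open) (use open_vimage[OF c'(4) F] c'(2) in auto)
  ultimately have ev: "\<forall>\<^sub>F y in nhds x. (\<psi> \<circ> f \<circ> inv_into W \<phi>) y = F y"
  proof eventually_elim
    case (elim y)
    then show ?case using inv[of y] sec[of "F y"] f[of y] by simp
  qed
  have "(F has_derivative D) (at x)"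
    by (rule has_derivative_transform_eventually[OF D(2)])
       (use ev eventually_nhds_x_imp_x[OF ev] in \<open>auto simp: eventually_at_filter elim: eventually_mono\<close>)
  then show "\<exists>D. complex_linear D \<and> (F has_derivative D) (at x)" using D(1) by blast
qed

text \<open>Uniformizations pass to quotients.  The two steps \<open>V \<rightarrow> T\<close> and \<open>T \<rightarrow> T/G~\<close>, and also the flat models, are
  instances.  Local freeness makes the orbit map injective on small open sets, so that the quotient has
  charts inverting the projection.\<close>

lemma uniformized_quotient_manifold:
  assumes u: "uniformized M p \<Gamma>"
    and eq: "\<And>x y. orbit_of H (p x) = orbit_of H (p y) \<longleftrightarrow> (\<exists>\<gamma>\<in>\<Gamma>'. y = \<gamma> x)"
    and hol: "\<And>\<gamma>. \<gamma> \<in> \<Gamma>' \<Longrightarrow> entire \<gamma>"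
    and disc: "\<And>x. \<exists>U. open U \<and> x \<in> U \<and> (\<forall>\<gamma>\<in>\<Gamma>'. \<forall>y\<in>U. \<gamma> y \<in> U \<longrightarrow> \<gamma> y = y)"
  shows "uniformized (quotient_manifold M H) (orbit_of H \<circ> p) \<Gamma>'"
proof -
  let ?r = "orbit_of H" and ?N = "quotient_manifold M H"
  have top: "openin (mtop ?N) U \<longleftrightarrow> U \<subseteq> range (?r \<circ> p) \<and> open ((?r \<circ> p) -` U)" for U
  proof -
    have "p -` {x \<in> range p. ?r x \<in> U} = (?r \<circ> p) -` U" by auto
    then show ?thesis
      by (simp add: quotient_manifold_def openin_quotient_top uniformized_topspace[OF u]
          uniformized_openin[OF u] image_comp)
  qed
  have charts: "open (\<psi> ` W) \<and> (\<exists>\<tau> \<sigma>. entire \<tau> \<and> entire \<sigma> \<and> (\<forall>x. \<sigma> (\<tau> x) = x) \<and> (\<forall>x. \<tau> (\<sigma> x) = x) \<and>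
      (\<forall>w\<in>W. (?r \<circ> p) (\<tau> (\<psi> w)) = w))" if at: "(W, \<psi>) \<in> atlas ?N" for W \<psi>
  proof -
    obtain U' U \<phi> where c: "W = ?r ` U'" "\<psi> = \<phi> \<circ> inv_into U' ?r" "(U, \<phi>) \<in> atlas M"
        "U' \<subseteq> U" "openin (mtop M) U'" "inj_on ?r U'"
      using at by (auto simp: quotient_manifold_def)
    obtain \<tau> \<sigma> where t: "open (\<phi> ` U)" "entire \<tau>" "entire \<sigma>" "\<And>x. \<sigma> (\<tau> x) = x" "\<And>x. \<tau> (\<sigma> x) = x"
      "\<And>w. w \<in> U \<Longrightarrow> p (\<tau> (\<phi> w)) = w"
      using uniformized_chart[OF u c(3)] by blast
    have img: "\<psi> ` W = \<phi> ` U'"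
      using c(1,2) inv_into_f_f[OF c(6)] by (force simp: image_image)
    also have "\<phi> ` U' = \<phi> ` U \<inter> (p \<circ> \<tau>) -` U'"
    proof (intro Set.set_eqI iffI)
      fix v assume "v \<in> \<phi> ` U'"
      then obtain a where "a \<in> U'" "v = \<phi> a" by blast
      then show "v \<in> \<phi> ` U \<inter> (p \<circ> \<tau>) -` U'" using c(4) t(6)[of a] by auto
    next
      fix v assume "v \<in> \<phi> ` U \<inter> (p \<circ> \<tau>) -` U'"
      then obtain a where "a \<in> U" "v = \<phi> a" "p (\<tau> v) \<in> U'" by auto
      then show "v \<in> \<phi> ` U'" using t(6)[of a] by simp
    qed
    finally have "\<psi> ` W = \<phi> ` U \<inter> \<tau> -` (p -` U')" by (simp add: vimage_comp comp_def)
    moreover have "open (\<tau> -` (p -` U'))"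
      using c(5) uniformized_openin[OF u] open_vimage[OF _ entire_continuous[OF t(2)]] by blast
    ultimately have "open (\<psi> ` W)" using t(1) by auto
    moreover have "(?r \<circ> p) (\<tau> (\<psi> w)) = w" if w: "w \<in> W" for w
    proof -
      obtain a where a: "a \<in> U'" "w = ?r a" using w c(1) by auto
      then have "\<psi> w = \<phi> a" using c(2,6) by simp
      then show ?thesis using a c(4) t(6)[of a] by auto
    qed
    ultimately show ?thesis using t(2-5) by blast
  qed
  have sections: "\<exists>(W, \<psi>) \<in> atlas ?N. x \<in> \<psi> ` W \<and> (\<forall>w\<in>W. (?r \<circ> p) (\<psi> w) = w)" for x
  proof -
    obtain U \<phi> where c: "(U, \<phi>) \<in> atlas M" "x \<in> \<phi> ` U" "\<And>w. w \<in> U \<Longrightarrow> p (\<phi> w) = w" "open (\<phi> ` U)"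
      using uniformized_section[OF u, of x] by blast
    obtain S where S: "open S" "x \<in> S" "\<And>\<gamma> y. \<gamma> \<in> \<Gamma>' \<Longrightarrow> y \<in> S \<Longrightarrow> \<gamma> y \<in> S \<Longrightarrow> \<gamma> y = y"
      using disc[of x] by blast
    let ?U' = "p ` (S \<inter> \<phi> ` U)"
    have sub: "?U' \<subseteq> U" using c(3) by auto
    have "p -` ?U' = (\<Union>\<gamma>\<in>\<Gamma>. \<gamma> -` (S \<inter> \<phi> ` U))"
    proof (intro Set.set_eqI iffI)
      fix y assume "y \<in> p -` ?U'"
      then obtain z where z: "z \<in> S \<inter> \<phi> ` U" "p y = p z" by auto
      then obtain \<gamma> where "\<gamma> \<in> \<Gamma>" "z = \<gamma> y" using uniformized_eq_iff[OF u, of y z] by auto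
      then show "y \<in> (\<Union>\<gamma>\<in>\<Gamma>. \<gamma> -` (S \<inter> \<phi> ` U))" using z(1) by auto
    next
      fix y assume "y \<in> (\<Union>\<gamma>\<in>\<Gamma>. \<gamma> -` (S \<inter> \<phi> ` U))"
      then obtain \<gamma> where g: "\<gamma> \<in> \<Gamma>" "\<gamma> y \<in> S \<inter> \<phi> ` U" by auto
      then have "p y = p (\<gamma> y)" using uniformized_eq_iff[OF u, of y "\<gamma> y"] by auto
      then show "y \<in> p -` ?U'" using g(2) by simp
    qed
    moreover have "open (\<gamma> -` (S \<inter> \<phi> ` U))" if "\<gamma> \<in> \<Gamma>" for \<gamma>
      using open_vimage[of "S \<inter> \<phi> ` U" \<gamma>] entire_continuous uniformized_entire[OF u that] S(1) c(4) by blast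
    ultimately have op: "openin (mtop M) ?U'"
      by (auto simp: uniformized_openin[OF u])
    have inj: "inj_on ?r ?U'"
    proof (rule inj_onI)
      fix a b assume "a \<in> ?U'" "b \<in> ?U'" "?r a = ?r b"
      then obtain y y' where y: "y \<in> S" "y' \<in> S" "a = p y" "b = p y'" by blast
      with \<open>?r a = ?r b\<close> obtain \<gamma> where "\<gamma> \<in> \<Gamma>'" "y' = \<gamma> y" using eq by auto
      then show "a = b" using S(3)[of \<gamma> y] y by simp
    qed
    let ?\<psi> = "\<phi> \<circ> inv_into ?U' ?r"
    have at: "(?r ` ?U', ?\<psi>) \<in> atlas ?N"
      using c(1) sub op inj unfolding quotient_manifold_def by (simp only: cmanifold.simps mem_Collect_eq) blast
    have psi: "?\<psi> (?r a) = \<phi> a" if "a \<in> ?U'" for a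
      using inj that by simp
    have "p x \<in> ?U'" using S(2) c(2) by auto
    moreover have "\<phi> (p x) = x" using c(2,3) by auto
    ultimately have "x \<in> ?\<psi> ` (?r ` ?U')" using psi by (metis image_eqI)
    moreover have "\<forall>w\<in>?r ` ?U'. (?r \<circ> p) (?\<psi> w) = w"
    proof
      fix w assume "w \<in> ?r ` ?U'"
      then obtain a where a: "a \<in> ?U'" "w = ?r a" by blast
      then have "p (\<phi> a) = a" using sub c(3) by blast
      then show "(?r \<circ> p) (?\<psi> w) = w" using psi[OF a(1)] a(2) by (metis comp_apply)
    qed
    ultimately show ?thesis using at by (intro bexI[of _ "(?r ` ?U', ?\<psi>)"]) simp_all
  qed
  show ?thesis
    unfolding uniformized_def
  proof (intro conjI)
    show "\<forall>U. openin (mtop ?N) U \<longleftrightarrow> U \<subseteq> range (?r \<circ> p) \<and> open ((?r \<circ> p) -` U)"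
      using top by (rule allI)
    show "\<forall>(W, \<psi>)\<in>atlas ?N. open (\<psi> ` W) \<and> (\<exists>\<tau> \<sigma>. entire \<tau> \<and> entire \<sigma> \<and> (\<forall>x. \<sigma> (\<tau> x) = x) \<and>
        (\<forall>x. \<tau> (\<sigma> x) = x) \<and> (\<forall>w\<in>W. (?r \<circ> p) (\<tau> (\<psi> w)) = w))"
      by (rule ballI, rule prod.case_eq_if[THEN iffD2], rule charts) simp
    show "\<forall>x. \<exists>(W, \<psi>)\<in>atlas ?N. x \<in> \<psi> ` W \<and> (\<forall>w\<in>W. (?r \<circ> p) (\<psi> w) = w)"
      using sections by (rule allI)
    show "\<forall>\<gamma>\<in>\<Gamma>'. entire \<gamma>" using hol by (rule ballI)
    show "\<forall>x y. ((?r \<circ> p) x = (?r \<circ> p) y) = (\<exists>\<gamma>\<in>\<Gamma>'. y = \<gamma> x)"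
      using eq by simp
  qed
qed


section \<open>Lifting to the universal cover\<close>

text \<open>The real linear coordinates \<open>B\<close> only serve to turn deck transformations into isometries; they need not
  respect the complex structure.\<close>

locale deck_group =
  fixes \<Gamma> :: "(complex ^ 'n::finite \<Rightarrow> complex ^ 'n) set" and B :: "complex ^ 'n \<Rightarrow> 'e::euclidean_space"
  assumes id_mem: "id \<in> \<Gamma>"
    and comp_mem: "\<gamma> \<in> \<Gamma> \<Longrightarrow> \<delta> \<in> \<Gamma> \<Longrightarrow> \<gamma> \<circ> \<delta> \<in> \<Gamma>"
    and left_inverse: "\<gamma> \<in> \<Gamma> \<Longrightarrow> \<exists>\<delta>\<in>\<Gamma>. \<delta> \<circ> \<gamma> = id"
    and entire_deck: "\<gamma> \<in> \<Gamma> \<Longrightarrow> entire \<gamma>"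
    and linear_B: "linear B" and bij_B: "bij B"
    and isometric: "\<gamma> \<in> \<Gamma> \<Longrightarrow> dist (B (\<gamma> x)) (B (\<gamma> y)) = dist (B x) (B y)"
    and displaces: "\<exists>U. open U \<and> x \<in> U \<and> (\<forall>\<gamma>\<in>\<Gamma>. \<gamma> x \<in> U \<longrightarrow> \<gamma> = id)"
begin

definition C :: "'e \<Rightarrow> complex ^ 'n" where "C = inv_into UNIV B"

lemma C_B [simp]: "C (B x) = x" and B_C [simp]: "B (C y) = y"
  using bij_B by (simp_all add: C_def bij_is_inj bij_is_surj surj_f_inv_f)

lemma B_eq_iff [simp]: "B x = B y \<longleftrightarrow> x = y"
  by (metis C_B)

lemma linear_C: "linear C"
proof (rule linearI)
  show "C (x + y) = C x + C y" for x y
    using linear_add[OF linear_B, of "C x" "C y"] C_B[of "C x + C y"] by simp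
  show "C (r *\<^sub>R x) = r *\<^sub>R C x" for r x
    using linear_scale[OF linear_B, of r "C x"] C_B[of "r *\<^sub>R C x"] by simp
qed

lemma continuous_B: "continuous_on S B" and continuous_C: "continuous_on T C"
  using linear_B linear_C by (simp_all add: linear_continuous_on linear_conv_bounded_linear)

lemma two_sided_inverse:
  assumes "\<gamma> \<in> \<Gamma>"
  obtains \<delta> where "\<delta> \<in> \<Gamma>" "\<And>x. \<delta> (\<gamma> x) = x" "\<And>x. \<gamma> (\<delta> x) = x"
proof -
  obtain \<delta> where d: "\<delta> \<in> \<Gamma>" "\<delta> \<circ> \<gamma> = id" using left_inverse[OF assms] by blast
  obtain \<epsilon> where e: "\<epsilon> \<in> \<Gamma>" "\<epsilon> \<circ> \<delta> = id" using left_inverse[OF d(1)] by blast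
  have "\<epsilon> = \<gamma>"
    by (metis comp_assoc comp_id d(2) e(2) id_comp)
  then show ?thesis using that[OF d(1)] d(2) e(2)
    by (metis comp_apply id_apply)
qed

lemma fixed_point_free: "\<gamma> \<in> \<Gamma> \<Longrightarrow> \<gamma> x = x \<Longrightarrow> \<gamma> = id"
  using displaces[of x] by auto

lemma displacement:
  obtains r where "r > 0" "\<And>\<gamma>. \<gamma> \<in> \<Gamma> \<Longrightarrow> \<gamma> \<noteq> id \<Longrightarrow> r \<le> dist (B x) (B (\<gamma> x))"
proof -
  obtain U where U: "open U" "x \<in> U" "\<And>\<gamma>. \<gamma> \<in> \<Gamma> \<Longrightarrow> \<gamma> x \<in> U \<Longrightarrow> \<gamma> = id"
    using displaces[of x] by blast
  have "open (C -` U)" using open_vimage[OF U(1) continuous_C] .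
  moreover have "B x \<in> C -` U" using U(2) by simp
  ultimately obtain r where r: "r > 0" "ball (B x) r \<subseteq> C -` U" using openE by blast
  have "r \<le> dist (B x) (B (\<gamma> x))" if "\<gamma> \<in> \<Gamma>" "\<gamma> \<noteq> id" for \<gamma>
  proof (rule ccontr)
    assume "\<not> r \<le> dist (B x) (B (\<gamma> x))"
    then have "B (\<gamma> x) \<in> ball (B x) r" by simp
    then have "B (\<gamma> x) \<in> C -` U" using r(2) by blast
    then show False using U(3) that by simp
  qed
  then show ?thesis using that r(1) by blast
qed

text \<open>A point near \<open>x\<close> is moved about as far as \<open>x\<close>, because the action is isometric.\<close>

lemma wandering_neighbourhood:
  "\<exists>U. open U \<and> x \<in> U \<and> (\<forall>\<gamma>\<in>\<Gamma>. \<forall>y\<in>U. \<gamma> y \<in> U \<longrightarrow> \<gamma> y = y)"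
proof -
  obtain r where r: "r > 0" "\<And>\<gamma>. \<gamma> \<in> \<Gamma> \<Longrightarrow> \<gamma> \<noteq> id \<Longrightarrow> r \<le> dist (B x) (B (\<gamma> x))"
    using displacement by blast
  let ?U = "B -` ball (B x) (r/2)"
  have "open ?U" using open_vimage[OF open_ball continuous_B] .
  moreover have "\<gamma> y = y" if g: "\<gamma> \<in> \<Gamma>" "y \<in> ?U" "\<gamma> y \<in> ?U" for \<gamma> y
  proof -
    have "dist (B x) (B (\<gamma> x)) \<le> dist (B x) (B (\<gamma> y)) + dist (B (\<gamma> y)) (B (\<gamma> x))"
      by (rule dist_triangle)
    also have "dist (B (\<gamma> y)) (B (\<gamma> x)) = dist (B x) (B y)"
      using isometric[OF g(1)] by (simp add: dist_commute)
    finally have "dist (B x) (B (\<gamma> x)) < r" using g(2,3) by simp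
    then have "\<gamma> = id" using r(2)[OF g(1)] by force
    then show ?thesis by simp
  qed
  ultimately show ?thesis using r(1) by (intro exI[of _ ?U]) auto
qed

definition \<Delta> :: "('e \<Rightarrow> 'e) set" where "\<Delta> = (\<lambda>\<gamma>. B \<circ> \<gamma> \<circ> C) ` \<Gamma>"

sublocale E: isometric_deck_group \<Delta>
proof
  show "id \<in> \<Delta>" using id_mem by (force simp: \<Delta>_def)
  show "\<gamma> \<circ> \<delta> \<in> \<Delta>" if gd: "\<gamma> \<in> \<Delta>" "\<delta> \<in> \<Delta>" for \<gamma> \<delta>
  proof -
    obtain a b where ab: "a \<in> \<Gamma>" "b \<in> \<Gamma>" "\<gamma> = B \<circ> a \<circ> C" "\<delta> = B \<circ> b \<circ> C"
      using gd by (auto simp: \<Delta>_def)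
    then have "\<gamma> \<circ> \<delta> = B \<circ> (a \<circ> b) \<circ> C" by (auto simp: fun_eq_iff)
    then show ?thesis using comp_mem[OF ab(1,2)] by (auto simp: \<Delta>_def)
  qed
  show "\<exists>\<delta>\<in>\<Delta>. \<delta> \<circ> \<gamma> = id" if g: "\<gamma> \<in> \<Delta>" for \<gamma>
  proof -
    obtain a where a: "a \<in> \<Gamma>" "\<gamma> = B \<circ> a \<circ> C" using g by (auto simp: \<Delta>_def)
    obtain b where b: "b \<in> \<Gamma>" "b \<circ> a = id" using left_inverse[OF a(1)] by blast
    have "(B \<circ> b \<circ> C) \<circ> \<gamma> = id" using a b by (auto simp: fun_eq_iff)
    then show ?thesis using b(1) by (auto simp: \<Delta>_def)
  qed
  show "dist (\<gamma> x) (\<gamma> y) = dist x y" if "\<gamma> \<in> \<Delta>" for \<gamma> x y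
    using that isometric[of _ "C x" "C y"] by (auto simp: \<Delta>_def)
  show "\<exists>r>0. \<forall>\<gamma>\<in>\<Delta>. \<gamma> \<noteq> id \<longrightarrow> r \<le> dist x (\<gamma> x)" for x
  proof -
    obtain r where r: "r > 0" "\<And>\<gamma>. \<gamma> \<in> \<Gamma> \<Longrightarrow> \<gamma> \<noteq> id \<Longrightarrow> r \<le> dist (B (C x)) (B (\<gamma> (C x)))"
      using displacement[of "C x"] by blast
    have "r \<le> dist x (\<gamma> x)" if g: "\<gamma> \<in> \<Delta>" "\<gamma> \<noteq> id" for \<gamma>
    proof -
      obtain a where a: "a \<in> \<Gamma>" "\<gamma> = B \<circ> a \<circ> C" using g by (auto simp: \<Delta>_def)
      have "a \<noteq> id"
      proof
        assume "a = id"
        then have "\<gamma> = id" using a(2) by (simp add: fun_eq_iff)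
        then show False using g(2) by simp
      qed
      then show ?thesis using r(2)[OF a(1)] a(2) by simp
    qed
    then show ?thesis using r(1) by blast
  qed
qed

lemma orbit_dist_B: "E.orbit_dist (B x) = E.orbit_dist (B y) \<longleftrightarrow> (\<exists>\<gamma>\<in>\<Gamma>. y = \<gamma> x)"
  unfolding E.orbit_dist_eq_iff by (auto simp: \<Delta>_def)

text \<open>\<open>M\<close> and the space of distance functions are both the set of orbits, so a map into \<open>M\<close> can be lifted as a
  map into that function space.\<close>

lemma lift_continuous_map:
  assumes u: "uniformized M p \<Gamma>" and f: "continuous_map euclidean (mtop M) f"
  obtains F where "continuous_on UNIV F" "\<And>x :: 'v::euclidean_space. p (F x) = f x"
proof -
  define j where "j = (\<lambda>m. E.orbit_dist (B (inv_into UNIV p m)))"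
  have j: "j (p x) = E.orbit_dist (B x)" for x
  proof -
    have "p (inv_into UNIV p (p x)) = p x" by (simp add: f_inv_into_f)
    then show ?thesis unfolding j_def orbit_dist_B uniformized_eq_iff[OF u] .
  qed
  have rf: "f x \<in> range p" for x
    using f by (auto simp: continuous_map_def uniformized_topspace[OF u])
  have "continuous_on UNIV (j \<circ> f)"
  proof (subst continuous_on_open_vimage, simp, intro allI impI)
    fix O' :: "('e \<Rightarrow>\<^sub>C real) set" assume O: "open O'"
    let ?U = "range p \<inter> j -` O'"
    have "p -` ?U = (\<lambda>x. j (p x)) -` O'" by auto
    then have "p -` ?U = (\<lambda>x. E.orbit_dist (B x)) -` O'" by (simp only: j)
    moreover have "continuous_on UNIV (\<lambda>x. E.orbit_dist (B x))"
      using continuous_on_compose2[OF E.continuous_orbit_dist[of UNIV] continuous_B[of UNIV]] by simp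
    ultimately have "openin (mtop M) ?U"
      using open_vimage[OF O] by (auto simp: uniformized_openin[OF u])
    then have "open {x. f x \<in> ?U}"
      using openin_continuous_map_preimage[OF f] by fastforce
    moreover have "{x. f x \<in> ?U} = (j \<circ> f) -` O' \<inter> UNIV" using rf by auto
    ultimately show "open ((j \<circ> f) -` O' \<inter> UNIV)" by simp
  qed
  moreover have "range (j \<circ> f) \<subseteq> range E.orbit_dist"
    by (auto simp: j_def)
  ultimately obtain F where F: "continuous_on UNIV F" "\<And>x. E.orbit_dist (F x) = (j \<circ> f) x"
    using E.lift_to_cover by blast
  have "p (C (F x)) = f x" for x
  proof -
    obtain y where y: "f x = p y" using rf by blast
    have "E.orbit_dist (B (C (F x))) = E.orbit_dist (B y)" using F(2)[of x] y j by simp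
    then show ?thesis unfolding orbit_dist_B uniformized_eq_iff[OF u, symmetric] using y by simp
  qed
  moreover have "continuous_on UNIV (\<lambda>x. C (F x))"
    using continuous_on_compose2[OF continuous_C[of UNIV] F(1)] by simp
  ultimately show ?thesis using that by blast
qed

lemma lifts_differ_by_deck:
  fixes F F' :: "'v::euclidean_space \<Rightarrow> complex ^ 'n"
  assumes u: "uniformized M p \<Gamma>"
    and F: "continuous_on UNIV F" "continuous_on UNIV F'" and eq: "\<And>x. p (F x) = p (F' x)"
  obtains \<gamma> where "\<gamma> \<in> \<Gamma>" "\<And>x. F' x = \<gamma> (F x)"
proof -
  have "continuous_on UNIV (\<lambda>x. B (F x))" "continuous_on UNIV (\<lambda>x. B (F' x))"
    using continuous_on_compose2[OF continuous_B[of UNIV] F(1)]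
      continuous_on_compose2[OF continuous_B[of UNIV] F(2)] by simp_all
  moreover have "E.orbit_dist (B (F x)) = E.orbit_dist (B (F' x))" for x
    using eq[of x] unfolding orbit_dist_B uniformized_eq_iff[OF u] .
  ultimately obtain \<delta> where d: "\<delta> \<in> \<Delta>" "\<And>x. B (F' x) = \<delta> (B (F x))"
    using E.lifts_differ_by_deck[of "\<lambda>x. B (F x)" "\<lambda>x. B (F' x)"] by blast
  obtain \<gamma> where g: "\<gamma> \<in> \<Gamma>" "\<delta> = B \<circ> \<gamma> \<circ> C" using d(1) by (auto simp: \<Delta>_def)
  have "F' x = \<gamma> (F x)" for x using d(2)[of x] g(2) by simp
  then show ?thesis using that g(1) by blast
qed

end

text \<open>Lifts of \<open>f\<close> and of its inverse compose to a lift of the identity, that is, to a deck transformation;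
  correcting one lift by it makes the two lifts inverse to each other.  A conjugate of a deck
  transformation again lifts the identity.\<close>

theorem biholomorphic_map_lifts:
  assumes d: "deck_group \<Gamma> B" and d': "deck_group \<Gamma>' B'"
    and u: "uniformized M p \<Gamma>" and u': "uniformized M' p' \<Gamma>'"
    and f: "biholomorphic_map M M' f"
  obtains F G where "entire F" "entire G" "\<And>x. F (G x) = x" "\<And>x. G (F x) = x"
    "\<And>x. p' (F x) = f (p x)" "\<And>\<gamma>. \<gamma> \<in> \<Gamma> \<Longrightarrow> F \<circ> \<gamma> \<circ> G \<in> \<Gamma>'" "\<And>\<gamma>. \<gamma> \<in> \<Gamma>' \<Longrightarrow> G \<circ> \<gamma> \<circ> F \<in> \<Gamma>"
proof -
  interpret D: deck_group \<Gamma> B by (rule d)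
  interpret D': deck_group \<Gamma>' B' by (rule d')
  define g where "g = inv_into (range p) f"
  have bij: "bij_betw f (range p) (range p')" and hf: "holomorphic_map M M' f" and hg: "holomorphic_map M' M g"
    using f unfolding biholomorphic_map_def g_def uniformized_topspace[OF u] uniformized_topspace[OF u'] by auto
  have gf: "g (f (p x)) = p x" for x
    using bij by (simp add: g_def bij_betw_inv_into_left)
  have fg: "f (g (p' x)) = p' x" for x
    using bij by (simp add: g_def bij_betw_inv_into_right)
  have cont: "continuous_map euclidean (mtop M') (f \<circ> p)" "continuous_map euclidean (mtop M) (g \<circ> p')"
    using hf hg uniformized_continuous_map[OF u] uniformized_continuous_map[OF u']
    by (auto simp: holomorphic_map_def intro: continuous_map_compose)
  obtain F where F: "continuous_on UNIV F" "\<And>x. p' (F x) = (f \<circ> p) x"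
    using D'.lift_continuous_map[OF u' cont(1)] by blast
  obtain G0 where G0: "continuous_on UNIV G0" "\<And>x. p (G0 x) = (g \<circ> p') x"
    using D.lift_continuous_map[OF u cont(2)] by blast
  have "continuous_on UNIV (\<lambda>x. G0 (F x))"
    using continuous_on_compose2[OF G0(1) F(1)] by simp
  moreover have "p x = p (G0 (F x))" for x using F(2) G0(2) gf by simp
  ultimately obtain \<gamma> where g0: "\<gamma> \<in> \<Gamma>" "\<And>x. G0 (F x) = \<gamma> x"
    using D.lifts_differ_by_deck[OF u continuous_on_id, of "\<lambda>x. G0 (F x)"] by blast
  obtain \<delta> where dl: "\<delta> \<in> \<Gamma>" "\<And>x. \<delta> (\<gamma> x) = x" "\<And>x. \<gamma> (\<delta> x) = x"
    using D.two_sided_inverse[OF g0(1)] by blast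
  define G where "G = \<delta> \<circ> G0"
  have contG: "continuous_on UNIV G"
    unfolding G_def
    using continuous_on_compose[OF G0(1)] entire_continuous[OF D.entire_deck[OF dl(1)]]
      continuous_on_subset by blast
  have GF: "G (F x) = x" for x by (simp add: G_def g0(2) dl(2))
  have pG: "p (G y) = g (p' y)" for y
    using G0(2)[of y] uniformized_eq_iff[OF u, of "G0 y" "G y"] dl(1) by (auto simp: G_def)
  have cFG: "continuous_on UNIV (\<lambda>y. F (G y))"
    using continuous_on_compose2[OF F(1) contG] by simp
  have "p' y = p' (F (G y))" for y using F(2) pG fg by simp
  then obtain \<gamma>' where g': "\<gamma>' \<in> \<Gamma>'" "\<And>y. F (G y) = \<gamma>' y"
    using D'.lifts_differ_by_deck[OF u' continuous_on_id cFG] by blast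
  \<comment> \<open>\<open>\<gamma>' \<circ> F = F \<circ> G \<circ> F = F\<close>, so \<open>\<gamma>'\<close> has fixed points.\<close>
  have "\<gamma>' (F 0) = F 0" using g'(2)[of "F 0"] GF by simp
  then have "\<gamma>' = id" using D'.fixed_point_free[OF g'(1)] by blast
  then have FG: "F (G y) = y" for y using g'(2) by simp
  have eF: "entire F" by (rule lift_of_holomorphic_map[OF u u' F(1) _ hf]) (use F(2) in simp)
  have eG: "entire G" by (rule lift_of_holomorphic_map[OF u' u contG _ hg]) (use pG in simp)
  have "F \<circ> \<alpha> \<circ> G \<in> \<Gamma>'" if a: "\<alpha> \<in> \<Gamma>" for \<alpha>
  proof -
    have "p' y = p' ((F \<circ> \<alpha> \<circ> G) y)" for y
      using F(2) pG fg uniformized_eq_iff[OF u, of "G y" "\<alpha> (G y)"] a by (metis comp_apply)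
    then obtain \<beta> where "\<beta> \<in> \<Gamma>'" "\<And>y. (F \<circ> \<alpha> \<circ> G) y = \<beta> y"
      using D'.lifts_differ_by_deck[OF u' continuous_on_id, of "F \<circ> \<alpha> \<circ> G"]
        entire_continuous[OF entire_compose[OF entire_compose[OF eF D.entire_deck[OF a]] eG]] by blast
    then show ?thesis by (metis ext)
  qed
  moreover have "G \<circ> \<alpha> \<circ> F \<in> \<Gamma>" if a: "\<alpha> \<in> \<Gamma>'" for \<alpha>
  proof -
    have "p x = p ((G \<circ> \<alpha> \<circ> F) x)" for x
      using F(2) pG gf uniformized_eq_iff[OF u', of "F x" "\<alpha> (F x)"] a by (metis comp_apply)
    then obtain \<beta> where "\<beta> \<in> \<Gamma>" "\<And>y. (G \<circ> \<alpha> \<circ> F) y = \<beta> y"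
      using D.lifts_differ_by_deck[OF u continuous_on_id, of "G \<circ> \<alpha> \<circ> F"]
        entire_continuous[OF entire_compose[OF entire_compose[OF eG D'.entire_deck[OF a]] eF]] by blast
    then show ?thesis by (metis ext)
  qed
  ultimately show ?thesis using that[OF eF eG FG GF] F(2) by simp
qed

text \<open>The condition on the deck groups is what makes the induced map injective.\<close>

theorem biholomorphic_map_descends:
  assumes u: "uniformized M p \<Gamma>" and u': "uniformized M' p' \<Gamma>'"
    and e: "entire F" "entire G" and FG: "\<And>x. F (G x) = x" "\<And>x. G (F x) = x"
    and f: "\<And>x. p' (F x) = f (p x)"
    and conj: "\<And>\<gamma>. \<gamma> \<in> \<Gamma>' \<Longrightarrow> G \<circ> \<gamma> \<circ> F \<in> \<Gamma>"
  shows "biholomorphic_map M M' f"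
proof -
  have inj: "p x = p y" if eq: "p' (F x) = p' (F y)" for x y
  proof -
    obtain \<gamma> where g: "\<gamma> \<in> \<Gamma>'" "F y = \<gamma> (F x)" using eq uniformized_eq_iff[OF u'] by blast
    have "y = G (F y)" by (simp add: FG)
    then have "y = (G \<circ> \<gamma> \<circ> F) x" by (simp add: g(2))
    then show ?thesis using conj[OF g(1)] uniformized_eq_iff[OF u, of x y] by blast
  qed
  have ij: "inj_on f (range p)" by (rule inj_onI) (auto simp flip: f intro: inj)
  have "f ` range p = range (\<lambda>x. p' (F x))" by (simp add: f image_image)
  also have "\<dots> = range p'" using FG(1) by (auto simp: image_iff) metis
  finally have "f ` range p = range p'" .
  then have bij: "bij_betw f (range p) (range p')" using ij by (simp add: bij_betw_def)
  have "p (G y) = inv_into (range p) f (p' y)" for y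
    using ij f[of "G y"] FG(1)[of y] by (metis inv_into_f_f rangeI)
  then have "holomorphic_map M' M (inv_into (range p) f)"
    by (rule holomorphic_map_descends[OF u' u e(2)])
  then show ?thesis
    unfolding biholomorphic_map_def uniformized_topspace[OF u] uniformized_topspace[OF u']
    using bij holomorphic_map_descends[OF u u' e(1) f] by blast
qed


section \<open>Complex linear and affine maps\<close>

lemma scaleR_eq_scalar: "r *\<^sub>R x = complex_of_real r *s (x :: complex ^ 'n)"
  unfolding vec_eq_iff vector_scaleR_component vector_smult_component by (simp add: scaleR_conv_of_real)

lemma complex_linear_imp_linear: "complex_linear A \<Longrightarrow> linear A"
  by (rule linearI) (simp_all add: complex_linear_iff scaleR_eq_scalar)

lemma complex_linear_zero: "complex_linear A \<Longrightarrow> A 0 = 0"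
  by (rule linear_0[OF complex_linear_imp_linear])

lemma complex_linear_add: "complex_linear A \<Longrightarrow> A (x + y) = A x + A y"
  by (simp add: complex_linear_iff)

lemma complex_linear_diff: "complex_linear A \<Longrightarrow> A (x - y) = A x - A y"
  by (rule linear_diff[OF complex_linear_imp_linear])

lemma complex_linear_neg: "complex_linear A \<Longrightarrow> A (- x) = - A x"
  by (rule linear_neg[OF complex_linear_imp_linear])

lemma complex_linear_id: "complex_linear id"
  by (simp add: complex_linear_iff)

lemma entire_affine:
  assumes "complex_linear A"
  shows "entire (\<lambda>x. A x + c)"
  unfolding holomorphic_vec_on_def
proof
  fix x
  have "(A has_derivative A) (at x)"
    using complex_linear_imp_linear[OF assms] by (simp add: linear_imp_has_derivative)
  then have "((\<lambda>x. A x + c) has_derivative A) (at x)"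
    by (auto intro!: derivative_eq_intros)
  then show "\<exists>D. complex_linear D \<and> ((\<lambda>x. A x + c) has_derivative D) (at x)"
    using assms by blast
qed

lemma complex_linear_inverse:
  assumes "complex_linear A" "\<And>x. A (B x) = x" "\<And>x. B (A x) = x"
  shows "complex_linear B"
  unfolding complex_linear_iff
proof (intro conjI allI)
  fix x y show "B (x + y) = B x + B y"
    using assms(2,3) complex_linear_add[OF assms(1), of "B x" "B y"] by metis
next
  fix c x
  have "A (c *s B x) = c *s x" using assms(1,2) by (simp add: complex_linear_iff)
  then show "B (c *s x) = c *s B x" using assms(3) by metis
qed

lemma entire_component_along_line:
  fixes F :: "complex ^ 'n \<Rightarrow> complex ^ 'm"
  assumes "entire F"
  shows "(\<lambda>w. F (a + w *s v) $ i) holomorphic_on UNIV"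
proof -
  have "(\<lambda>w. F (a + w *s v) $ i) field_differentiable (at w)" for w
  proof -
    obtain D where D: "complex_linear D" "(F has_derivative D) (at (a + w *s v))"
      using assms unfolding holomorphic_vec_on_def by blast
    have "linear (\<lambda>w :: complex. w *s v)"
      by (rule linearI) (simp_all add: vec_eq_iff algebra_simps)
    then have "((\<lambda>w. w *s v) has_derivative (\<lambda>w. w *s v)) (at w)"
      by (rule linear_imp_has_derivative)
    then have 1: "((\<lambda>w. a + w *s v) has_derivative (\<lambda>w. w *s v)) (at w)"
      by (auto intro!: derivative_eq_intros)
    have 2: "((\<lambda>w. F (a + w *s v)) has_derivative (\<lambda>w. D (w *s v))) (at w)"
      using diff_chain_at[OF 1 D(2)] by (simp add: comp_def)
    have "((\<lambda>w. F (a + w *s v) $ i) has_derivative (\<lambda>w. D (w *s v) $ i)) (at w)"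
      using bounded_linear.has_derivative[OF bounded_linear_vec_nth 2] .
    moreover have "(\<lambda>w. D (w *s v) $ i) = (*) (D v $ i)"
      using D(1) by (auto simp: complex_linear_iff)
    ultimately show ?thesis
      unfolding field_differentiable_def has_field_derivative_def by auto
  qed
  then show ?thesis by (simp add: holomorphic_on_def)
qed

text \<open>Liouville's theorem, applied on each complex line through the origin.\<close>

lemma entire_bounded_constant:
  fixes F :: "complex ^ 'n \<Rightarrow> complex ^ 'm"
  assumes "entire F" "bounded (range F)"
  shows "F x = F 0"
proof -
  have "F x $ i = F 0 $ i" for i
  proof -
    let ?g = "\<lambda>w. F (0 + w *s x) $ i"
    have "bounded ((\<lambda>z. z $ i) ` range F)"
      by (rule bounded_linear_image[OF assms(2) bounded_linear_vec_nth])
    then have "bounded (range ?g)" by (rule bounded_subset) auto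
    then have "?g constant_on UNIV"
      by (rule Liouville_theorem[OF entire_component_along_line[OF assms(1)]])
    then have "?g 1 = ?g 0" unfolding constant_on_def by (metis UNIV_I)
    then show ?thesis by simp
  qed
  then show ?thesis by (simp add: vec_eq_iff)
qed

text \<open>An additive map has the same derivative at every point, hence differs from it by a constant.\<close>

lemma entire_additive_imp_linear:
  assumes "entire A" and add: "\<And>x y. A (x + y) = A x + A y"
  shows "complex_linear A"
proof -
  have zero: "A 0 = 0" using add[of 0 0] by simp
  obtain D where D: "complex_linear D" "(A has_derivative D) (at 0)"
    using assms(1) unfolding holomorphic_vec_on_def by blast
  have der: "(A has_derivative D) (at x)" for x
  proof -
    have 1: "((\<lambda>y. y - x) has_derivative (\<lambda>y. y)) (at x)" by (auto intro!: derivative_eq_intros)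
    have "((\<lambda>y. A (y - x)) has_derivative D) (at x)"
      using diff_chain_at[OF 1, of A D] D(2) by (simp add: comp_def)
    then have "((\<lambda>y. A (y - x) + A x) has_derivative D) (at x)"
      by (auto intro!: derivative_eq_intros)
    moreover have "(\<lambda>y. A (y - x) + A x) = A" by (simp flip: add)
    ultimately show ?thesis by simp
  qed
  have "A x - D x = A 0 - D 0" for x
  proof (rule has_derivative_zero_unique[of UNIV "\<lambda>x. A x - D x"])
    fix x
    have "(D has_derivative D) (at x)"
      using complex_linear_imp_linear[OF D(1)] by (simp add: linear_imp_has_derivative)
    from has_derivative_diff[OF der this]
    show "((\<lambda>x. A x - D x) has_derivative (\<lambda>h. 0)) (at x within UNIV)" by simp
  qed auto
  then have "A = D" using zero complex_linear_zero[OF D(1)] by (auto simp: fun_eq_iff)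
  then show ?thesis using D(1) by simp
qed


section \<open>Lattices and complex tori\<close>

lemma group_vector_group: "comm_group (vector_group :: ('a::ab_group_add) monoid)"
proof (rule comm_groupI)
  fix x :: 'a
  show "\<exists>y\<in>carrier vector_group. y \<otimes>\<^bsub>vector_group\<^esub> x = \<one>\<^bsub>vector_group\<^esub>"
    by (rule bexI[of _ "- x"]) (simp_all add: vector_group_def)
qed (simp_all add: vector_group_def add.assoc add.commute)

lemma vector_group_simps [simp]:
  "carrier vector_group = UNIV" "x \<otimes>\<^bsub>vector_group\<^esub> y = x + y" "\<one>\<^bsub>vector_group\<^esub> = 0"
  by (simp_all add: vector_group_def)

lemma inv_vector_group [simp]: "inv\<^bsub>vector_group\<^esub> (x::'a::ab_group_add) = - x"
  by (rule group.inv_equality[OF comm_group.axioms(2)[OF group_vector_group]]) simp_all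

locale lattice =
  fixes L :: "(complex ^ 'n::finite) set"
  assumes is_lattice: "is_lattice L"
begin

lemma subgroup_L: "subgroup L vector_group"
  using is_lattice by (simp add: is_lattice_def)

lemma L_zero [simp]: "0 \<in> L"
  using subgroup.one_closed[OF subgroup_L] by simp

lemma L_add: "x \<in> L \<Longrightarrow> y \<in> L \<Longrightarrow> x + y \<in> L"
  using subgroup.m_closed[OF subgroup_L] by simp

lemma L_neg: "x \<in> L \<Longrightarrow> - x \<in> L"
  using subgroup.m_inv_closed[OF subgroup_L] by simp

lemma L_diff: "x \<in> L \<Longrightarrow> y \<in> L \<Longrightarrow> x - y \<in> L"
  using L_add[OF _ L_neg, of x y] by simp

lemma L_diff_commute: "x - y \<in> L \<Longrightarrow> y - x \<in> L"
  using L_neg[of "x - y"] by simp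

lemma L_scale_nat: "x \<in> L \<Longrightarrow> of_nat k *\<^sub>R x \<in> L"
  by (induction k) (auto simp: scaleR_add_left intro: L_add)

lemma L_scale_int: "x \<in> L \<Longrightarrow> of_int k *\<^sub>R x \<in> L"
  by (cases k) (auto simp: L_scale_nat L_neg scaleR_minus_left simp del: of_nat_Suc intro: L_neg[of "_ *\<^sub>R x", simplified])

lemma separated:
  obtains r where "r > 0" "\<And>l. l \<in> L \<Longrightarrow> l \<noteq> 0 \<Longrightarrow> r \<le> norm l"
proof -
  have "0 isolated_in L" using is_lattice by (simp add: is_lattice_def discrete_def)
  then obtain T where T: "open T" "T \<inter> L = {0}" by (auto simp: isolated_in_def)
  then obtain r where r: "r > 0" "ball 0 r \<subseteq> T" using openE[of T 0] by blast
  have "r \<le> norm l" if "l \<in> L" "l \<noteq> 0" for l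
  proof (rule ccontr)
    assume "\<not> r \<le> norm l"
    then have "l \<in> T" using r(2) by auto
    then show False using T(2) that by auto
  qed
  then show ?thesis using that r(1) by blast
qed

lemma closed_translate: "closed ((+) x ` L)"
proof -
  obtain r where r: "r > 0" "\<And>l. l \<in> L \<Longrightarrow> l \<noteq> 0 \<Longrightarrow> r \<le> norm l" using separated by blast
  have "closed L"
  proof (rule discrete_imp_closed[OF r(1)], intro ballI impI)
    fix x y assume "x \<in> L" "y \<in> L" "dist y x < r"
    then show "y = x" using r(2)[of "y - x"] L_diff by (auto simp: dist_norm)
  qed
  then show ?thesis by (rule closed_translation)
qed

text \<open>Round down the coordinates with respect to a basis of \<open>V\<close> contained in \<open>L\<close>.\<close>

lemma cobounded:
  obtains R where "\<And>x. \<exists>l\<in>L. norm (x - l) \<le> R"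
proof -
  obtain S where S: "S \<subseteq> L" "independent S" "L \<subseteq> span S"
    using maximal_independent_subset[of L] by blast
  have fin: "finite S" using S(2) by (rule independent_imp_finite)
  have spn: "span S = UNIV"
    using S(1,3) is_lattice span_mono span_minimal[OF S(3) subspace_span] by (auto simp: is_lattice_def)
  have "\<exists>l\<in>L. norm (x - l) \<le> (\<Sum>s\<in>S. norm s)" for x
  proof -
    obtain u where u: "x = (\<Sum>s\<in>S. u s *\<^sub>R s)"
      using spn fin span_finite[OF fin] by (metis (no_types, lifting) UNIV_I imageE)
    let ?l = "\<Sum>s\<in>S. of_int \<lfloor>u s\<rfloor> *\<^sub>R s"
    have "?l \<in> L"
      using fin S(1)
    proof (induction S rule: finite_induct)
      case (insert a S)
      then show ?case using L_scale_int[of a] by (auto intro!: L_add)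
    qed simp
    moreover have "norm (x - ?l) \<le> (\<Sum>s\<in>S. norm s)"
    proof -
      have "x - ?l = (\<Sum>s\<in>S. frac (u s) *\<^sub>R s)"
        by (simp add: u frac_def scaleR_diff_left sum_subtractf)
      also have "norm \<dots> \<le> (\<Sum>s\<in>S. norm (frac (u s) *\<^sub>R s))" by (rule norm_sum)
      also have "\<dots> \<le> (\<Sum>s\<in>S. norm s)"
        by (rule sum_mono) (simp add: mult_left_le_one_le frac_lt_1 less_imp_le)
      finally show ?thesis .
    qed
    ultimately show ?thesis by blast
  qed
  then show ?thesis using that by blast
qed

text \<open>A nonzero linear map takes arbitrarily small nonzero values.\<close>

lemma linear_into_lattice_zero:
  assumes "linear f" "\<And>x. f x \<in> L"
  shows "f x = 0"
proof (rule ccontr)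
  assume ne: "f x \<noteq> 0"
  obtain r where r: "r > 0" "\<And>l. l \<in> L \<Longrightarrow> l \<noteq> 0 \<Longrightarrow> r \<le> norm l" using separated by blast
  define t where "t = r / (2 * norm (f x))"
  have t: "t > 0" using ne r(1) by (simp add: t_def)
  have "f (t *\<^sub>R x) = t *\<^sub>R f x" by (rule linear_scale[OF assms(1)])
  moreover have "norm (t *\<^sub>R f x) = r / 2" using ne r(1) by (simp add: t_def)
  moreover have "t *\<^sub>R f x \<noteq> 0" using t ne by simp
  ultimately show False using r assms(2)[of "t *\<^sub>R x"] by (metis field_sum_of_halves less_add_same_cancel1 half_gt_zero not_le)
qed

text \<open>The projection \<open>V \<rightarrow> T\<close>.\<close>

definition q :: "complex ^ 'n \<Rightarrow> (complex ^ 'n) set" where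
  "q x = L #>\<^bsub>vector_group\<^esub> x"

lemma mem_q: "y \<in> q x \<longleftrightarrow> y - x \<in> L"
proof
  assume "y - x \<in> L"
  then show "y \<in> q x" unfolding q_def r_coset_def by (intro UN_I[of "y - x"]) simp_all
qed (auto simp: q_def r_coset_def)

lemma q_eq_iff: "q x = q y \<longleftrightarrow> x - y \<in> L"
proof
  assume "q x = q y"
  moreover have "x \<in> q x" by (simp add: mem_q)
  ultimately show "x - y \<in> L" by (simp add: mem_q)
next
  assume "x - y \<in> L"
  have "z - x \<in> L \<longleftrightarrow> z - y \<in> L" for z
    using L_add[of "z - x" "x - y"] L_diff[of "z - y" "x - y"] \<open>x - y \<in> L\<close> by auto
  then show "q x = q y" by (auto simp: mem_q)
qed

lemma q_add_lattice [simp]: "l \<in> L \<Longrightarrow> q (l + x) = q x" "l \<in> L \<Longrightarrow> q (x + l) = q x"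
  by (simp_all add: q_eq_iff)

lemma normal_L: "normal L vector_group"
  using comm_group.subgroup_imp_normal[OF group_vector_group subgroup_L] .

lemma comm_group_torus: "comm_group (torus L)"
  unfolding torus_def by (rule comm_group.abelian_FactGroup[OF group_vector_group subgroup_L])

lemma group_torus: "group (torus L)"
  using comm_group_torus by (rule comm_group.axioms(2))

lemma carrier_torus: "carrier (torus L) = range q"
  by (simp add: torus_def carrier_FactGroup q_def[abs_def])

lemma q_carrier [simp]: "q x \<in> carrier (torus L)"
  by (simp add: carrier_torus)

lemma torus_pointE:
  assumes "X \<in> carrier (torus L)"
  obtains x where "X = q x"
  using assms by (auto simp: carrier_torus)

lemma torus_mult [simp]: "q x \<otimes>\<^bsub>torus L\<^esub> q y = q (x + y)"
  using normal.rcos_sum[OF normal_L, of x y] by (simp add: torus_def q_def)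

lemma torus_one: "\<one>\<^bsub>torus L\<^esub> = q 0"
  using mem_q[of _ 0] by (auto simp: torus_def)

lemma torus_inv [simp]: "inv\<^bsub>torus L\<^esub> q x = q (- x)"
  by (rule group.inv_equality[OF group_torus]) (simp_all add: torus_one)

abbreviation shifts :: "(complex ^ 'n \<Rightarrow> complex ^ 'n) set" where
  "shifts \<equiv> (\<lambda>l x. l + x) ` L"

lemma orbit_shifts: "orbit_of shifts x = q x"
  by (auto simp: orbit_of_def q_def r_coset_def)

lemma deck_group_shifts: "deck_group shifts id"
proof
  show "id \<in> shifts" by (rule image_eqI[of _ _ 0]) (auto simp: fun_eq_iff)
  show "\<gamma> \<circ> \<delta> \<in> shifts" if "\<gamma> \<in> shifts" "\<delta> \<in> shifts" for \<gamma> \<delta>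
  proof -
    from that obtain l m where "l \<in> L" "m \<in> L" "\<gamma> = (\<lambda>x. l + x)" "\<delta> = (\<lambda>x. m + x)" by blast
    then show ?thesis by (intro image_eqI[of _ _ "l + m"]) (auto simp: fun_eq_iff add.assoc L_add)
  qed
  show "\<exists>\<delta>\<in>shifts. \<delta> \<circ> \<gamma> = id" if "\<gamma> \<in> shifts" for \<gamma>
  proof -
    from that obtain l where "l \<in> L" "\<gamma> = (\<lambda>x. l + x)" by blast
    then show ?thesis by (intro bexI[of _ "\<lambda>x. - l + x"]) (auto simp: fun_eq_iff L_neg)
  qed
  show "entire \<gamma>" if "\<gamma> \<in> shifts" for \<gamma>
  proof -
    from that obtain l where "\<gamma> = (\<lambda>x. l + x)" by blast
    then show ?thesis using entire_affine[OF complex_linear_id, of l] by (simp add: add.commute)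
  qed
  show "dist (id (\<gamma> x)) (id (\<gamma> y)) = dist (id x) (id y)" if "\<gamma> \<in> shifts" for \<gamma> x y
    using that by auto
  show "\<exists>U. open U \<and> x \<in> U \<and> (\<forall>\<gamma>\<in>shifts. \<gamma> x \<in> U \<longrightarrow> \<gamma> = id)" for x
  proof -
    obtain r where r: "r > 0" "\<And>l. l \<in> L \<Longrightarrow> l \<noteq> 0 \<Longrightarrow> r \<le> norm l" using separated by blast
    have "\<gamma> = id" if g: "\<gamma> \<in> shifts" "\<gamma> x \<in> ball x r" for \<gamma>
    proof -
      obtain l where l: "l \<in> L" "\<gamma> = (\<lambda>x. l + x)" using g(1) by blast
      then have "norm l < r" using g(2) by (simp add: dist_norm)
      then have "l = 0" using r(2)[OF l(1)] by force
      then show ?thesis using l(2) by (auto simp: fun_eq_iff)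
    qed
    then show ?thesis using r(1) by (intro exI[of _ "ball x r"]) auto
  qed
qed (auto simp: linear_id)

lemma uniformized_complex_space: "uniformized complex_space id {id}"
proof -
  have "\<exists>\<tau> \<sigma>. entire \<tau> \<and> entire \<sigma> \<and> (\<forall>x. \<sigma> (\<tau> x) = x) \<and> (\<forall>x. \<tau> (\<sigma> x) = x) \<and>
           (\<forall>w\<in>UNIV. id (\<tau> (id w)) = (w :: complex ^ 'k::finite))"
    by (rule exI[of _ id], rule exI[of _ id]) (simp add: entire_id)
  then show ?thesis
    unfolding uniformized_def complex_space_def by (simp add: entire_id eq_commute)
qed

lemma uniformized_torus: "uniformized (torus_manifold L) q shifts"
proof -
  interpret D: deck_group shifts id by (rule deck_group_shifts)
  have "uniformized (quotient_manifold complex_space shifts) (orbit_of shifts \<circ> id) shifts"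
  proof (rule uniformized_quotient_manifold[OF uniformized_complex_space])
    show "orbit_of shifts (id x) = orbit_of shifts (id y) \<longleftrightarrow> (\<exists>\<gamma>\<in>shifts. y = \<gamma> x)" for x y
    proof -
      have "(\<exists>\<gamma>\<in>shifts. y = \<gamma> x) \<longleftrightarrow> y - x \<in> L"
        by (auto intro!: bexI[of _ "y - x"])
      then show ?thesis using L_diff_commute by (auto simp: orbit_shifts q_eq_iff)
    qed
  qed (use D.entire_deck D.wandering_neighbourhood in auto)
  then show ?thesis by (simp add: torus_manifold_def orbit_shifts comp_def)
qed

lemma entire_periodic_imp_affine:
  assumes F: "entire F" and periods: "\<And>l. l \<in> L \<Longrightarrow> \<exists>l'\<in>L. \<forall>x. F (l + x) = l' + F x"
  obtains A c where "complex_linear A" "\<And>x. F x = A x + c"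
proof -
  define A where "A = (\<lambda>x. F x - F 0)"
  have shift: "entire (\<lambda>y. F (a + y))" for a
    using entire_compose[OF F entire_affine[OF complex_linear_id, of a]] by (simp add: comp_def add.commute)
  have entire_diff: "entire (\<lambda>x. f x - g x)" if fg: "entire f" "entire g"
    for f g :: "complex ^ 'n \<Rightarrow> complex ^ 'n"
    unfolding holomorphic_vec_on_def
  proof
    fix x
    obtain D E where "complex_linear D" "(f has_derivative D) (at x)"
      "complex_linear E" "(g has_derivative E) (at x)"
      using fg unfolding holomorphic_vec_on_def by blast
    then show "\<exists>D. complex_linear D \<and> ((\<lambda>x. f x - g x) has_derivative D) (at x)"
      by (intro exI[of _ "\<lambda>x. D x - E x"] conjI has_derivative_diff)
         (auto simp: complex_linear_iff vec.scale_right_diff_distrib)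
  qed
  \<comment> \<open>The difference of two translates of \<open>F\<close> is periodic, hence bounded, hence constant.\<close>
  have "F (a + y) - F y = F (a + 0) - F 0" for a y
  proof (rule entire_bounded_constant[of "\<lambda>y. F (a + y) - F y"])
    let ?h = "\<lambda>y. F (a + y) - F y"
    show eh: "entire ?h" by (rule entire_diff[OF shift F])
    obtain R where R: "\<And>x. \<exists>l\<in>L. norm (x - l) \<le> R" using cobounded by blast
    have "range ?h \<subseteq> ?h ` cball 0 R"
    proof
      fix z assume "z \<in> range ?h"
      then obtain y where y: "z = ?h y" by blast
      obtain l where l: "l \<in> L" "norm (y - l) \<le> R" using R by blast
      obtain l' where "\<And>x. F (l + x) = l' + F x" using periods[OF l(1)] by blast
      from this[of "a + (y - l)"] this[of "y - l"] have "?h y = ?h (y - l)"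
        by (simp add: algebra_simps)
      then show "z \<in> ?h ` cball 0 R" using y l(2) by auto
    qed
    moreover have "compact (?h ` cball 0 R)"
      by (rule compact_continuous_image[OF continuous_on_subset[OF entire_continuous[OF eh]]]) auto
    ultimately show "bounded (range ?h)"
      using bounded_subset compact_imp_bounded by blast
  qed
  then have add: "F (a + y) - F y = F a - F 0" for a y by simp
  have additive: "A (x + y) = A x + A y" for x y
    using add[of x y] by (simp add: A_def algebra_simps)
  have eq: "(\<lambda>x. id x + - F 0) \<circ> F = A" by (simp add: A_def fun_eq_iff)
  have "entire ((\<lambda>x. id x + - F 0) \<circ> F)"
    by (rule entire_compose[OF entire_affine[OF complex_linear_id] F])
  then have "entire A" by (simp only: eq)
  then have "complex_linear A" using additive by (rule entire_additive_imp_linear)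
  then show ?thesis by (rule that[of A "F 0"]) (simp add: A_def)
qed

end


section \<open>Automorphisms of complex tori\<close>

context lattice
begin

definition lattice_aut :: "(complex ^ 'n \<Rightarrow> complex ^ 'n) \<Rightarrow> bool" where
  "lattice_aut A \<longleftrightarrow> complex_linear A \<and> bij A \<and> A ` L = L"

lemma lattice_aut_linear: "lattice_aut A \<Longrightarrow> complex_linear A"
  by (simp add: lattice_aut_def)

lemma lattice_aut_mem: "lattice_aut A \<Longrightarrow> l \<in> L \<Longrightarrow> A l \<in> L"
  by (auto simp: lattice_aut_def)

lemma lattice_aut_id: "lattice_aut id"
  by (simp add: lattice_aut_def complex_linear_id)

lemma lattice_aut_compose: "lattice_aut A \<Longrightarrow> lattice_aut B \<Longrightarrow> lattice_aut (A \<circ> B)"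
  unfolding lattice_aut_def by (metis bij_comp complex_linear_compose image_comp)

lemma lattice_autI:
  assumes "complex_linear A" "\<And>x. A (B x) = x" "\<And>x. B (A x) = x"
    "\<And>l. l \<in> L \<Longrightarrow> A l \<in> L" "\<And>l. l \<in> L \<Longrightarrow> B l \<in> L"
  shows "lattice_aut A"
proof -
  have "bij A" by (rule o_bij[of B]) (auto simp: fun_eq_iff assms)
  moreover have "A ` L = L"
  proof
    show "L \<subseteq> A ` L" using assms(2,5) by (metis image_eqI subsetI)
  qed (use assms(4) in auto)
  ultimately show ?thesis using assms(1) by (simp add: lattice_aut_def)
qed

lemma lattice_aut_inverse:
  assumes A: "lattice_aut A"
  obtains B where "lattice_aut B" "\<And>x. A (B x) = x" "\<And>x. B (A x) = x"
proof -
  define B where "B = inv_into UNIV A"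
  have AB: "A (B x) = x" and BA: "B (A x) = x" for x
    using A by (simp_all add: B_def lattice_aut_def bij_is_inj bij_is_surj surj_f_inv_f)
  have "B l \<in> L" if l: "l \<in> L" for l
  proof -
    have "l \<in> A ` L" using A l by (simp add: lattice_aut_def)
    then show ?thesis using BA by auto
  qed
  then have "lattice_aut B"
    using complex_linear_inverse[OF lattice_aut_linear[OF A] AB BA] AB BA lattice_aut_mem[OF A]
    by (intro lattice_autI[of B A]) auto
  then show ?thesis using that AB BA by blast
qed

text \<open>This is meaningful if \<open>A\<close> maps \<open>L\<close> into itself, for then the chosen representative is immaterial.\<close>

definition aff :: "(complex ^ 'n \<Rightarrow> complex ^ 'n) \<Rightarrow> complex ^ 'n \<Rightarrow> 'n torus_map" where
  "aff A c = (\<lambda>X\<in>carrier (torus L). q (A (SOME x. q x = X) + c))"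

lemma aff_q [simp]:
  assumes A: "lattice_aut A"
  shows "aff A c (q x) = q (A x + c)"
proof -
  let ?y = "SOME y. q y = q x"
  have "q ?y = q x" by (rule someI[of "\<lambda>y. q y = q x"]) simp
  then have "A (?y - x) \<in> L" using lattice_aut_mem[OF A] by (simp add: q_eq_iff)
  then have "q (A ?y + c) = q (A x + c)"
    by (simp add: q_eq_iff complex_linear_diff[OF lattice_aut_linear[OF A]])
  then show ?thesis by (simp add: aff_def)
qed

lemma aff_extensional: "aff A c \<in> extensional (carrier (torus L))"
  by (simp add: aff_def)

lemma torus_map_eqI:
  assumes "f \<in> extensional (carrier (torus L))" "g \<in> extensional (carrier (torus L))"
    and "\<And>x. f (q x) = g (q x)"
  shows "f = g"
  by (rule extensionalityI[OF assms(1,2)]) (use assms(3) in \<open>auto elim: torus_pointE\<close>)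

lemma aff_in_torus_Aut:
  assumes A: "lattice_aut A"
  shows "aff A c \<in> carrier (torus_Aut L)"
proof -
  obtain B where B: "lattice_aut B" "\<And>x. A (B x) = x" "\<And>x. B (A x) = x"
    using lattice_aut_inverse[OF A] by blast
  let ?F = "\<lambda>x. A x + c" and ?G = "\<lambda>x. B x + - B c"
  have "biholomorphic_map (torus_manifold L) (torus_manifold L) (aff A c)"
  proof (rule biholomorphic_map_descends[OF uniformized_torus uniformized_torus])
    show "entire ?F" by (rule entire_affine[OF lattice_aut_linear[OF A]])
    show "entire ?G" by (rule entire_affine[OF lattice_aut_linear[OF B(1)]])
    show "?F (?G x) = x" "?G (?F x) = x" for x
      using B A by (simp_all add: complex_linear_add complex_linear_neg complex_linear_diff lattice_aut_linear)
    show "q (A x + c) = aff A c (q x)" for x using A by simp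
    show "?G \<circ> \<gamma> \<circ> ?F \<in> shifts" if g: "\<gamma> \<in> shifts" for \<gamma>
    proof -
      obtain l where l: "l \<in> L" "\<gamma> = (\<lambda>x. l + x)" using g by blast
      have "?G \<circ> \<gamma> \<circ> ?F = (\<lambda>x. B l + x)"
        using l(2) B by (simp add: fun_eq_iff complex_linear_add lattice_aut_linear)
      then show ?thesis using lattice_aut_mem[OF B(1) l(1)] by simp
    qed
  qed
  then show ?thesis
    using aff_extensional
    by (simp add: torus_Aut_def Bij_def) (simp add: biholomorphic_map_def topspace_torus_manifold)
qed

text \<open>Normalizing the lattice translations means being periodic up to lattice vectors, and such maps are
  affine.\<close>

lemma conjugates_shifts_imp_lattice_aut:
  assumes F: "entire F" and FG: "\<And>x. F (G x) = x" "\<And>x. G (F x) = x"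
    and conj: "\<And>\<gamma>. \<gamma> \<in> shifts \<Longrightarrow> F \<circ> \<gamma> \<circ> G \<in> shifts" "\<And>\<gamma>. \<gamma> \<in> shifts \<Longrightarrow> G \<circ> \<gamma> \<circ> F \<in> shifts"
  obtains A c where "lattice_aut A" "F = (\<lambda>x. A x + c)"
proof -
  have shift: "\<exists>l'\<in>L. \<forall>x. F (l + x) = l' + F x" if l: "l \<in> L" for l
  proof -
    have "F \<circ> (\<lambda>x. l + x) \<circ> G \<in> shifts" using conj(1) l by blast
    then obtain l' where l': "l' \<in> L" "F \<circ> (\<lambda>x. l + x) \<circ> G = (\<lambda>x. l' + x)" by blast
    have "F (l + x) = l' + F x" for x
      using fun_cong[OF l'(2), of "F x"] FG(2) by simp
    then show ?thesis using l'(1) by blast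
  qed
  obtain A c where A: "complex_linear A" "\<And>x. F x = A x + c"
    using entire_periodic_imp_affine[OF F shift] by blast
  define B where "B = (\<lambda>x. G (x + c))"
  have AB: "A (B x) = x" for x using A(2)[of "G (x + c)"] FG(1) by (simp add: B_def)
  have BA: "B (A x) = x" for x using FG(2)[of x] by (simp add: B_def A(2))
  have lB: "complex_linear B" by (rule complex_linear_inverse[OF A(1) AB BA])
  have "A l \<in> L" if l: "l \<in> L" for l
  proof -
    obtain l' where "l' \<in> L" "F (l + 0) = l' + F 0" using shift[OF l] by blast
    then show ?thesis using A complex_linear_zero[OF A(1)] by simp
  qed
  moreover have "B l \<in> L" if l: "l \<in> L" for l
  proof -
    have "G \<circ> (\<lambda>x. l + x) \<circ> F \<in> shifts" using conj(2) l by blast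
    then obtain l' where l': "l' \<in> L" "G \<circ> (\<lambda>x. l + x) \<circ> F = (\<lambda>x. l' + x)" by blast
    have "G (l + F 0) = l'" using fun_cong[OF l'(2), of 0] by simp
    then have "B l = l'" using A(2)[of 0] complex_linear_zero[OF A(1)] by (simp add: B_def)
    then show ?thesis using l'(1) by simp
  qed
  ultimately have "lattice_aut A" using A(1) AB BA by (intro lattice_autI[of A B]) auto
  then show ?thesis using that A(2) by blast
qed

text \<open>An automorphism of \<open>T\<close> lifts to the universal cover \<open>V\<close>, where it normalizes the lattice translations.\<close>

lemma torus_Aut_iff: "f \<in> carrier (torus_Aut L) \<longleftrightarrow> (\<exists>A c. lattice_aut A \<and> f = aff A c)"
proof
  assume f: "f \<in> carrier (torus_Aut L)"
  then have ext: "f \<in> extensional (carrier (torus L))"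
    and bih: "biholomorphic_map (torus_manifold L) (torus_manifold L) f"
    by (simp_all add: torus_Aut_def Bij_def)
  obtain F G where F: "entire F" "entire G" "\<And>x. F (G x) = x" "\<And>x. G (F x) = x"
    "\<And>x. q (F x) = f (q x)" "\<And>\<gamma>. \<gamma> \<in> shifts \<Longrightarrow> F \<circ> \<gamma> \<circ> G \<in> shifts" "\<And>\<gamma>. \<gamma> \<in> shifts \<Longrightarrow> G \<circ> \<gamma> \<circ> F \<in> shifts"
    using biholomorphic_map_lifts[OF deck_group_shifts deck_group_shifts uniformized_torus uniformized_torus bih]
    by blast
  obtain A c where A: "lattice_aut A" "F = (\<lambda>x. A x + c)"
    using conjugates_shifts_imp_lattice_aut[OF F(1,3,4,6,7)] by blast
  have "f = aff A c"
    by (rule torus_map_eqI[OF ext aff_extensional]) (use F(5) A in simp)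
  then show "\<exists>A c. lattice_aut A \<and> f = aff A c" using A(1) by blast
qed (use aff_in_torus_Aut in auto)

lemma torus_Aut_mult:
  assumes "f \<in> carrier (torus_Aut L)" "g \<in> carrier (torus_Aut L)"
  shows "f \<otimes>\<^bsub>torus_Aut L\<^esub> g = compose (carrier (torus L)) f g"
  using assms by (simp add: torus_Aut_def BijGroup_def)

lemma aff_mult [simp]:
  assumes "lattice_aut A" "lattice_aut B"
  shows "aff A c \<otimes>\<^bsub>torus_Aut L\<^esub> aff B d = aff (A \<circ> B) (A d + c)"
proof (rule torus_map_eqI)
  show "aff A c \<otimes>\<^bsub>torus_Aut L\<^esub> aff B d \<in> extensional (carrier (torus L))"
    using assms by (simp add: torus_Aut_mult aff_in_torus_Aut)
  show "(aff A c \<otimes>\<^bsub>torus_Aut L\<^esub> aff B d) (q x) = aff (A \<circ> B) (A d + c) (q x)" for x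
    using assms lattice_aut_compose[OF assms]
    by (simp add: torus_Aut_mult aff_in_torus_Aut compose_def complex_linear_add[OF lattice_aut_linear] add.assoc)
qed (rule aff_extensional)

lemma torus_Aut_one: "\<one>\<^bsub>torus_Aut L\<^esub> = aff id 0"
proof (rule torus_map_eqI[OF _ aff_extensional])
  show "\<one>\<^bsub>torus_Aut L\<^esub> \<in> extensional (carrier (torus L))"
    by (simp add: torus_Aut_def BijGroup_def)
  show "\<one>\<^bsub>torus_Aut L\<^esub> (q x) = aff id 0 (q x)" for x
    by (simp add: torus_Aut_def BijGroup_def lattice_aut_id)
qed

text \<open>The difference of two lifts of the same map takes values in \<open>L\<close>, so its linear part vanishes.\<close>

lemma aff_eq_iff:
  assumes "lattice_aut A" "lattice_aut B"
  shows "aff A c = aff B d \<longleftrightarrow> A = B \<and> q c = q d"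
proof
  assume eq: "aff A c = aff B d"
  have *: "q (A x + c) = q (B x + d)" for x
    using fun_cong[OF eq, of "q x"] assms by simp
  have cd: "c - d \<in> L"
    using *[of 0] assms by (simp add: q_eq_iff complex_linear_zero lattice_aut_linear)
  have "linear (\<lambda>x. A x - B x)"
    using assms by (intro linear_compose_sub complex_linear_imp_linear lattice_aut_linear)
  moreover have "A x - B x \<in> L" for x
  proof -
    have "(A x + c) - (B x + d) \<in> L" using *[of x] by (simp add: q_eq_iff)
    then show ?thesis using L_diff[OF _ cd] by fastforce
  qed
  ultimately have "A x - B x = 0" for x by (rule linear_into_lattice_zero)
  then show "A = B \<and> q c = q d" using cd by (auto simp: fun_eq_iff q_eq_iff)
next
  assume ab: "A = B \<and> q c = q d"
  then have "aff A c (q x) = aff B d (q x)" for x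
    using assms by (simp add: q_eq_iff)
  then show "aff A c = aff B d" by (rule torus_map_eqI[OF aff_extensional aff_extensional])
qed

lemma group_torus_Aut: "group (torus_Aut L)"
proof (rule groupI)
  fix f assume "f \<in> carrier (torus_Aut L)"
  then obtain A c where A: "lattice_aut A" "f = aff A c" by (auto simp: torus_Aut_iff)
  obtain B where B: "lattice_aut B" "\<And>x. A (B x) = x" "\<And>x. B (A x) = x"
    using lattice_aut_inverse[OF A(1)] by blast
  have "B \<circ> A = id" using B by (simp add: fun_eq_iff)
  then show "\<exists>g\<in>carrier (torus_Aut L). g \<otimes>\<^bsub>torus_Aut L\<^esub> f = \<one>\<^bsub>torus_Aut L\<^esub>"
    using A B by (intro bexI[of _ "aff B (- B c)"]) (simp_all add: torus_Aut_one aff_in_torus_Aut)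
next
  fix f g assume "f \<in> carrier (torus_Aut L)" "g \<in> carrier (torus_Aut L)"
  then obtain A B c d where "lattice_aut A" "f = aff A c" "lattice_aut B" "g = aff B d"
    by (auto simp: torus_Aut_iff)
  then show "f \<otimes>\<^bsub>torus_Aut L\<^esub> g \<in> carrier (torus_Aut L)"
    using aff_in_torus_Aut lattice_aut_compose by simp
qed (auto simp: torus_Aut_iff[of f for f] torus_Aut_one lattice_aut_id lattice_aut_compose comp_assoc
    complex_linear_add[OF lattice_aut_linear] add.assoc intro!: exI[of _ id] exI[of _ 0])

lemma torus_Aut0_iff: "f \<in> carrier (torus_Aut0 L) \<longleftrightarrow> (\<exists>A. lattice_aut A \<and> f = aff A 0)"
proof
  assume f: "f \<in> carrier (torus_Aut0 L)"
  then have "f \<in> carrier (torus_Aut L)" and hom: "f \<in> hom (torus L) (torus L)"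
    by (simp_all add: torus_Aut0_def)
  then obtain A c where A: "lattice_aut A" "f = aff A c" by (auto simp: torus_Aut_iff)
  have "f (q 0) = q 0"
    using hom_one[OF hom group_torus group_torus] by (simp add: torus_one)
  then have "q c = q 0" using A by (simp add: complex_linear_zero lattice_aut_linear)
  then show "\<exists>A. lattice_aut A \<and> f = aff A 0" using A aff_eq_iff[OF A(1) A(1), of c 0] by auto
next
  assume "\<exists>A. lattice_aut A \<and> f = aff A 0"
  then obtain A where A: "lattice_aut A" "f = aff A 0" by blast
  have "f \<in> hom (torus L) (torus L)"
  proof (rule homI)
    fix X Y assume "X \<in> carrier (torus L)" "Y \<in> carrier (torus L)"
    then obtain x y where xy: "X = q x" "Y = q y" unfolding carrier_torus by blast
    show "f X \<in> carrier (torus L)" using xy A by simp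
    show "f (X \<otimes>\<^bsub>torus L\<^esub> Y) = f X \<otimes>\<^bsub>torus L\<^esub> f Y"
      using xy A by (simp add: complex_linear_add[OF lattice_aut_linear])
  qed
  then show "f \<in> carrier (torus_Aut0 L)" using A aff_in_torus_Aut by (simp add: torus_Aut0_def)
qed

lemma torus_Aut0_mult [simp]: "f \<otimes>\<^bsub>torus_Aut0 L\<^esub> g = f \<otimes>\<^bsub>torus_Aut L\<^esub> g"
  and torus_Aut0_one [simp]: "\<one>\<^bsub>torus_Aut0 L\<^esub> = \<one>\<^bsub>torus_Aut L\<^esub>"
  by (simp_all add: torus_Aut0_def)

lemma group_torus_Aut0: "group (torus_Aut0 L)"
proof (rule groupI)
  fix f assume "f \<in> carrier (torus_Aut0 L)"
  then obtain A where A: "lattice_aut A" "f = aff A 0" by (auto simp: torus_Aut0_iff)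
  obtain B where B: "lattice_aut B" "\<And>x. A (B x) = x" "\<And>x. B (A x) = x"
    using lattice_aut_inverse[OF A(1)] by blast
  have "B \<circ> A = id" using B by (simp add: fun_eq_iff)
  moreover have "aff B 0 \<in> carrier (torus_Aut0 L)" using B(1) by (auto simp: torus_Aut0_iff)
  ultimately show "\<exists>g\<in>carrier (torus_Aut0 L). g \<otimes>\<^bsub>torus_Aut0 L\<^esub> f = \<one>\<^bsub>torus_Aut0 L\<^esub>"
    using A B by (intro bexI[of _ "aff B 0"])
      (simp_all add: torus_Aut_one complex_linear_zero lattice_aut_linear)
next
  fix f g assume "f \<in> carrier (torus_Aut0 L)" "g \<in> carrier (torus_Aut0 L)"
  then obtain A B where AB: "lattice_aut A" "f = aff A 0" "lattice_aut B" "g = aff B 0"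
    by (auto simp: torus_Aut0_iff)
  then have "f \<otimes>\<^bsub>torus_Aut0 L\<^esub> g = aff (A \<circ> B) 0" by (simp add: complex_linear_zero lattice_aut_linear)
  then show "f \<otimes>\<^bsub>torus_Aut0 L\<^esub> g \<in> carrier (torus_Aut0 L)"
    using AB lattice_aut_compose by (auto simp: torus_Aut0_iff)
next
  show "\<one>\<^bsub>torus_Aut0 L\<^esub> \<in> carrier (torus_Aut0 L)"
    using lattice_aut_id by (auto simp: torus_Aut0_iff torus_Aut_one)
next
  interpret A: group "torus_Aut L" by (rule group_torus_Aut)
  fix f g h assume "f \<in> carrier (torus_Aut0 L)" "g \<in> carrier (torus_Aut0 L)" "h \<in> carrier (torus_Aut0 L)"
  then have "f \<in> carrier (torus_Aut L)" "g \<in> carrier (torus_Aut L)" "h \<in> carrier (torus_Aut L)"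
    by (simp_all add: torus_Aut0_def)
  then show "f \<otimes>\<^bsub>torus_Aut0 L\<^esub> g \<otimes>\<^bsub>torus_Aut0 L\<^esub> h = f \<otimes>\<^bsub>torus_Aut0 L\<^esub> (g \<otimes>\<^bsub>torus_Aut0 L\<^esub> h)"
    and "\<one>\<^bsub>torus_Aut0 L\<^esub> \<otimes>\<^bsub>torus_Aut0 L\<^esub> f = f"
    by (simp_all add: A.m_assoc)
qed

abbreviation lift :: "'n torus_map \<Rightarrow> complex ^ 'n \<Rightarrow> complex ^ 'n" where
  "lift \<equiv> linear_lift L"

lemma lift_aff [simp]:
  assumes A: "lattice_aut A"
  shows "lift (aff A 0) = A"
  unfolding linear_lift_def q_def[symmetric]
proof (rule the_equality)
  show "complex_linear A \<and> (\<forall>x. aff A 0 (q x) = q (A x))"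
    using A by (simp add: lattice_aut_linear)
next
  fix B assume B: "complex_linear B \<and> (\<forall>x. aff A 0 (q x) = q (B x))"
  have "linear (\<lambda>x. B x - A x)"
    using B lattice_aut_linear[OF A] by (intro linear_compose_sub complex_linear_imp_linear) auto
  moreover have "B x - A x \<in> L" for x
    using A B L_diff_commute by (auto simp: q_eq_iff)
  ultimately have "B x - A x = 0" for x by (rule linear_into_lattice_zero)
  then show "B = A" by (simp add: fun_eq_iff)
qed

lemma
  assumes "g \<in> carrier (torus_Aut0 L)"
  shows lattice_aut_lift: "lattice_aut (lift g)" and aff_lift: "aff (lift g) 0 = g"
    and torus_Aut0_q: "g (q x) = q (lift g x)"
proof -
  obtain A where "lattice_aut A" "g = aff A 0" using assms by (auto simp: torus_Aut0_iff)
  then show "lattice_aut (lift g)" "aff (lift g) 0 = g" "g (q x) = q (lift g x)" by simp_all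
qed

lemma torus_Aut0_mem_Aut: "g \<in> carrier (torus_Aut0 L) \<Longrightarrow> g \<in> carrier (torus_Aut L)"
  by (simp add: torus_Aut0_def)

lemma lift_mult:
  assumes "g \<in> carrier (torus_Aut0 L)" "h \<in> carrier (torus_Aut0 L)"
  shows "lift (g \<otimes>\<^bsub>torus_Aut L\<^esub> h) = lift g \<circ> lift h"
proof -
  have "g \<otimes>\<^bsub>torus_Aut L\<^esub> h = aff (lift g \<circ> lift h) 0"
    using aff_mult[OF lattice_aut_lift[OF assms(1)] lattice_aut_lift[OF assms(2)], of 0 0]
    by (simp add: aff_lift assms complex_linear_zero lattice_aut_linear lattice_aut_lift)
  then show ?thesis using lattice_aut_compose lattice_aut_lift assms by simp
qed

lemma lift_one: "lift \<one>\<^bsub>torus_Aut L\<^esub> = id"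
  by (simp add: torus_Aut_one lattice_aut_id)

lemma linear_part_aff:
  assumes A: "lattice_aut A"
  shows "linear_part L (aff A c) = aff A 0"
proof (rule torus_map_eqI[OF _ aff_extensional])
  show "linear_part L (aff A c) \<in> extensional (carrier (torus L))"
    by (simp add: linear_part_def)
  show "linear_part L (aff A c) (q x) = aff A 0 (q x)" for x
    using A by (simp add: linear_part_def torus_one complex_linear_zero lattice_aut_linear)
qed

end


section \<open>Cocycles, affine groups on the torus and their lifts\<close>

locale torus_group = lattice L for L :: "(complex ^ 'n::finite) set" +
  fixes G :: "'n torus_map set"
  assumes subgroup_G: "subgroup G (torus_Aut0 L)" and finite_G: "finite G"
begin

abbreviation GG :: "'n torus_map monoid" where
  "GG \<equiv> (torus_Aut0 L)\<lparr>carrier := G\<rparr>"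

abbreviation Z1 :: "('n torus_map \<Rightarrow> (complex ^ 'n) set) set" where
  "Z1 \<equiv> carrier (cocycles1 GG (torus L) (\<lambda>g t. g t))"

abbreviation prodG (infixl \<open>\<cdot>\<close> 70) where
  "g \<cdot> h \<equiv> g \<otimes>\<^bsub>torus_Aut L\<^esub> h"

abbreviation oneG (\<open>\<e>\<close>) where
  "\<e> \<equiv> \<one>\<^bsub>torus_Aut L\<^esub>"

lemma G_Aut0: "g \<in> G \<Longrightarrow> g \<in> carrier (torus_Aut0 L)"
  using subgroup.mem_carrier[OF subgroup_G] .

lemma G_Aut: "g \<in> G \<Longrightarrow> g \<in> carrier (torus_Aut L)"
  by (rule torus_Aut0_mem_Aut[OF G_Aut0])

lemma G_mult: "g \<in> G \<Longrightarrow> h \<in> G \<Longrightarrow> g \<cdot> h \<in> G"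
  using subgroup.m_closed[OF subgroup_G] by simp

lemma G_one: "\<e> \<in> G"
  using subgroup.one_closed[OF subgroup_G] by simp

lemma G_inverse:
  assumes "g \<in> G"
  obtains h where "h \<in> G" "g \<cdot> h = \<e>" "h \<cdot> g = \<e>"
proof -
  interpret A: group "torus_Aut0 L" by (rule group_torus_Aut0)
  show ?thesis
    using that[of "inv\<^bsub>torus_Aut0 L\<^esub> g"] subgroup.m_inv_closed[OF subgroup_G assms]
      A.r_inv[OF G_Aut0[OF assms]] A.l_inv[OF G_Aut0[OF assms]] by simp
qed

lemma group_GG: "group GG"
  using group.subgroup_imp_group[OF group_torus_Aut0 subgroup_G] .

lemma lift_G [simp]: "g \<in> G \<Longrightarrow> lattice_aut (lift g)"
  by (rule lattice_aut_lift[OF G_Aut0])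

lemma lift_G_linear [simp]: "g \<in> G \<Longrightarrow> complex_linear (lift g)"
  by (simp add: lattice_aut_linear)

lemma lift_G_mult [simp]: "g \<in> G \<Longrightarrow> h \<in> G \<Longrightarrow> lift (g \<cdot> h) x = lift g (lift h x)"
  by (simp add: lift_mult G_Aut0)

lemma lift_G_one [simp]: "lift \<e> x = x"
  by (simp add: lift_one)

lemma G_q: "g \<in> G \<Longrightarrow> g (q x) = q (lift g x)"
  by (rule torus_Aut0_q[OF G_Aut0])

lemma G_aff: "g \<in> G \<Longrightarrow> aff (lift g) 0 = g"
  by (rule aff_lift[OF G_Aut0])

lemma lift_inj: "g \<in> G \<Longrightarrow> h \<in> G \<Longrightarrow> lift g = lift h \<Longrightarrow> g = h"
  using G_aff by metis

lemma cocycle_iff: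
  "z \<in> Z1 \<longleftrightarrow> z \<in> G \<rightarrow>\<^sub>E carrier (torus L) \<and> (\<forall>g\<in>G. \<forall>h\<in>G. z (g \<cdot> h) = z g \<otimes>\<^bsub>torus L\<^esub> g (z h))"
  by (simp add: cocycles1_def pointwise_group_def)

lemma cocycle_carrier: "z \<in> Z1 \<Longrightarrow> g \<in> G \<Longrightarrow> z g \<in> carrier (torus L)"
  by (auto simp: cocycle_iff)

lemma cochain_rep:
  assumes "z \<in> G \<rightarrow>\<^sub>E carrier (torus L)" "g \<in> G"
  obtains c where "q c = z g"
  using assms PiE_mem[OF assms] unfolding carrier_torus by auto

lemma cocycle_rep:
  assumes "z \<in> Z1" "g \<in> G"
  obtains c where "q c = z g"
  using cochain_rep assms unfolding cocycle_iff by blast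

lemma cocycle_mult:
  assumes "z \<in> Z1" "g \<in> G" "h \<in> G" "q c = z g" "q d = z h"
  shows "q (lift g d + c) = z (g \<cdot> h)"
proof -
  have "z (g \<cdot> h) = q c \<otimes>\<^bsub>torus L\<^esub> g (q d)" using assms by (simp add: cocycle_iff)
  then show ?thesis using assms(2) by (simp add: G_q add.commute)
qed

lemma cocycle_one:
  assumes z: "z \<in> Z1"
  shows "z \<e> = q 0"
proof -
  obtain c where c: "q c = z \<e>" using cocycle_rep[OF z G_one] by blast
  have ee: "\<e> \<cdot> \<e> = \<e>" by (simp add: torus_Aut_one lattice_aut_id)
  have "q (lift \<e> c + c) = z (\<e> \<cdot> \<e>)" by (rule cocycle_mult[OF z, OF G_one G_one c c])
  then have "q (c + c) = q c" by (simp only: ee c lift_G_one)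
  then have "c \<in> L" by (simp add: q_eq_iff)
  then show ?thesis using c q_eq_iff[of c 0] by simp
qed

lemma cocycleI:
  assumes "z \<in> G \<rightarrow>\<^sub>E carrier (torus L)"
    and "\<And>g h c d. g \<in> G \<Longrightarrow> h \<in> G \<Longrightarrow> q c = z g \<Longrightarrow> q d = z h \<Longrightarrow> q (lift g d + c) = z (g \<cdot> h)"
  shows "z \<in> Z1"
  unfolding cocycle_iff
proof (intro conjI ballI)
  fix g h assume gh: "g \<in> G" "h \<in> G"
  obtain c d where cd: "q c = z g" "q d = z h"
    using cochain_rep[OF assms(1)] gh by metis
  show "z (g \<cdot> h) = z g \<otimes>\<^bsub>torus L\<^esub> g (z h)"
    using assms(2)[OF gh cd] gh by (simp flip: cd add: G_q add.commute)
qed (rule assms(1))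

text \<open>The group \<open>{x \<mapsto> g x + z(g)}\<close> of automorphisms of \<open>T\<close>, and the group of its lifts to \<open>V\<close>, which
  is an extension of \<open>G\<close> by the lattice.\<close>

definition affine_group :: "('n torus_map \<Rightarrow> (complex ^ 'n) set) \<Rightarrow> 'n torus_map set" where
  "affine_group z = (\<lambda>g. \<lambda>X\<in>carrier (torus L). g X \<otimes>\<^bsub>torus L\<^esub> z g) ` G"

definition deck :: "('n torus_map \<Rightarrow> (complex ^ 'n) set) \<Rightarrow> (complex ^ 'n \<Rightarrow> complex ^ 'n) set" where
  "deck z = {\<lambda>x. lift g x + c | g c. g \<in> G \<and> q c = z g}"

lemma deckI: "g \<in> G \<Longrightarrow> q c = z g \<Longrightarrow> (\<lambda>x. lift g x + c) \<in> deck z"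
  by (auto simp: deck_def)

lemma deckE:
  assumes "\<gamma> \<in> deck z"
  obtains g c where "g \<in> G" "q c = z g" "\<gamma> = (\<lambda>x. lift g x + c)"
  using assms by (auto simp: deck_def)

lemma affine_map_eq_aff:
  assumes "g \<in> G" "q c = t"
  shows "(\<lambda>X\<in>carrier (torus L). g X \<otimes>\<^bsub>torus L\<^esub> t) = aff (lift g) c"
  by (rule torus_map_eqI[OF _ aff_extensional]) (use assms in \<open>auto simp flip: assms(2) simp: G_q\<close>)

lemma affine_group_iff:
  assumes "z \<in> G \<rightarrow>\<^sub>E carrier (torus L)"
  shows "f \<in> affine_group z \<longleftrightarrow> (\<exists>g\<in>G. \<exists>c. q c = z g \<and> f = aff (lift g) c)"
proof
  assume "f \<in> affine_group z"
  then obtain g where g: "g \<in> G" "f = (\<lambda>X\<in>carrier (torus L). g X \<otimes>\<^bsub>torus L\<^esub> z g)"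
    by (auto simp: affine_group_def)
  obtain c where c: "q c = z g" using cochain_rep[OF assms g(1)] by blast
  show "\<exists>g\<in>G. \<exists>c. q c = z g \<and> f = aff (lift g) c"
    using g c affine_map_eq_aff[OF g(1) c] by auto
next
  assume "\<exists>g\<in>G. \<exists>c. q c = z g \<and> f = aff (lift g) c"
  then obtain g c where g: "g \<in> G" "q c = z g" "f = aff (lift g) c" by blast
  then show "f \<in> affine_group z"
    unfolding affine_group_def using affine_map_eq_aff[OF g(1,2)] by (intro image_eqI[of _ _ g]) simp_all
qed

lemma cocycle_fun: "z \<in> Z1 \<Longrightarrow> z \<in> G \<rightarrow>\<^sub>E carrier (torus L)"
  by (simp add: cocycle_iff)

lemma inverse_translation:
  assumes z: "z \<in> Z1" and g: "g \<in> G" and h: "h \<in> G" "h \<cdot> g = \<e>" and c: "q c = z g"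
  shows "q (- lift h c) = z h"
proof -
  obtain d where d: "q d = z h" using cocycle_rep[OF z h(1)] by blast
  have "q (lift h c + d) = q 0"
    using cocycle_mult[OF z, OF h(1) g d c] h(2) cocycle_one[OF z] by simp
  then have "lift h c + d \<in> L" by (simp add: q_eq_iff)
  then have "d - - lift h c \<in> L" by (simp add: add.commute)
  then show ?thesis using d q_eq_iff[of d "- lift h c"] by simp
qed

lemma subgroup_affine_group:
  assumes z: "z \<in> Z1"
  shows "subgroup (affine_group z) (torus_Aut L)"
proof -
  note iff = affine_group_iff[OF cocycle_fun[OF z]]
  interpret A: group "torus_Aut L" by (rule group_torus_Aut)
  show ?thesis
  proof (rule A.subgroupI)
    show "affine_group z \<subseteq> carrier (torus_Aut L)"
      using iff by (auto simp: aff_in_torus_Aut)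
    show "affine_group z \<noteq> {}" using G_one by (auto simp: affine_group_def)
  next
    fix f assume "f \<in> affine_group z"
    then obtain g c where g: "g \<in> G" "q c = z g" "f = aff (lift g) c" using iff by blast
    obtain h where h: "h \<in> G" "g \<cdot> h = \<e>" "h \<cdot> g = \<e>" using G_inverse[OF g(1)] by blast
    have q: "q (- lift h c) = z h" by (rule inverse_translation[OF z, OF g(1) h(1,3) g(2)])
    have "lift h \<circ> lift g = id" using lift_G_mult[OF h(1) g(1)] h(3) by (auto simp: fun_eq_iff)
    then have "aff (lift h) (- lift h c) \<cdot> f = \<e>"
      using g h by (simp add: torus_Aut_one)
    then have "inv\<^bsub>torus_Aut L\<^esub> f = aff (lift h) (- lift h c)"
      using g(1,3) h(1) by (intro A.inv_equality) (simp_all add: aff_in_torus_Aut)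
    then show "inv\<^bsub>torus_Aut L\<^esub> f \<in> affine_group z" using iff q h(1) by blast
  next
    fix f f' assume "f \<in> affine_group z" "f' \<in> affine_group z"
    then obtain g c h d where g: "g \<in> G" "q c = z g" "f = aff (lift g) c"
      and h: "h \<in> G" "q d = z h" "f' = aff (lift h) d" using iff[of f] iff[of f'] by blast
    have "f \<cdot> f' = aff (lift (g \<cdot> h)) (lift g d + c)"
      using g h by (simp add: lift_mult G_Aut0)
    then show "f \<cdot> f' \<in> affine_group z"
      using iff cocycle_mult[OF z, OF g(1) h(1) g(2) h(2)] G_mult[OF g(1) h(1)] by blast
  qed
qed

lemma linear_part_affine:
  assumes "g \<in> G"
  shows "linear_part L (aff (lift g) c) = g"
  using assms by (simp add: linear_part_aff G_aff)

lemma iso_affine_group: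
  assumes z: "z \<in> Z1"
  shows "linear_part L \<in> iso ((torus_Aut L)\<lparr>carrier := affine_group z\<rparr>) GG"
proof -
  note iff = affine_group_iff[OF cocycle_fun[OF z]]
  have "linear_part L \<in> hom ((torus_Aut L)\<lparr>carrier := affine_group z\<rparr>) GG"
  proof (rule homI)
    fix f assume "f \<in> carrier ((torus_Aut L)\<lparr>carrier := affine_group z\<rparr>)"
    then obtain g c where "g \<in> G" "f = aff (lift g) c" using iff by auto
    then show "linear_part L f \<in> carrier GG" by (simp add: linear_part_affine)
  next
    fix f f' assume "f \<in> carrier ((torus_Aut L)\<lparr>carrier := affine_group z\<rparr>)"
      "f' \<in> carrier ((torus_Aut L)\<lparr>carrier := affine_group z\<rparr>)"
    then obtain g c h d where g: "g \<in> G" "f = aff (lift g) c" and h: "h \<in> G" "f' = aff (lift h) d"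
      using iff by auto
    have "f \<cdot> f' = aff (lift (g \<cdot> h)) (lift g d + c)"
      using g h by (simp add: lift_mult G_Aut0)
    then show "linear_part L (f \<otimes>\<^bsub>(torus_Aut L)\<lparr>carrier := affine_group z\<rparr>\<^esub> f') =
        linear_part L f \<otimes>\<^bsub>GG\<^esub> linear_part L f'"
      using g h G_mult by (simp add: linear_part_affine del: aff_mult)
  qed
  moreover have "inj_on (linear_part L) (affine_group z)"
  proof (rule inj_onI)
    fix f f' assume f: "f \<in> affine_group z" "f' \<in> affine_group z" "linear_part L f = linear_part L f'"
    then obtain g c h d where g: "g \<in> G" "q c = z g" "f = aff (lift g) c"
      and h: "h \<in> G" "q d = z h" "f' = aff (lift h) d" using iff[of f] iff[of f'] by blast
    then have "g = h" using f(3) by (simp add: linear_part_affine)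
    then show "f = f'" using g h by (simp add: aff_eq_iff)
  qed
  moreover have "linear_part L ` affine_group z = G"
  proof
    show "linear_part L ` affine_group z \<subseteq> G" using iff by (auto simp: linear_part_affine)
    show "G \<subseteq> linear_part L ` affine_group z"
    proof
      fix g assume g: "g \<in> G"
      obtain c where "q c = z g" using cocycle_rep[OF z g] by blast
      then have "aff (lift g) c \<in> affine_group z" using iff g by blast
      then show "g \<in> linear_part L ` affine_group z"
        using g by (intro image_eqI[of _ _ "aff (lift g) c"]) (simp_all add: linear_part_affine)
    qed
  qed
  ultimately show ?thesis by (simp add: iso_def bij_betw_def)
qed

lemma lift_cocycle_affine_group:
  assumes z: "z \<in> Z1"
  shows "lift_cocycle L G (affine_group z) = z"
proof (rule extensionalityI)
  show "lift_cocycle L G (affine_group z) \<in> extensional G" by (simp add: lift_cocycle_def)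
  show "z \<in> extensional G" using z by (simp add: cocycle_iff PiE_def)
  fix g assume g: "g \<in> G"
  have "(THE t. t \<in> carrier (torus L) \<and> (\<lambda>X\<in>carrier (torus L). g X \<otimes>\<^bsub>torus L\<^esub> t) \<in> affine_group z) = z g"
  proof (rule the_equality)
    show "z g \<in> carrier (torus L) \<and> (\<lambda>X\<in>carrier (torus L). g X \<otimes>\<^bsub>torus L\<^esub> z g) \<in> affine_group z"
      using g cocycle_carrier[OF z g] by (auto simp: affine_group_def)
  next
    fix t assume t: "t \<in> carrier (torus L) \<and> (\<lambda>X\<in>carrier (torus L). g X \<otimes>\<^bsub>torus L\<^esub> t) \<in> affine_group z"
    then obtain c where c: "q c = t" by (auto elim: torus_pointE)
    have "aff (lift g) c \<in> affine_group z" using t affine_map_eq_aff[OF g c] by simp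
    then obtain h d where h: "h \<in> G" "q d = z h" "aff (lift g) c = aff (lift h) d"
      using affine_group_iff[OF cocycle_fun[OF z]] by blast
    then have "lift g = lift h" "q c = q d" using g by (simp_all add: aff_eq_iff)
    then show "t = z g" using lift_inj[OF g h(1)] h(2) c by simp
  qed
  then show "lift_cocycle L G (affine_group z) g = z g"
    using g by (simp add: lift_cocycle_def)
qed

text \<open>As \<open>\<pi>\<close> is a bijection onto \<open>G\<close>, there is exactly one translation part for each \<open>g\<close>; closure under
  composition is the cocycle identity.\<close>

lemma free_lifts_iff:
  "H \<in> free_lifts L G \<longleftrightarrow> (\<exists>z\<in>Z1. H = affine_group z \<and> acts_freely_on_torus L H)"
proof
  assume "H \<in> free_lifts L G"
  then have sub: "subgroup H (torus_Aut L)" and free: "acts_freely_on_torus L H"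
    and iso: "linear_part L \<in> iso ((torus_Aut L)\<lparr>carrier := H\<rparr>) GG"
    by (auto simp: free_lifts_def)
  have bij: "bij_betw (linear_part L) H G" using iso by (simp add: iso_def)
  have elem: "\<exists>c. h = aff (lift (linear_part L h)) c" if h: "h \<in> H" for h
  proof -
    obtain A c where A: "lattice_aut A" "h = aff A c"
      using subgroup.mem_carrier[OF sub h] by (auto simp: torus_Aut_iff)
    then show ?thesis by (auto simp: linear_part_aff)
  qed
  have unique: "q c = q d" if "g \<in> G" "aff (lift g) c \<in> H" "aff (lift g) d \<in> H" for g c d
  proof -
    have "aff (lift g) c = aff (lift g) d"
      by (rule inj_onD[OF bij_betw_imp_inj_on[OF bij]]) (use that in \<open>simp_all add: linear_part_affine\<close>)
    then show ?thesis using that(1) by (simp add: aff_eq_iff)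
  qed
  have ex: "\<exists>c. aff (lift g) c \<in> H" if g: "g \<in> G" for g
  proof -
    obtain h where h: "h \<in> H" "linear_part L h = g" using bij g by (auto simp: bij_betw_def)
    obtain c where "h = aff (lift g) c" using elem[OF h(1)] h(2) by auto
    then show ?thesis using h(1) by auto
  qed
  define z where "z = (\<lambda>g\<in>G. q (SOME c. aff (lift g) c \<in> H))"
  have z: "aff (lift g) c \<in> H \<longleftrightarrow> q c = z g" if g: "g \<in> G" for g c
  proof -
    let ?d = "SOME c. aff (lift g) c \<in> H"
    have d: "aff (lift g) ?d \<in> H" "z g = q ?d" using someI_ex[OF ex[OF g]] g by (simp_all add: z_def)
    show ?thesis
    proof
      assume "q c = z g"
      then have "aff (lift g) c = aff (lift g) ?d" using d g by (simp add: aff_eq_iff)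
      then show "aff (lift g) c \<in> H" using d by simp
    next
      assume "aff (lift g) c \<in> H"
      then have "q c = q ?d" by (rule unique[OF g _ d(1)])
      then show "q c = z g" using d(2) by simp
    qed
  qed
  have "z \<in> Z1"
  proof (rule cocycleI)
    show "z \<in> G \<rightarrow>\<^sub>E carrier (torus L)" by (auto simp: z_def)
    fix g h c d assume gh: "g \<in> G" "h \<in> G" "q c = z g" "q d = z h"
    then have "aff (lift g) c \<in> H" "aff (lift h) d \<in> H" using z[of g c] z[of h d] by simp_all
    then have "aff (lift g) c \<cdot> aff (lift h) d \<in> H" by (rule subgroup.m_closed[OF sub])
    moreover have "aff (lift g) c \<cdot> aff (lift h) d = aff (lift (g \<cdot> h)) (lift g d + c)"
      using gh by (simp add: lift_mult G_Aut0)
    ultimately show "q (lift g d + c) = z (g \<cdot> h)"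
      using z[OF G_mult[OF gh(1,2)], of "lift g d + c"] by simp
  qed
  moreover have "H = affine_group z"
  proof (intro Set.set_eqI iffI)
    fix h assume h: "h \<in> H"
    then have g: "linear_part L h \<in> G" using bij by (auto simp: bij_betw_def)
    obtain c where c: "h = aff (lift (linear_part L h)) c" using elem[OF h] by blast
    then have "q c = z (linear_part L h)" using z[OF g, of c] h by simp
    then show "h \<in> affine_group z"
      using c g affine_group_iff[OF cocycle_fun[OF \<open>z \<in> Z1\<close>]] by blast
  next
    fix h assume "h \<in> affine_group z"
    then obtain g c where "g \<in> G" "q c = z g" "h = aff (lift g) c"
      using affine_group_iff[OF cocycle_fun[OF \<open>z \<in> Z1\<close>]] by blast
    then show "h \<in> H" using z[of g c] by simp
  qed
  ultimately show "\<exists>z\<in>Z1. H = affine_group z \<and> acts_freely_on_torus L H" using free by blast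
next
  assume "\<exists>z\<in>Z1. H = affine_group z \<and> acts_freely_on_torus L H"
  then show "H \<in> free_lifts L G"
    using subgroup_affine_group iso_affine_group by (auto simp: free_lifts_def)
qed

text \<open>If a map fixes \<open>q x\<close>, then its lifts move \<open>x\<close> by lattice vectors, and correcting a lift by such a vector
  gives one that fixes \<open>x\<close>.\<close>

lemma acts_freely_iff:
  assumes z: "z \<in> Z1"
  shows "acts_freely_on_torus L (affine_group z) \<longleftrightarrow> (\<forall>\<gamma>\<in>deck z. \<forall>x. \<gamma> x = x \<longrightarrow> \<gamma> = id)"
proof
  assume free: "acts_freely_on_torus L (affine_group z)"
  show "\<forall>\<gamma>\<in>deck z. \<forall>x. \<gamma> x = x \<longrightarrow> \<gamma> = id"
  proof (intro ballI allI impI)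
    fix \<gamma> x assume "\<gamma> \<in> deck z" and fixed: "\<gamma> x = x"
    then obtain g c where g: "g \<in> G" "q c = z g" "\<gamma> = (\<lambda>x. lift g x + c)" by (auto elim: deckE)
    then have "aff (lift g) c \<in> affine_group z"
      using affine_group_iff[OF cocycle_fun[OF z]] by blast
    moreover have "aff (lift g) c (q x) = q x" using fixed g by simp
    ultimately have "aff (lift g) c = \<e>"
      using free unfolding acts_freely_on_torus_def by (metis q_carrier)
    then have "lift g = id" using g(1) by (simp add: torus_Aut_one aff_eq_iff lattice_aut_id)
    then show "\<gamma> = id" using fixed g(3) by (simp add: fun_eq_iff)
  qed
next
  assume free: "\<forall>\<gamma>\<in>deck z. \<forall>x. \<gamma> x = x \<longrightarrow> \<gamma> = id"
  show "acts_freely_on_torus L (affine_group z)"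
    unfolding acts_freely_on_torus_def
  proof (intro ballI impI notI)
    fix f X assume f: "f \<in> affine_group z" "f \<noteq> \<e>" "X \<in> carrier (torus L)" "f X = X"
    obtain g c where g: "g \<in> G" "q c = z g" "f = aff (lift g) c"
      using f(1) affine_group_iff[OF cocycle_fun[OF z]] by blast
    obtain x where x: "X = q x" using f(3) by (rule torus_pointE)
    define l where "l = lift g x + c - x"
    have l: "l \<in> L" using f(4) g x by (simp add: l_def q_eq_iff)
    have "q (c - l) = z g" using l g(2)[symmetric] L_neg[OF l] by (simp add: q_eq_iff)
    then have "(\<lambda>y. lift g y + (c - l)) \<in> deck z" by (rule deckI[where z = z, OF g(1)])
    moreover have "lift g x + (c - l) = x" by (simp add: l_def)
    ultimately have "(\<lambda>y. lift g y + (c - l)) = id" by (rule free[rule_format, where x = x])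
    then have id: "lift g y + (c - l) = y" for y by (simp add: fun_eq_iff)
    have "c = l" using id[of 0] g(1) by (simp add: complex_linear_zero)
    then have "lift g = id" using id by (simp add: fun_eq_iff)
    then have "f = \<e>" using g(3) \<open>c = l\<close> l by (simp add: torus_Aut_one aff_eq_iff lattice_aut_id q_eq_iff)
    then show False using f(2) by simp
  qed
qed

lemma deck_comp:
  assumes z: "z \<in> Z1" and "\<gamma> \<in> deck z" "\<delta> \<in> deck z"
  shows "\<gamma> \<circ> \<delta> \<in> deck z"
proof -
  obtain g c where g: "g \<in> G" "q c = z g" "\<gamma> = (\<lambda>x. lift g x + c)" using assms(2) by (rule deckE)
  obtain h d where h: "h \<in> G" "q d = z h" "\<delta> = (\<lambda>x. lift h x + d)" using assms(3) by (rule deckE)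
  have "\<gamma> \<circ> \<delta> = (\<lambda>x. lift (g \<cdot> h) x + (lift g d + c))"
    using g h by (simp add: fun_eq_iff complex_linear_add)
  then show ?thesis
    using deckI[where z = z, OF G_mult[OF g(1) h(1)] cocycle_mult[OF z, OF g(1) h(1) g(2) h(2)]] by simp
qed

lemma id_deck: "z \<in> Z1 \<Longrightarrow> id \<in> deck z"
  using deckI[where z = z, OF G_one, of 0] cocycle_one[of z] by (simp add: id_def)

lemma translation_deck: "z \<in> Z1 \<Longrightarrow> l \<in> L \<Longrightarrow> (\<lambda>x. x + l) \<in> deck z"
  using deckI[where z = z, OF G_one, of l] cocycle_one[of z] by (simp add: q_eq_iff)

lemma deck_left_inverse:
  assumes z: "z \<in> Z1" and "\<gamma> \<in> deck z"
  shows "\<exists>\<delta>\<in>deck z. \<delta> \<circ> \<gamma> = id"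
proof -
  obtain g c where g: "g \<in> G" "q c = z g" "\<gamma> = (\<lambda>x. lift g x + c)" using assms(2) by (rule deckE)
  obtain h where h: "h \<in> G" "g \<cdot> h = \<e>" "h \<cdot> g = \<e>" using G_inverse[OF g(1)] by blast
  let ?\<delta> = "\<lambda>x. lift h x + - lift h c"
  have "?\<delta> \<in> deck z" by (rule deckI[where z = z, OF h(1) inverse_translation[OF z, OF g(1) h(1,3) g(2)]])
  moreover have "lift h (lift g x) = x" for x using lift_G_mult[OF h(1) g(1), of x] h(3) by simp
  then have "?\<delta> \<circ> \<gamma> = id" using g h by (simp add: fun_eq_iff complex_linear_add)
  ultimately show ?thesis by blast
qed

lemma deck_entire: "\<gamma> \<in> deck z \<Longrightarrow> entire \<gamma>"
  by (auto elim!: deckE intro: entire_affine)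

text \<open>Elements with linear part other than the identity send \<open>x\<close> into finitely many translates of \<open>L\<close>; these are
  closed and, by freeness, do not contain \<open>x\<close>.\<close>

lemma deck_displaces:
  assumes z: "z \<in> Z1" and free: "\<forall>\<gamma>\<in>deck z. \<forall>x. \<gamma> x = x \<longrightarrow> \<gamma> = id"
  shows "\<exists>U. open U \<and> x \<in> U \<and> (\<forall>\<gamma>\<in>deck z. \<gamma> x \<in> U \<longrightarrow> \<gamma> = id)"
proof -
  obtain r where r: "r > 0" "\<And>l. l \<in> L \<Longrightarrow> l \<noteq> 0 \<Longrightarrow> r \<le> norm l" using separated by blast
  let ?S = "\<lambda>g. {lift g x + c | c. q c = z g}"
  have closed: "closed (?S g)" if g: "g \<in> G" for g
  proof -
    obtain d where d: "q d = z g" using cocycle_rep[OF z g] by blast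
    have "?S g = (+) (lift g x + d) ` L"
    proof (intro Set.set_eqI iffI)
      fix y assume "y \<in> ?S g"
      then obtain c where "q c = q d" "y = lift g x + c" using d by auto
      then show "y \<in> (+) (lift g x + d) ` L" by (intro image_eqI[of _ _ "c - d"]) (simp_all add: q_eq_iff)
    next
      fix y assume "y \<in> (+) (lift g x + d) ` L"
      then obtain l where "l \<in> L" "y = lift g x + (d + l)" by (auto simp: add.assoc)
      then show "y \<in> ?S g" using d q_add_lattice(2)[of l d] by auto
    qed
    then show ?thesis using closed_translate by simp
  qed
  let ?U = "ball x r \<inter> - (\<Union>g\<in>G - {\<e>}. ?S g)"
  have "closed (\<Union>g\<in>G - {\<e>}. ?S g)" using finite_G closed by (intro closed_UN) auto
  then have "open ?U" by (intro open_Int open_ball open_Compl)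
  moreover have "x \<notin> ?S g" if g: "g \<in> G - {\<e>}" for g
  proof
    assume "x \<in> ?S g"
    then obtain c where c: "x = lift g x + c" "q c = z g" by blast
    have "(\<lambda>x. lift g x + c) \<in> deck z" using deckI[of g c z] c(2) g by simp
    then have "(\<lambda>x. lift g x + c) = id" by (rule free[rule_format, where x = x]) (simp flip: c(1))
    then have id: "lift g y + c = y" for y by (simp add: fun_eq_iff)
    have "c = 0" using id[of 0] g by (simp add: complex_linear_zero)
    then have "lift g = lift \<e>" using id by (simp add: fun_eq_iff)
    then show False using lift_inj[of g \<e>] g G_one by auto
  qed
  then have "x \<in> ?U" using r(1) by auto
  moreover have "\<gamma> = id" if \<gamma>: "\<gamma> \<in> deck z" "\<gamma> x \<in> ?U" for \<gamma>
  proof -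
    obtain g c where g: "g \<in> G" "q c = z g" "\<gamma> = (\<lambda>x. lift g x + c)" using \<gamma>(1) by (rule deckE)
    then have "\<gamma> x \<in> ?S g" by auto
    then have "g = \<e>" using \<gamma>(2) g(1) by auto
    then have \<gamma>': "\<gamma> = (\<lambda>x. x + c)" "c \<in> L" using g cocycle_one[OF z] by (simp_all add: q_eq_iff)
    then have "norm c < r" using \<gamma>(2) by (simp add: dist_norm)
    then have "c = 0" using r(2)[OF \<gamma>'(2)] by force
    then show ?thesis using \<gamma>'(1) by (simp add: fun_eq_iff)
  qed
  ultimately show ?thesis by blast
qed

lemma deck_group_deck:
  fixes B :: "complex ^ 'n \<Rightarrow> 'e::euclidean_space"
  assumes z: "z \<in> Z1" and free: "\<forall>\<gamma>\<in>deck z. \<forall>x. \<gamma> x = x \<longrightarrow> \<gamma> = id"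
    and B: "linear B" "bij B" "\<And>g x. g \<in> G \<Longrightarrow> norm (B (lift g x)) = norm (B x)"
  shows "deck_group (deck z) B"
proof
  show "dist (B (\<gamma> x)) (B (\<gamma> y)) = dist (B x) (B y)" if "\<gamma> \<in> deck z" for \<gamma> x y
  proof -
    obtain g c where g: "g \<in> G" "\<gamma> = (\<lambda>x. lift g x + c)" using \<open>\<gamma> \<in> deck z\<close> by (rule deckE)
    have "B (\<gamma> x) - B (\<gamma> y) = B (lift g (x - y))"
      using g by (simp add: complex_linear_diff linear_diff[OF B(1), symmetric])
    then show ?thesis using B(3)[OF g(1), of "x - y"] by (simp add: dist_norm linear_diff[OF B(1)])
  qed
qed (use id_deck[OF z] deck_comp[OF z] deck_left_inverse[OF z] deck_entire deck_displaces[OF z free]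
    linear_add[OF B(1)] linear_scale[OF B(1)] B(2) in auto)

lemma orbit_affine_group_iff:
  assumes z: "z \<in> Z1"
  shows "orbit_of (affine_group z) (q x) = orbit_of (affine_group z) (q y) \<longleftrightarrow> (\<exists>\<gamma>\<in>deck z. y = \<gamma> x)"
proof -
  note iff = affine_group_iff[OF cocycle_fun[OF z]]
  have mem: "q y \<in> orbit_of (affine_group z) (q x) \<longleftrightarrow> (\<exists>\<gamma>\<in>deck z. y = \<gamma> x)" for x y
  proof
    assume "q y \<in> orbit_of (affine_group z) (q x)"
    then obtain f where f: "f \<in> affine_group z" "q y = f (q x)" by (auto simp: mem_orbit_of)
    obtain g c where g: "g \<in> G" "q c = z g" "f = aff (lift g) c" using f(1) iff by blast
    define l where "l = y - (lift g x + c)"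
    have "l \<in> L" using f(2) g by (simp add: l_def q_eq_iff)
    then have "q (c + l) = z g" using g(2) by simp
    then have "(\<lambda>x. lift g x + (c + l)) \<in> deck z" by (rule deckI[where z = z, OF g(1)])
    then show "\<exists>\<gamma>\<in>deck z. y = \<gamma> x" by (intro bexI[of _ "\<lambda>x. lift g x + (c + l)"]) (simp_all add: l_def)
  next
    assume "\<exists>\<gamma>\<in>deck z. y = \<gamma> x"
    then obtain g c where g: "g \<in> G" "q c = z g" "y = lift g x + c" by (auto elim!: deckE)
    then have "aff (lift g) c \<in> affine_group z" "q y = aff (lift g) c (q x)" using iff by auto
    then show "q y \<in> orbit_of (affine_group z) (q x)" unfolding mem_orbit_of by blast
  qed
  interpret A: group "torus_Aut L" by (rule group_torus_Aut)
  have sub: "subgroup (affine_group z) (torus_Aut L)" by (rule subgroup_affine_group[OF z])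
  have self: "q y \<in> orbit_of (affine_group z) (q y)" for y
    unfolding mem by (rule bexI[OF _ id_deck[OF z]]) simp
  have le: "orbit_of (affine_group z) (q y) \<subseteq> orbit_of (affine_group z) (q x)" if "\<gamma> \<in> deck z" "y = \<gamma> x" for \<gamma> x y
  proof
    fix Y assume Y: "Y \<in> orbit_of (affine_group z) (q y)"
    then obtain f where f: "f \<in> affine_group z" "Y = f (q y)" by (auto simp: mem_orbit_of)
    then obtain w where w: "Y = q w" using iff by auto
    then obtain \<delta> where "\<delta> \<in> deck z" "w = \<delta> y" using Y mem by auto
    then have "\<delta> \<circ> \<gamma> \<in> deck z" "w = (\<delta> \<circ> \<gamma>) x" using deck_comp[OF z] that by auto
    then show "Y \<in> orbit_of (affine_group z) (q x)" unfolding w mem by blast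
  qed
  show ?thesis
  proof
    assume "orbit_of (affine_group z) (q x) = orbit_of (affine_group z) (q y)"
    then have "q y \<in> orbit_of (affine_group z) (q x)" using self[of y] by simp
    then show "\<exists>\<gamma>\<in>deck z. y = \<gamma> x" by (simp only: mem)
  next
    assume "\<exists>\<gamma>\<in>deck z. y = \<gamma> x"
    then obtain \<gamma> where g: "\<gamma> \<in> deck z" "y = \<gamma> x" by blast
    obtain \<delta> where d: "\<delta> \<in> deck z" "\<delta> \<circ> \<gamma> = id" using deck_left_inverse[OF z g(1)] by blast
    then have "x = \<delta> y" using g(2) by (simp add: fun_eq_iff)
    then show "orbit_of (affine_group z) (q x) = orbit_of (affine_group z) (q y)"
      using le[OF g] le[OF d(1)] by blast
  qed
qed

lemma uniformized_torus_quotient: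
  fixes B :: "complex ^ 'n \<Rightarrow> 'e::euclidean_space"
  assumes z: "z \<in> Z1" and d: "deck_group (deck z) B"
  shows "uniformized (torus_quotient L (affine_group z)) (orbit_of (affine_group z) \<circ> q) (deck z)"
  unfolding torus_quotient_def
  by (rule uniformized_quotient_manifold[OF uniformized_torus])
     (use orbit_affine_group_iff[OF z] deck_entire deck_group.wandering_neighbourhood[OF d] in auto)

end


section \<open>Cohomology classes and extensions\<close>

context torus_group
begin

abbreviation cls :: "('n torus_map \<Rightarrow> (complex ^ 'n) set) \<Rightarrow> ('n torus_map \<Rightarrow> (complex ^ 'n) set) set" where
  "cls \<equiv> class1 GG (torus L) (\<lambda>g t. g t)"

lemma class_iff:
  assumes z: "z \<in> G \<rightarrow>\<^sub>E carrier (torus L)"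
  shows "w \<in> cls z \<longleftrightarrow> (\<exists>m. w = (\<lambda>g\<in>G. q (lift g m - m) \<otimes>\<^bsub>torus L\<^esub> z g))"
proof -
  have "cls z = (\<lambda>m. \<lambda>g\<in>G. (\<lambda>g\<in>G. g (q m) \<otimes>\<^bsub>torus L\<^esub> inv\<^bsub>torus L\<^esub> q m) g \<otimes>\<^bsub>torus L\<^esub> z g) ` UNIV"
    by (auto simp: class1_def coboundaries1_def r_coset_def cocycles1_def pointwise_group_def carrier_torus
        simp del: torus_inv)
  also have "(\<lambda>m. \<lambda>g\<in>G. (\<lambda>g\<in>G. g (q m) \<otimes>\<^bsub>torus L\<^esub> inv\<^bsub>torus L\<^esub> q m) g \<otimes>\<^bsub>torus L\<^esub> z g) =
      (\<lambda>m. \<lambda>g\<in>G. q (lift g m - m) \<otimes>\<^bsub>torus L\<^esub> z g)"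
  proof (rule ext)
    fix m
    show "(\<lambda>g\<in>G. (\<lambda>g\<in>G. g (q m) \<otimes>\<^bsub>torus L\<^esub> inv\<^bsub>torus L\<^esub> q m) g \<otimes>\<^bsub>torus L\<^esub> z g) =
        (\<lambda>g\<in>G. q (lift g m - m) \<otimes>\<^bsub>torus L\<^esub> z g)"
      by (rule restrict_ext) (simp add: G_q)
  qed
  finally have eq: "cls z = range (\<lambda>m. \<lambda>g\<in>G. q (lift g m - m) \<otimes>\<^bsub>torus L\<^esub> z g)" .
  show ?thesis unfolding eq image_iff by blast
qed

lemma class_rep_iff:
  assumes z: "z \<in> G \<rightarrow>\<^sub>E carrier (torus L)"
  shows "w \<in> cls z \<longleftrightarrow> w \<in> extensional G \<and>
    (\<exists>m. \<forall>g\<in>G. \<forall>c. q c = z g \<longrightarrow> w g = q (c + lift g m - m))"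
proof -
  have eq: "w = (\<lambda>g\<in>G. q (lift g m - m) \<otimes>\<^bsub>torus L\<^esub> z g) \<longleftrightarrow>
      w \<in> extensional G \<and> (\<forall>g\<in>G. \<forall>c. q c = z g \<longrightarrow> w g = q (c + lift g m - m))" for m
  proof
    assume w: "w = (\<lambda>g\<in>G. q (lift g m - m) \<otimes>\<^bsub>torus L\<^esub> z g)"
    have "w g = q (c + lift g m - m)" if "g \<in> G" "q c = z g" for g c
      using that by (simp add: w flip: that(2)) (simp add: algebra_simps)
    then show "w \<in> extensional G \<and> (\<forall>g\<in>G. \<forall>c. q c = z g \<longrightarrow> w g = q (c + lift g m - m))"
      using w by simp
  next
    assume w: "w \<in> extensional G \<and> (\<forall>g\<in>G. \<forall>c. q c = z g \<longrightarrow> w g = q (c + lift g m - m))"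
    show "w = (\<lambda>g\<in>G. q (lift g m - m) \<otimes>\<^bsub>torus L\<^esub> z g)"
    proof (rule extensionalityI[of _ G])
      fix g assume g: "g \<in> G"
      obtain c where c: "q c = z g" using cochain_rep[OF z g] by blast
      then have "w g = q (c + lift g m - m)" using w g by blast
      then show "w g = (\<lambda>g\<in>G. q (lift g m - m) \<otimes>\<^bsub>torus L\<^esub> z g) g"
        using g by (simp flip: c) (simp add: algebra_simps)
    qed (use w in auto)
  qed
  show ?thesis unfolding class_iff[OF z] eq by blast
qed

lemma classE:
  assumes z: "z \<in> G \<rightarrow>\<^sub>E carrier (torus L)" and w: "w \<in> cls z"
  obtains m where "w \<in> extensional G" "\<And>g c. g \<in> G \<Longrightarrow> q c = z g \<Longrightarrow> w g = q (c + lift g m - m)"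
proof -
  from iffD1[OF class_rep_iff[OF z] w] obtain m
    where "w \<in> extensional G" and m: "\<forall>g\<in>G. \<forall>c. q c = z g \<longrightarrow> w g = q (c + lift g m - m)"
    by (elim conjE exE) (rule that)
  then show ?thesis using that[of m] by simp
qed

lemma class_self:
  assumes z: "z \<in> Z1"
  shows "z \<in> cls z"
  unfolding class_rep_iff[OF cocycle_fun[OF z]]
proof (intro conjI exI[of _ 0] ballI allI impI)
  show "z \<in> extensional G" using z by (simp add: cocycle_iff PiE_def)
  show "z g = q (c + lift g 0 - 0)" if "g \<in> G" "q c = z g" for g c
    using that by (simp add: complex_linear_zero)
qed

lemma class_mem_carrier:
  assumes z: "z \<in> G \<rightarrow>\<^sub>E carrier (torus L)" and w: "w \<in> cls z"
  shows "w \<in> G \<rightarrow>\<^sub>E carrier (torus L)"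
proof -
  obtain m where m: "w \<in> extensional G" "\<And>g c. g \<in> G \<Longrightarrow> q c = z g \<Longrightarrow> w g = q (c + lift g m - m)"
    by (rule classE[OF z w]) iprover
  have "w g \<in> carrier (torus L)" if g: "g \<in> G" for g
  proof -
    obtain c where "q c = z g" using cochain_rep[OF z g] by blast
    then show ?thesis using m(2)[OF g] by simp
  qed
  then show ?thesis using m(1) by (simp add: PiE_iff)
qed

lemma class_sym:
  assumes z: "z \<in> G \<rightarrow>\<^sub>E carrier (torus L)" and w: "w \<in> cls z"
  shows "z \<in> cls w"
proof -
  obtain m where m: "w \<in> extensional G" "\<And>g c. g \<in> G \<Longrightarrow> q c = z g \<Longrightarrow> w g = q (c + lift g m - m)"
    by (rule classE[OF z w]) iprover
  have "z g = q (d + lift g (- m) - (- m))" if g: "g \<in> G" "q d = w g" for g d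
  proof -
    obtain c where c: "q c = z g" using cochain_rep[OF z g(1)] by blast
    have "q d = q (c + lift g m - m)" using m(2)[OF g(1) c] g(2) by simp
    then have "c - (d + lift g (- m) - (- m)) \<in> L"
      using g(1) L_neg by (fastforce simp: q_eq_iff complex_linear_neg algebra_simps)
    then show ?thesis using c q_eq_iff[of c] by simp
  qed
  then show ?thesis
    unfolding class_rep_iff[OF class_mem_carrier[OF z w]]
    using z by (intro conjI exI[of _ "- m"]) (auto simp: PiE_def)
qed

lemma class_trans:
  assumes z: "z \<in> G \<rightarrow>\<^sub>E carrier (torus L)" and w: "w \<in> cls z" and u: "u \<in> cls w"
  shows "u \<in> cls z"
proof -
  obtain m where m: "w \<in> extensional G" "\<And>g c. g \<in> G \<Longrightarrow> q c = z g \<Longrightarrow> w g = q (c + lift g m - m)"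
    by (rule classE[OF z w]) iprover
  obtain k where k: "u \<in> extensional G" "\<And>g c. g \<in> G \<Longrightarrow> q c = w g \<Longrightarrow> u g = q (c + lift g k - k)"
    by (rule classE[OF class_mem_carrier[OF z w] u]) iprover
  have "u g = q (c + lift g (m + k) - (m + k))" if g: "g \<in> G" "q c = z g" for g c
    using k(2)[OF g(1), OF m(2)[OF g, symmetric]] g(1) by (simp add: complex_linear_add algebra_simps)
  then show ?thesis
    unfolding class_rep_iff[OF z] using k(1) by blast
qed

lemma class_eq:
  assumes z: "z \<in> Z1" and w: "w \<in> cls z"
  shows "cls w = cls z"
  using class_trans class_sym[OF cocycle_fun[OF z] w] class_mem_carrier[OF cocycle_fun[OF z] w] w cocycle_fun[OF z]
  by blast

lemma class_cocycle:
  assumes z: "z \<in> Z1" and w: "w \<in> cls z"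
  shows "w \<in> Z1"
proof (rule cocycleI[OF class_mem_carrier[OF cocycle_fun[OF z] w]])
  obtain m where "w \<in> extensional G" and m: "\<And>g c. g \<in> G \<Longrightarrow> q c = z g \<Longrightarrow> w g = q (c + lift g m - m)"
    by (rule classE[OF cocycle_fun[OF z] w]) iprover
  fix g h c d assume g: "g \<in> G" and h: "h \<in> G" and c: "q c = w g" and d: "q d = w h"
  obtain c' where c': "q c' = z g" using cocycle_rep[OF z g] by blast
  obtain d' where d': "q d' = z h" using cocycle_rep[OF z h] by blast
  define l where "l = c - (c' + lift g m - m)"
  define k where "k = d - (d' + lift h m - m)"
  have l: "l \<in> L" using m[OF g c'] c by (simp add: l_def q_eq_iff)
  have k: "lift g k \<in> L" using m[OF h d'] d lattice_aut_mem[OF lift_G[OF g]] by (simp add: k_def q_eq_iff)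
  have "w (g \<cdot> h) = q (lift g d' + c' + lift (g \<cdot> h) m - m)"
    by (rule m[OF G_mult[OF g h] cocycle_mult[OF z, OF g h c' d']])
  moreover have "lift g d + c = (lift g k + l) + (lift g d' + c' + lift (g \<cdot> h) m - m)"
    using g h by (simp add: l_def k_def complex_linear_add complex_linear_diff)
  ultimately show "q (lift g d + c) = w (g \<cdot> h)" using L_add[OF k l] by simp
qed

lemma carrier_torus_H1: "carrier (torus_H1 L G) = cls ` Z1"
  by (simp add: torus_H1_def cohomology1_def carrier_FactGroup class1_def[abs_def])

lemma lift_class_affine_group: "z \<in> Z1 \<Longrightarrow> lift_class L G (affine_group z) = cls z"
  by (simp add: lift_class_def lift_cocycle_affine_group)


subsection \<open>The connecting homomorphism\<close>

abbreviation lattice_group :: "(complex ^ 'n) monoid" where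
  "lattice_group \<equiv> vector_group\<lparr>carrier := L\<rparr>"

lemma inv_lattice_group: "l \<in> L \<Longrightarrow> inv\<^bsub>lattice_group\<^esub> l = - l"
  by (rule group.inv_equality[OF subgroup.subgroup_is_group[OF subgroup_L
        comm_group.axioms(2)[OF group_vector_group]]]) (simp_all add: L_neg)

text \<open>The inhomogeneous coboundary, written so that the same formula serves cochains with values in \<open>L\<close> and
  in \<open>V\<close>.\<close>

definition cobd :: "('n torus_map \<Rightarrow> complex ^ 'n) \<Rightarrow> 'n torus_map \<times> 'n torus_map \<Rightarrow> complex ^ 'n" where
  "cobd b = restrict (\<lambda>(g, h). lift g (b h) - b (g \<cdot> h) + b g) (G \<times> G)"

lemma coboundary2_vector: "coboundary2 GG vector_group lift b = cobd b"
  by (simp add: coboundary2_def cobd_def)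

lemma coboundary2_lattice:
  assumes b: "b \<in> G \<rightarrow>\<^sub>E L"
  shows "coboundary2 GG lattice_group lift b = cobd b"
  unfolding coboundary2_def cobd_def
proof (simp, rule restrict_ext, clarify)
  fix g h assume "g \<in> G" "h \<in> G"
  then have "b (g \<cdot> h) \<in> L" using b G_mult by blast
  then show "lift g (b h) + inv\<^bsub>lattice_group\<^esub> b (g \<cdot> h) + b g = lift g (b h) - b (g \<cdot> h) + b g"
    by (simp add: inv_lattice_group)
qed

definition lifts :: "('n torus_map \<Rightarrow> (complex ^ 'n) set) \<Rightarrow> ('n torus_map \<Rightarrow> complex ^ 'n) set" where
  "lifts z = {b \<in> G \<rightarrow>\<^sub>E UNIV. \<forall>g\<in>G. q (b g) = z g}"

lemma lifts_nonempty:
  assumes "z \<in> G \<rightarrow>\<^sub>E carrier (torus L)"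
  obtains b where "b \<in> lifts z"
proof -
  have "\<forall>g\<in>G. \<exists>c. q c = z g" using cochain_rep[OF assms] by metis
  then obtain b where "\<forall>g\<in>G. q (b g) = z g" by (auto dest: bchoice)
  then have "restrict b G \<in> lifts z" by (simp add: lifts_def)
  then show ?thesis using that by blast
qed

abbreviation Z2 :: "('n torus_map \<times> 'n torus_map \<Rightarrow> complex ^ 'n) set" where
  "Z2 \<equiv> carrier (cocycles2 GG lattice_group lift)"

text \<open>The class of \<open>c\<close> in \<open>H\<^sup>2(G,L)\<close>.\<close>

definition coset2 where
  "coset2 c = (\<lambda>l. \<lambda>x\<in>G \<times> G. cobd l x + c x) ` (G \<rightarrow>\<^sub>E L)"

lemma carrier_lattice_H2: "carrier (lattice_H2 L G) = coset2 ` Z2"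
proof -
  have "coboundary2 GG lattice_group lift ` (G \<rightarrow>\<^sub>E L) = cobd ` (G \<rightarrow>\<^sub>E L)"
    using coboundary2_lattice by (rule image_cong[OF refl])
  moreover have "cobd ` (G \<rightarrow>\<^sub>E L) #>\<^bsub>cocycles2 GG lattice_group lift\<^esub> c = coset2 c" for c
    by (auto simp: r_coset_def cocycles2_def pointwise_group_def coset2_def)
  ultimately show ?thesis
    by (simp add: lattice_H2_def cohomology2_def carrier_FactGroup)
qed

lemma cobd_eqI:
  assumes "\<And>g h. g \<in> G \<Longrightarrow> h \<in> G \<Longrightarrow> f (g, h) = lift g (b h) - b (g \<cdot> h) + b g" "f \<in> extensional (G \<times> G)"
  shows "f = cobd b"
  by (rule extensionalityI[OF assms(2)]) (auto simp: cobd_def assms(1))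

lemma cobd_apply: "g \<in> G \<Longrightarrow> h \<in> G \<Longrightarrow> cobd b (g, h) = lift g (b h) - b (g \<cdot> h) + b g"
  by (simp add: cobd_def)

text \<open>Two lifts of \<open>z\<close> differ by an \<open>L\<close>-valued cochain, so the coboundaries of all lifts form one class.\<close>

lemma coset2_eq_lifts:
  assumes b: "b \<in> lifts z" and "cobd b \<in> coset2 c"
  shows "coset2 c = cobd ` lifts z"
proof -
  obtain l0 where l0: "l0 \<in> G \<rightarrow>\<^sub>E L" "cobd b = (\<lambda>x\<in>G \<times> G. cobd l0 x + c x)"
    using assms(2) by (auto simp: coset2_def)
  have c: "c (g, h) = cobd b (g, h) - cobd l0 (g, h)" if "g \<in> G" "h \<in> G" for g h
    using fun_cong[OF l0(2), of "(g, h)"] that by simp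
  show ?thesis
  proof (intro Set.set_eqI iffI)
    fix f assume "f \<in> coset2 c"
    then obtain l where l: "l \<in> G \<rightarrow>\<^sub>E L" "f = (\<lambda>x\<in>G \<times> G. cobd l x + c x)" by (auto simp: coset2_def)
    define b' where "b' = (\<lambda>g\<in>G. b g + (l g - l0 g))"
    have "f = cobd b'"
      by (rule cobd_eqI) (auto simp: l(2) c cobd_apply b'_def G_mult complex_linear_add complex_linear_diff)
    moreover have "b' \<in> lifts z"
      using b l(1) l0(1) by (auto simp: lifts_def b'_def PiE_iff L_diff)
    ultimately show "f \<in> cobd ` lifts z" by blast
  next
    fix f assume "f \<in> cobd ` lifts z"
    then obtain b' where b': "b' \<in> lifts z" "f = cobd b'" by blast
    define l where "l = (\<lambda>g\<in>G. b' g - b g + l0 g)"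
    have "b' g - b g + l0 g \<in> L" if g: "g \<in> G" for g
    proof -
      have "q (b' g) = q (b g)" using b b'(1) g by (simp add: lifts_def)
      then show ?thesis using L_add l0(1) g by (auto simp: q_eq_iff)
    qed
    then have l: "l \<in> G \<rightarrow>\<^sub>E L" by (simp add: l_def)
    have "(\<lambda>x\<in>G \<times> G. cobd l x + c x) = cobd b'"
      by (rule cobd_eqI) (auto simp: c cobd_apply l_def G_mult complex_linear_add complex_linear_diff)
    then have "f = (\<lambda>x\<in>G \<times> G. cobd l x + c x)" using b'(2) by simp
    then show "f \<in> coset2 c" unfolding coset2_def using l by (rule image_eqI)
  qed
qed

lemma cobd_lifts_cocycle:
  assumes z: "z \<in> Z1" and b: "b \<in> lifts z"
  shows "cobd b \<in> Z2"
proof -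
  have bz: "q (b g) = z g" if "g \<in> G" for g using b that by (simp add: lifts_def)
  have "lift g (b h) - b (g \<cdot> h) + b g \<in> L" if g: "g \<in> G" and h: "h \<in> G" for g h
  proof -
    have "q (lift g (b h) + b g) = q (b (g \<cdot> h))"
      using cocycle_mult[OF z, OF g h bz[OF g] bz[OF h]] bz[OF G_mult[OF g h]] by simp
    then show ?thesis by (simp add: q_eq_iff algebra_simps)
  qed
  moreover have "g \<cdot> (h \<cdot> k) = (g \<cdot> h) \<cdot> k" if "g \<in> G" "h \<in> G" "k \<in> G" for g h k
    using monoid.m_assoc[OF group.is_monoid[OF group_torus_Aut]] that G_Aut by simp
  ultimately show ?thesis
    by (simp add: cocycles2_def pointwise_group_def PiE_iff G_mult cobd_apply complex_linear_add complex_linear_diff)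
      (auto simp: cobd_def)
qed

text \<open>Changing \<open>z\<close> by a coboundary changes a lift of \<open>z\<close> by a coboundary, which has coboundary zero.  Hence the
  connecting map is well defined on classes.\<close>

lemma cobd_lifts_class:
  assumes z: "z \<in> G \<rightarrow>\<^sub>E carrier (torus L)" and w: "w \<in> cls z"
  shows "cobd ` lifts z \<subseteq> cobd ` lifts w"
proof
  fix f assume "f \<in> cobd ` lifts z"
  then obtain b where b: "b \<in> lifts z" "f = cobd b" by blast
  obtain m where "w \<in> extensional G" and m: "\<And>g c. g \<in> G \<Longrightarrow> q c = z g \<Longrightarrow> w g = q (c + lift g m - m)"
    by (rule classE[OF z w]) iprover
  define b' where "b' = (\<lambda>g\<in>G. b g + lift g m - m)"
  have "w g = q (b g + lift g m - m)" if "g \<in> G" for g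
    by (rule m[OF that]) (use b(1) that in \<open>simp add: lifts_def\<close>)
  then have "b' \<in> lifts w" by (simp add: lifts_def b'_def)
  moreover have "f = cobd b'" unfolding b(2)
    by (rule cobd_eqI) (auto simp: cobd_apply b'_def G_mult complex_linear_add complex_linear_diff cobd_def)
  ultimately show "f \<in> cobd ` lifts w" by blast
qed

lemma connecting_map_class:
  assumes z: "z \<in> Z1"
  shows "connecting_map L G (cls z) = cobd ` lifts z"
  unfolding connecting_map_def
proof (rule the_equality)
  obtain b where b: "b \<in> lifts z" using lifts_nonempty[OF cocycle_fun[OF z]] by blast
  have "cobd b = (\<lambda>x\<in>G \<times> G. cobd (\<lambda>g\<in>G. 0) x + cobd b x)"
    by (rule extensionalityI[of _ "G \<times> G"]) (auto simp: cobd_def G_mult complex_linear_zero)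
  then have "cobd b \<in> coset2 (cobd b)" unfolding coset2_def by (rule image_eqI[where x = "\<lambda>g\<in>G. 0"]) simp
  then have "cobd ` lifts z = coset2 (cobd b)" using coset2_eq_lifts[OF b] by simp
  then have "cobd ` lifts z \<in> carrier (lattice_H2 L G)"
    using cobd_lifts_cocycle[OF z b] by (simp add: carrier_lattice_H2)
  moreover have "b \<in> G \<rightarrow>\<^sub>E UNIV" "\<forall>g\<in>G. L #>\<^bsub>vector_group\<^esub> b g = z g"
    using b by (simp_all add: lifts_def q_def)
  ultimately show "cobd ` lifts z \<in> carrier (lattice_H2 L G) \<and>
      (\<exists>z'\<in>cls z. \<exists>b\<in>G \<rightarrow>\<^sub>E UNIV. (\<forall>g\<in>G. L #>\<^bsub>vector_group\<^esub> b g = z' g) \<and>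
        coboundary2 GG vector_group lift b \<in> cobd ` lifts z)"
    using class_self[OF z] b coboundary2_vector by blast
next
  fix D assume "D \<in> carrier (lattice_H2 L G) \<and>
      (\<exists>z'\<in>cls z. \<exists>b\<in>G \<rightarrow>\<^sub>E UNIV. (\<forall>g\<in>G. L #>\<^bsub>vector_group\<^esub> b g = z' g) \<and>
        coboundary2 GG vector_group lift b \<in> D)"
  then obtain c w b where c: "D = coset2 c" and w: "w \<in> cls z" and b: "b \<in> lifts w" and "cobd b \<in> D"
    by (auto simp: carrier_lattice_H2 coboundary2_vector lifts_def q_def)
  then have "D = cobd ` lifts w" using coset2_eq_lifts[OF b] by simp
  then show "D = cobd ` lifts z"
    using cobd_lifts_class[OF cocycle_fun[OF z] w]
      cobd_lifts_class[OF class_mem_carrier[OF cocycle_fun[OF z] w] class_sym[OF cocycle_fun[OF z] w]] by blast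
qed


subsection \<open>Torsion and fixed points\<close>

lemma deck_funpow: "z \<in> Z1 \<Longrightarrow> \<gamma> \<in> deck z \<Longrightarrow> \<gamma> ^^ k \<in> deck z"
  by (induction k) (simp_all add: id_deck deck_comp)

lemma lift_funpow:
  assumes g: "g \<in> G"
  shows "(lift g ^^ card G) x = x"
proof -
  interpret GG: group GG by (rule group_GG)
  have "g [^]\<^bsub>GG\<^esub> k \<in> G \<and> (lift g ^^ k) x = lift (g [^]\<^bsub>GG\<^esub> k) x" for k :: nat
  proof (induction k arbitrary: x)
    case (Suc k)
    have "(lift g ^^ Suc k) x = (lift g ^^ k) (lift g x)" by (simp only: funpow_Suc_right comp_apply)
    then show ?case
      using g G_mult Suc by simp
  qed (simp add: G_one)
  moreover have "g [^]\<^bsub>GG\<^esub> (card G) = \<e>"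
    using GG.pow_order_eq_1[of g] g by (simp add: order_def)
  ultimately show ?thesis by (metis lift_G_one)
qed

text \<open>The order of \<open>G\<close> kills all linear parts, so this power of a deck transformation is a translation.\<close>

lemma deck_power_translation:
  assumes z: "z \<in> Z1" and \<gamma>: "\<gamma> \<in> deck z"
  obtains l where "l \<in> L" "\<And>x. (\<gamma> ^^ card G) x = x + l"
proof -
  obtain g c where g: "g \<in> G" "q c = z g" "\<gamma> = (\<lambda>x. lift g x + c)" using \<gamma> by (rule deckE)
  have "(lift g ^^ k) (x - y) = (\<gamma> ^^ k) x - (\<gamma> ^^ k) y" for k x y
    by (induction k) (simp_all add: g complex_linear_diff)
  from this[of "card G" _ 0] have "x = (\<gamma> ^^ card G) x - (\<gamma> ^^ card G) 0" for x
    using lift_funpow[OF g(1), of x] by (metis diff_zero)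
  then have tr: "(\<gamma> ^^ card G) x = x + (\<gamma> ^^ card G) 0" for x
    by (metis diff_add_cancel)
  obtain h d where h: "h \<in> G" "q d = z h" "\<gamma> ^^ card G = (\<lambda>x. lift h x + d)"
    using deck_funpow[OF z \<gamma>] by (rule deckE)
  have "lift h x = x" for x using tr[of x] h by (simp add: complex_linear_zero)
  then have "h = \<e>" using lift_inj[OF h(1) G_one] by (auto simp: fun_eq_iff)
  then have "d \<in> L" using h(2) cocycle_one[OF z] by (simp add: q_eq_iff)
  moreover have "(\<gamma> ^^ card G) x = x + d" for x using h(3) \<open>h = \<e>\<close> by simp
  ultimately show ?thesis using that by blast
qed

lemma card_G_pos: "card G > 0"
  using finite_G G_one by (auto simp: card_gt_0_iff)

lemma deck_torsion_free_iff:
  assumes z: "z \<in> Z1"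
  shows "(\<forall>\<gamma>\<in>deck z. \<forall>k>0. \<gamma> ^^ k = id \<longrightarrow> \<gamma> = id) \<longleftrightarrow> (\<forall>\<gamma>\<in>deck z. \<forall>x. \<gamma> x = x \<longrightarrow> \<gamma> = id)"
proof
  assume tf: "\<forall>\<gamma>\<in>deck z. \<forall>k>0. \<gamma> ^^ k = id \<longrightarrow> \<gamma> = id"
  show "\<forall>\<gamma>\<in>deck z. \<forall>x. \<gamma> x = x \<longrightarrow> \<gamma> = id"
  proof (intro ballI allI impI)
    fix \<gamma> x assume \<gamma>: "\<gamma> \<in> deck z" "\<gamma> x = x"
    obtain l where l: "\<And>y. (\<gamma> ^^ card G) y = y + l" using deck_power_translation[OF z \<gamma>(1)] by blast
    have "(\<gamma> ^^ k) x = x" for k by (induction k) (simp_all add: \<gamma>(2))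
    then have "l = 0" using l[of x] by simp
    then have "\<gamma> ^^ card G = id" using l by (simp add: fun_eq_iff)
    then show "\<gamma> = id" using tf \<gamma>(1) card_G_pos by blast
  qed
next
  assume free: "\<forall>\<gamma>\<in>deck z. \<forall>x. \<gamma> x = x \<longrightarrow> \<gamma> = id"
  show "\<forall>\<gamma>\<in>deck z. \<forall>k>0. \<gamma> ^^ k = id \<longrightarrow> \<gamma> = id"
  proof (intro ballI allI impI)
    fix \<gamma> and k :: nat assume \<gamma>: "\<gamma> \<in> deck z" and k: "k > 0" "\<gamma> ^^ k = id"
    obtain g c where g: "g \<in> G" "\<gamma> = (\<lambda>x. lift g x + c)" using \<gamma> by (rule deckE)
    \<comment> \<open>The centroid of a finite orbit is a fixed point.\<close>
    define y where "y = (\<lambda>i. (\<gamma> ^^ i) 0)"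
    define x where "x = (1 / real k) *\<^sub>R (\<Sum>i<k. y i)"
    have lin: "linear (lift g)" using g(1) by (simp add: complex_linear_imp_linear)
    have step: "lift g (y i) + c = y (Suc i)" for i by (simp add: y_def g(2))
    have c: "(1 / real k) *\<^sub>R (\<Sum>i<k. c) = c"
      unfolding sum_constant_scaleR using k(1) by simp
    have "\<gamma> x = (1 / real k) *\<^sub>R (\<Sum>i<k. lift g (y i)) + (1 / real k) *\<^sub>R (\<Sum>i<k. c)"
      unfolding c by (simp add: g(2) x_def linear_scale[OF lin] linear_sum[OF lin])
    also have "\<dots> = (1 / real k) *\<^sub>R (\<Sum>i<k. y (Suc i))"
      unfolding step[symmetric] sum.distrib scaleR_add_right ..
    also have "(\<Sum>i<k. y (Suc i)) = (\<Sum>i<k. y i)"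
    proof -
      have "y k = y 0" using k(2) by (simp add: y_def)
      then show ?thesis using sum.lessThan_Suc_shift[of y k] sum.lessThan_Suc[of y k] by simp
    qed
    finally have "\<gamma> x = x" by (simp add: x_def)
    then show "\<gamma> = id" using free \<gamma> by blast
  qed
qed

text \<open>Mapping \<open>(l, g)\<close> to \<open>x \<mapsto> g x + l + b(g)\<close> is an isomorphism from the extension onto the deck group.\<close>

lemma torsion_free_extension_iff:
  assumes z: "z \<in> Z1" and b: "b \<in> lifts z"
  shows "torsion_free (extension GG lattice_group lift (cobd b)) \<longleftrightarrow>
    (\<forall>\<gamma>\<in>deck z. \<forall>x. \<gamma> x = x \<longrightarrow> \<gamma> = id)"
proof -
  let ?E = "extension GG lattice_group lift (cobd b)"
  have bz: "q (b g) = z g" if "g \<in> G" for g using b that by (simp add: lifts_def)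
  have carrier: "carrier ?E = L \<times> G" by (simp add: extension_def)
  define \<Theta> where "\<Theta> = (\<lambda>(l, g) x. lift g x + (l + b g))"
  have b1: "b \<e> \<in> L" using bz[OF G_one] cocycle_one[OF z] by (simp add: q_eq_iff)
  have "cobd b (\<e>, \<e>) = b \<e>"
    using G_one monoid.l_one[OF group.is_monoid[OF group_torus_Aut] G_Aut[OF G_one]] by (simp add: cobd_apply)
  then have one: "\<one>\<^bsub>?E\<^esub> = (- b \<e>, \<e>)" using b1 by (simp add: extension_def inv_lattice_group)
  have \<Theta>_one: "\<Theta> \<one>\<^bsub>?E\<^esub> = id" by (simp add: one \<Theta>_def fun_eq_iff)
  have one_mem: "\<one>\<^bsub>?E\<^esub> \<in> L \<times> G" using b1 G_one by (simp add: one L_neg)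
  have \<Theta>_mult: "x \<otimes>\<^bsub>?E\<^esub> y \<in> L \<times> G \<and> \<Theta> (x \<otimes>\<^bsub>?E\<^esub> y) = \<Theta> x \<circ> \<Theta> y" if xy: "x \<in> L \<times> G" "y \<in> L \<times> G" for x y
  proof -
    obtain l g m h where lg: "x = (l, g)" "l \<in> L" "g \<in> G" "y = (m, h)" "m \<in> L" "h \<in> G" using xy by auto
    have xy: "x \<otimes>\<^bsub>?E\<^esub> y = (l + lift g m + cobd b (g, h), g \<cdot> h)" by (simp add: extension_def lg)
    have "cobd b (g, h) \<in> L"
      using cobd_lifts_cocycle[OF z b] lg by (auto simp: cocycles2_def pointwise_group_def PiE_iff)
    then have "l + lift g m + cobd b (g, h) \<in> L"
      using lg lattice_aut_mem[OF lift_G] by (intro L_add) auto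
    then show ?thesis
      using lg G_mult unfolding xy by (auto simp: \<Theta>_def cobd_apply fun_eq_iff complex_linear_add)
  qed
  have \<Theta>_inj: "x = y" if xy: "x \<in> L \<times> G" "y \<in> L \<times> G" and eq: "\<Theta> x = \<Theta> y" for x y
  proof -
    obtain l g m h where lg: "x = (l, g)" "g \<in> G" "y = (m, h)" "h \<in> G" using xy by auto
    have eq': "lift g v + (l + b g) = lift h v + (m + b h)" for v
      using fun_cong[OF eq, of v] by (simp add: \<Theta>_def lg)
    have c: "l + b g = m + b h" using eq'[of 0] lg by (simp add: complex_linear_zero)
    then have "lift g = lift h" using eq' by (simp add: fun_eq_iff)
    then have "g = h" using lift_inj lg by blast
    then show ?thesis using c lg by simp
  qed
  have \<Theta>_image: "\<Theta> ` (L \<times> G) = deck z"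
  proof (intro Set.set_eqI iffI)
    fix \<gamma> assume "\<gamma> \<in> \<Theta> ` (L \<times> G)"
    then obtain l g where lg: "l \<in> L" "g \<in> G" "\<gamma> = (\<lambda>x. lift g x + (l + b g))" by (auto simp: \<Theta>_def)
    then show "\<gamma> \<in> deck z" using deckI[of g "l + b g" z] bz by simp
  next
    fix \<gamma> assume "\<gamma> \<in> deck z"
    then obtain g c where g: "g \<in> G" "q c = z g" "\<gamma> = (\<lambda>x. lift g x + c)" by (rule deckE)
    have "c - b g \<in> L" using bz[OF g(1)] g(2) by (simp add: q_eq_iff[symmetric])
    moreover have "\<gamma> = \<Theta> (c - b g, g)" by (simp add: \<Theta>_def g(3))
    ultimately show "\<gamma> \<in> \<Theta> ` (L \<times> G)" using g(1) by blast
  qed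
  have \<Theta>_pow: "x [^]\<^bsub>?E\<^esub> k \<in> L \<times> G \<and> \<Theta> (x [^]\<^bsub>?E\<^esub> k) = \<Theta> x ^^ k" if x: "x \<in> L \<times> G" for x and k :: nat
  proof (induction k)
    case 0
    then show ?case using one_mem \<Theta>_one by (simp add: nat_pow_def)
  next
    case (Suc k)
    have "x [^]\<^bsub>?E\<^esub> Suc k = x [^]\<^bsub>?E\<^esub> k \<otimes>\<^bsub>?E\<^esub> x" by (simp add: nat_pow_def)
    then show ?case using \<Theta>_mult[OF _ x] Suc by (metis funpow_Suc_right)
  qed
  have pow_iff: "x [^]\<^bsub>?E\<^esub> k = \<one>\<^bsub>?E\<^esub> \<longleftrightarrow> \<Theta> x ^^ k = id"
    and one_iff: "x = \<one>\<^bsub>?E\<^esub> \<longleftrightarrow> \<Theta> x = id" if x: "x \<in> L \<times> G" for x and k :: nat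
    using \<Theta>_pow[OF x, of k] \<Theta>_one one_mem \<Theta>_inj x by metis+
  have "torsion_free ?E \<longleftrightarrow> (\<forall>x\<in>L \<times> G. \<forall>k>0. \<Theta> x ^^ k = id \<longrightarrow> \<Theta> x = id)"
    unfolding torsion_free_def carrier
    by (rule ball_cong[OF refl]) (simp only: pow_iff one_iff imp_conjL)
  also have "\<dots> \<longleftrightarrow> (\<forall>\<gamma>\<in>\<Theta> ` (L \<times> G). \<forall>k>0. \<gamma> ^^ k = id \<longrightarrow> \<gamma> = id)"
    by blast
  finally have "torsion_free ?E \<longleftrightarrow> (\<forall>\<gamma>\<in>deck z. \<forall>k>0. \<gamma> ^^ k = id \<longrightarrow> \<gamma> = id)"
    unfolding \<Theta>_image .
  then show ?thesis using deck_torsion_free_iff[OF z] by simp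
qed

lemma special_class_iff:
  assumes z: "z \<in> Z1"
  shows "cls z \<in> special_classes L G \<longleftrightarrow> affine_group z \<in> free_lifts L G"
proof -
  have "affine_group z \<in> free_lifts L G \<longleftrightarrow> acts_freely_on_torus L (affine_group z)"
    using free_lifts_iff z by blast
  moreover obtain b where "b \<in> lifts z" using lifts_nonempty[OF cocycle_fun[OF z]] by blast
  ultimately show ?thesis
    using torsion_free_extension_iff[OF z] z
    by (auto simp: special_classes_def connecting_map_class acts_freely_iff carrier_torus_H1)
qed

end


section \<open>The action of the normalizer\<close>

context torus_group
begin

abbreviation N :: "'n torus_map set" where "N \<equiv> normalizer (torus_Aut0 L) G"

abbreviation invA (\<open>(_\<^sup>-)\<close> [1000] 999) where "n\<^sup>- \<equiv> inv\<^bsub>torus_Aut0 L\<^esub> n"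

lemma Aut_assoc:
  "f \<in> carrier (torus_Aut0 L) \<Longrightarrow> g \<in> carrier (torus_Aut0 L) \<Longrightarrow> h \<in> carrier (torus_Aut0 L) \<Longrightarrow> f \<cdot> g \<cdot> h = f \<cdot> (g \<cdot> h)"
  using monoid.m_assoc[OF group.is_monoid[OF group_torus_Aut]] torus_Aut0_mem_Aut by blast

lemma Aut0_mult_closed: "f \<in> carrier (torus_Aut0 L) \<Longrightarrow> g \<in> carrier (torus_Aut0 L) \<Longrightarrow> f \<cdot> g \<in> carrier (torus_Aut0 L)"
  using monoid.m_closed[OF group.is_monoid[OF group_torus_Aut0]] by simp

lemma Aut0_inv:
  assumes "n \<in> carrier (torus_Aut0 L)"
  shows "n\<^sup>- \<in> carrier (torus_Aut0 L)" "n \<cdot> n\<^sup>- = \<e>" "n\<^sup>- \<cdot> n = \<e>" "(n\<^sup>-)\<^sup>- = n"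
  using group.inv_closed[OF group_torus_Aut0 assms] group.r_inv[OF group_torus_Aut0 assms]
    group.l_inv[OF group_torus_Aut0 assms] group.inv_inv[OF group_torus_Aut0 assms] by simp_all

lemma Aut0_l_one: "f \<in> carrier (torus_Aut0 L) \<Longrightarrow> \<e> \<cdot> f = f"
  and Aut0_r_one: "f \<in> carrier (torus_Aut0 L) \<Longrightarrow> f \<cdot> \<e> = f"
  using monoid.l_one[OF group.is_monoid[OF group_torus_Aut]] monoid.r_one[OF group.is_monoid[OF group_torus_Aut]]
    torus_Aut0_mem_Aut by blast+

lemma normalizer_iff:
  "n \<in> N \<longleftrightarrow> n \<in> carrier (torus_Aut0 L) \<and> (\<forall>a\<in>G. n\<^sup>- \<cdot> a \<cdot> n \<in> G) \<and> (\<forall>a\<in>G. n \<cdot> a \<cdot> n\<^sup>- \<in> G)"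
proof (cases "n \<in> carrier (torus_Aut0 L)")
  case True
  note n = Aut0_inv[OF True]
  have eq: "n <#\<^bsub>torus_Aut0 L\<^esub> G #>\<^bsub>torus_Aut0 L\<^esub> n\<^sup>- = (\<lambda>a. n \<cdot> a \<cdot> n\<^sup>-) ` G"
    by (auto simp: l_coset_def r_coset_def)
  have cancel: "n \<cdot> (n\<^sup>- \<cdot> a \<cdot> n) \<cdot> n\<^sup>- = a" "n\<^sup>- \<cdot> (n \<cdot> a \<cdot> n\<^sup>-) \<cdot> n = a" if a: "a \<in> G" for a
  proof -
    note a' = G_Aut0[OF a]
    have "n \<cdot> (n\<^sup>- \<cdot> a \<cdot> n) \<cdot> n\<^sup>- = (n \<cdot> n\<^sup>-) \<cdot> a \<cdot> (n \<cdot> n\<^sup>-)"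
      using n(1) True a' by (simp only: Aut_assoc Aut0_mult_closed)
    then show "n \<cdot> (n\<^sup>- \<cdot> a \<cdot> n) \<cdot> n\<^sup>- = a" by (simp only: n(2) Aut0_l_one[OF a'] Aut0_r_one[OF a'])
    have "n\<^sup>- \<cdot> (n \<cdot> a \<cdot> n\<^sup>-) \<cdot> n = (n\<^sup>- \<cdot> n) \<cdot> a \<cdot> (n\<^sup>- \<cdot> n)"
      using n(1) True a' by (simp only: Aut_assoc Aut0_mult_closed)
    then show "n\<^sup>- \<cdot> (n \<cdot> a \<cdot> n\<^sup>-) \<cdot> n = a" by (simp only: n(3) Aut0_l_one[OF a'] Aut0_r_one[OF a'])
  qed
  have "n \<in> N \<longleftrightarrow> (\<lambda>a. n \<cdot> a \<cdot> n\<^sup>-) ` G = G"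
    using True subgroup.subset[OF subgroup_G] by (simp add: normalizer_def stabilizer_def eq)
  also have "\<dots> \<longleftrightarrow> (\<forall>a\<in>G. n\<^sup>- \<cdot> a \<cdot> n \<in> G) \<and> (\<forall>a\<in>G. n \<cdot> a \<cdot> n\<^sup>- \<in> G)"
  proof
    assume img: "(\<lambda>a. n \<cdot> a \<cdot> n\<^sup>-) ` G = G"
    have "n\<^sup>- \<cdot> a \<cdot> n \<in> G" if "a \<in> G" for a
    proof -
      have "a \<in> (\<lambda>a. n \<cdot> a \<cdot> n\<^sup>-) ` G" using img \<open>a \<in> G\<close> by simp
      then obtain b where "b \<in> G" "a = n \<cdot> b \<cdot> n\<^sup>-" by blast
      then show ?thesis using cancel(2) by simp
    qed
    then show "(\<forall>a\<in>G. n\<^sup>- \<cdot> a \<cdot> n \<in> G) \<and> (\<forall>a\<in>G. n \<cdot> a \<cdot> n\<^sup>- \<in> G)" using img by blast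
  next
    assume closed: "(\<forall>a\<in>G. n\<^sup>- \<cdot> a \<cdot> n \<in> G) \<and> (\<forall>a\<in>G. n \<cdot> a \<cdot> n\<^sup>- \<in> G)"
    show "(\<lambda>a. n \<cdot> a \<cdot> n\<^sup>-) ` G = G"
    proof
      show "G \<subseteq> (\<lambda>a. n \<cdot> a \<cdot> n\<^sup>-) ` G"
      proof
        fix a assume a: "a \<in> G"
        show "a \<in> (\<lambda>a. n \<cdot> a \<cdot> n\<^sup>-) ` G"
          by (rule image_eqI[of _ _ "n\<^sup>- \<cdot> a \<cdot> n"]) (use closed a cancel(1)[OF a] in auto)
      qed
    qed (use closed in auto)
  qed
  finally show ?thesis using True by simp
next
  case False
  then show ?thesis by (simp add: normalizer_def stabilizer_def)
qed

lemma N_Aut0: "n \<in> N \<Longrightarrow> n \<in> carrier (torus_Aut0 L)"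
  by (simp add: normalizer_iff)

lemma subgroup_N: "subgroup N (torus_Aut0 L)"
  by (rule group.normalizer_imp_subgroup[OF group_torus_Aut0 subgroup.subset[OF subgroup_G]])

lemma N_one: "\<e> \<in> N"
  using subgroup.one_closed[OF subgroup_N] by simp

lemma N_mult: "n \<in> N \<Longrightarrow> m \<in> N \<Longrightarrow> n \<cdot> m \<in> N"
  using subgroup.m_closed[OF subgroup_N] by simp

lemma N_inv: "n \<in> N \<Longrightarrow> n\<^sup>- \<in> N"
  by (rule subgroup.m_inv_closed[OF subgroup_N])

definition conj_by :: "'n torus_map \<Rightarrow> 'n torus_map \<Rightarrow> 'n torus_map" where
  "conj_by n a = n\<^sup>- \<cdot> a \<cdot> n"

lemma conj_by_G: "n \<in> N \<Longrightarrow> a \<in> G \<Longrightarrow> conj_by n a \<in> G"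
  by (simp add: normalizer_iff conj_by_def)

lemma conj_by_eq_iff:
  assumes n: "n \<in> carrier (torus_Aut0 L)" and a: "a \<in> carrier (torus_Aut0 L)" and g: "g \<in> carrier (torus_Aut0 L)"
  shows "conj_by n a = g \<longleftrightarrow> a \<cdot> n = n \<cdot> g" "n \<cdot> g \<cdot> n\<^sup>- = a \<longleftrightarrow> a \<cdot> n = n \<cdot> g"
proof -
  note n' = Aut0_inv[OF n]
  have "n \<cdot> (n\<^sup>- \<cdot> (a \<cdot> n)) = a \<cdot> n"
    using n n' a by (simp only: Aut_assoc[symmetric] Aut0_mult_closed Aut0_l_one)
  moreover have "n\<^sup>- \<cdot> (n \<cdot> g) = g"
    using n n' g by (simp only: Aut_assoc[symmetric] Aut0_mult_closed Aut0_l_one)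
  moreover have "conj_by n a = n\<^sup>- \<cdot> (a \<cdot> n)"
    using n n'(1) a by (simp only: conj_by_def Aut_assoc)
  ultimately show "conj_by n a = g \<longleftrightarrow> a \<cdot> n = n \<cdot> g" by metis
  have "n \<cdot> g \<cdot> n\<^sup>- \<cdot> n = n \<cdot> g"
    using n n' g by (simp only: Aut_assoc Aut0_mult_closed Aut0_r_one)
  moreover have "a \<cdot> n \<cdot> n\<^sup>- = a"
    using n n' a by (simp only: Aut_assoc Aut0_mult_closed Aut0_r_one)
  ultimately show "n \<cdot> g \<cdot> n\<^sup>- = a \<longleftrightarrow> a \<cdot> n = n \<cdot> g" by metis
qed

lemma commute_lift_iff:
  assumes n: "n \<in> carrier (torus_Aut0 L)" and a: "a \<in> carrier (torus_Aut0 L)" and g: "g \<in> carrier (torus_Aut0 L)"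
  shows "a \<cdot> n = n \<cdot> g \<longleftrightarrow> (\<forall>x. lift a (lift n x) = lift n (lift g x))"
proof
  assume "a \<cdot> n = n \<cdot> g"
  then have "lift (a \<cdot> n) = lift (n \<cdot> g)" by simp
  then show "\<forall>x. lift a (lift n x) = lift n (lift g x)"
    using assms by (simp add: lift_mult fun_eq_iff)
next
  assume "\<forall>x. lift a (lift n x) = lift n (lift g x)"
  then have eq: "lift (a \<cdot> n) = lift (n \<cdot> g)"
    using assms by (simp add: lift_mult fun_eq_iff)
  have "a \<cdot> n = aff (lift (a \<cdot> n)) 0" by (rule aff_lift[OF Aut0_mult_closed[OF a n], symmetric])
  also have "\<dots> = n \<cdot> g" unfolding eq by (rule aff_lift[OF Aut0_mult_closed[OF n g]])
  finally show "a \<cdot> n = n \<cdot> g" .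
qed

lemma lift_conj_by:
  assumes "n \<in> N" "a \<in> G"
  shows "lift n (lift (conj_by n a) x) = lift a (lift n x)"
proof -
  note n = N_Aut0[OF assms(1)] and a = G_Aut0[OF assms(2)] and g = G_Aut0[OF conj_by_G[OF assms]]
  have "a \<cdot> n = n \<cdot> conj_by n a" using conj_by_eq_iff(1)[OF n a g] by simp
  then show ?thesis using commute_lift_iff[OF n a g] by simp
qed

text \<open>An element of \<open>Aut\<^sub>0(T)\<close> is determined by its lift, so conjugation can be computed in \<open>V\<close>.\<close>

lemma conj_by_unique:
  assumes n: "n \<in> N" and a: "a \<in> G" and g: "g \<in> G" and eq: "\<And>x. lift a (lift n x) = lift n (lift g x)"
  shows "conj_by n a = g"
  using conj_by_eq_iff(1) commute_lift_iff N_Aut0[OF n] G_Aut0 a g eq by blast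

lemma lift_N [simp]: "n \<in> N \<Longrightarrow> lattice_aut (lift n)"
  by (rule lattice_aut_lift[OF N_Aut0])

lemma lift_N_linear [simp]: "n \<in> N \<Longrightarrow> complex_linear (lift n)"
  by (rule lattice_aut_linear[OF lift_N])

lemma star_apply:
  assumes "n \<in> N" "a \<in> G" "q c = z (conj_by n a)"
  shows "star L G n z a = q (lift n c)"
proof -
  have "star L G n z a = n (q c)" using assms(2,3) by (simp add: star_def conj_by_def)
  then show ?thesis using torus_Aut0_q[OF N_Aut0[OF assms(1)]] by simp
qed

lemma star_extensional: "star L G n z \<in> extensional G"
  by (simp add: star_def)

lemma conj_by_mult:
  assumes "n \<in> N" "a \<in> G" "b \<in> G"
  shows "conj_by n (a \<cdot> b) = conj_by n a \<cdot> conj_by n b"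
  using assms by (intro conj_by_unique) (simp_all add: G_mult conj_by_G lift_conj_by)

lemma star_cocycle:
  assumes n: "n \<in> N" and z: "z \<in> Z1"
  shows "star L G n z \<in> Z1"
proof (rule cocycleI)
  have val: "\<exists>c. q c = z (conj_by n a) \<and> star L G n z a = q (lift n c)" if a: "a \<in> G" for a
  proof -
    obtain c where "q c = z (conj_by n a)" using cocycle_rep[OF z conj_by_G[OF n a]] by blast
    then show ?thesis using star_apply[OF n a] by blast
  qed
  have "star L G n z a \<in> carrier (torus L)" if "a \<in> G" for a
    using val[OF that] by auto
  then show "star L G n z \<in> G \<rightarrow>\<^sub>E carrier (torus L)"
    using star_extensional by (simp add: PiE_iff)
  fix a b c d assume a: "a \<in> G" and b: "b \<in> G" and c: "q c = star L G n z a" and d: "q d = star L G n z b"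
  obtain c' where c': "q c' = z (conj_by n a)" "q c = q (lift n c')" using val[OF a] c by auto
  obtain d' where d': "q d' = z (conj_by n b)" "q d = q (lift n d')" using val[OF b] d by auto
  have "q (lift (conj_by n a) d' + c') = z (conj_by n (a \<cdot> b))"
    using cocycle_mult[OF z, OF conj_by_G[OF n a] conj_by_G[OF n b] c'(1) d'(1)] conj_by_mult[OF n a b] by simp
  then have "star L G n z (a \<cdot> b) = q (lift n (lift (conj_by n a) d' + c'))"
    by (rule star_apply[OF n G_mult[OF a b]])
  also have "\<dots> = q (lift a (lift n d') + lift n c')"
    using n a by (simp add: complex_linear_add lift_conj_by)
  also have "\<dots> = q (lift a d + c)"
  proof -
    have "lift n c' - c \<in> L" using c'(2) L_diff_commute by (simp add: q_eq_iff)
    moreover have "lift a (lift n d' - d) \<in> L"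
      using d'(2) L_diff_commute lattice_aut_mem[OF lift_G[OF a]] by (simp add: q_eq_iff)
    ultimately have "lift a (lift n d' - d) + (lift n c' - c) \<in> L" using L_add by blast
    then show ?thesis using a by (simp add: q_eq_iff complex_linear_diff algebra_simps)
  qed
  finally show "q (lift a d + c) = star L G n z (a \<cdot> b)" by simp
qed

lemma star_one:
  assumes z: "z \<in> Z1"
  shows "star L G \<e> z = z"
proof (rule extensionalityI[OF star_extensional])
  show "z \<in> extensional G" using z by (simp add: cocycle_iff PiE_def)
  fix a assume a: "a \<in> G"
  obtain c where c: "q c = z a" using cocycle_rep[OF z a] by blast
  have "conj_by \<e> a = a" by (rule conj_by_unique[OF N_one a a]) simp
  then show "star L G \<e> z a = z a" using star_apply[OF N_one a, of c z] c by simp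
qed

lemma star_mult:
  assumes n: "n \<in> N" and m: "m \<in> N" and z: "z \<in> Z1"
  shows "star L G n (star L G m z) = star L G (n \<cdot> m) z"
proof (rule extensionalityI[OF star_extensional star_extensional])
  fix a assume a: "a \<in> G"
  let ?b = "conj_by n a"
  have b: "?b \<in> G" "conj_by m ?b \<in> G" using conj_by_G n m a by auto
  obtain c where c: "q c = z (conj_by m ?b)" using cocycle_rep[OF z b(2)] by blast
  have nm: "lift (n \<cdot> m) x = lift n (lift m x)" for x
    by (simp add: lift_mult N_Aut0 n m)
  have "conj_by (n \<cdot> m) a = conj_by m ?b"
    by (rule conj_by_unique[OF N_mult[OF n m] a b(2)]) (simp add: nm lift_conj_by n m a b)
  then have "star L G (n \<cdot> m) z a = q (lift (n \<cdot> m) c)"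
    using star_apply[OF N_mult[OF n m] a, of c z] c by simp
  moreover have "star L G m z ?b = q (lift m c)" by (rule star_apply[where z = z, OF m b(1) c])
  then have "star L G n (star L G m z) a = q (lift n (lift m c))"
    using star_apply[OF n a, of "lift m c" "star L G m z"] by simp
  ultimately show "star L G n (star L G m z) a = star L G (n \<cdot> m) z a" by (simp add: nm)
qed

lemma star_class_mem:
  assumes n: "n \<in> N" and z: "z \<in> Z1" and w: "w \<in> cls z"
  shows "star L G n w \<in> cls (star L G n z)"
proof -
  obtain m where "w \<in> extensional G" and m: "\<And>g c. g \<in> G \<Longrightarrow> q c = z g \<Longrightarrow> w g = q (c + lift g m - m)"
    by (rule classE[OF cocycle_fun[OF z] w]) iprover
  have "star L G n w a = q (c + lift a (lift n m) - lift n m)" if a: "a \<in> G" and c: "q c = star L G n z a" for a c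
  proof -
    let ?g = "conj_by n a"
    obtain d where d: "q d = z ?g" using cocycle_rep[OF z conj_by_G[OF n a]] by blast
    have "q (d + lift ?g m - m) = w ?g" using m[OF conj_by_G[OF n a] d] by simp
    then have "star L G n w a = q (lift n (d + lift ?g m - m))" by (rule star_apply[OF n a])
    also have "\<dots> = q (lift n d + (lift a (lift n m) - lift n m))"
      using n a by (simp add: complex_linear_add complex_linear_diff lift_conj_by add_diff_eq)
    also have "\<dots> = q (c + (lift a (lift n m) - lift n m))"
    proof -
      have "q (lift n d) = q c" using star_apply[where z = z, OF n a d] c by simp
      then show ?thesis by (simp add: q_eq_iff)
    qed
    finally show ?thesis by (simp add: add_diff_eq)
  qed
  then show ?thesis
    unfolding class_rep_iff[OF cocycle_fun[OF star_cocycle[OF n z]]]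
    using star_extensional by blast
qed

lemma star_class_cls:
  assumes n: "n \<in> N" and z: "z \<in> Z1"
  shows "star_class L G n (cls z) = cls (star L G n z)"
proof
  show "star_class L G n (cls z) \<subseteq> cls (star L G n z)"
    using star_class_mem[OF n z] by (auto simp: star_class_def)
  show "cls (star L G n z) \<subseteq> star_class L G n (cls z)"
  proof
    fix u assume u: "u \<in> cls (star L G n z)"
    note n' = N_inv[OF n] and sz = star_cocycle[OF n z]
    have u': "u \<in> Z1" by (rule class_cocycle[OF sz u])
    have "star L G (n\<^sup>-) u \<in> cls (star L G (n\<^sup>-) (star L G n z))" by (rule star_class_mem[OF n' sz u])
    then have "star L G (n\<^sup>-) u \<in> cls z"
      using star_mult[OF n' n z] star_one[OF z] Aut0_inv(3)[OF N_Aut0[OF n]] by simp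
    moreover have "u = star L G n (star L G (n\<^sup>-) u)"
      using star_mult[OF n n' u'] star_one[OF u'] Aut0_inv(2)[OF N_Aut0[OF n]] by simp
    ultimately show "u \<in> star_class L G n (cls z)" by (auto simp: star_class_def)
  qed
qed

abbreviation orb where
  "orb C \<equiv> orbit (normalizer_group L G) (star_class L G) C"

lemma orbit_cls:
  assumes z: "z \<in> Z1"
  shows "orb (cls z) = (\<lambda>n. cls (star L G n z)) ` N"
proof -
  have "orb (cls z) = (\<lambda>n. star_class L G n (cls z)) ` N"
    by (auto simp: orbit_def normalizer_group_def)
  also have "\<dots> = (\<lambda>n. cls (star L G n z)) ` N"
    by (rule image_cong[OF refl star_class_cls[OF _ z]])
  finally show ?thesis .
qed

lemma orbit_eq_iff:
  assumes z: "z \<in> Z1" and z': "z' \<in> Z1"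
  shows "orb (cls z) = orb (cls z') \<longleftrightarrow> (\<exists>n\<in>N. star L G n z \<in> cls z')"
proof
  assume eq: "orb (cls z) = orb (cls z')"
  have "cls z' \<in> orb (cls z')"
    unfolding orbit_cls[OF z'] by (rule image_eqI[OF _ N_one]) (simp add: star_one[OF z'])
  then have "cls z' \<in> (\<lambda>n. cls (star L G n z)) ` N"
    by (simp only: eq[symmetric] orbit_cls[OF z])
  then obtain n where "n \<in> N" "cls z' = cls (star L G n z)" by blast
  then show "\<exists>n\<in>N. star L G n z \<in> cls z'"
    using class_self[OF star_cocycle[OF _ z]] by blast
next
  assume "\<exists>n\<in>N. star L G n z \<in> cls z'"
  then obtain n where n: "n \<in> N" "star L G n z \<in> cls z'" by blast
  have eq: "cls z' = cls (star L G n z)" using class_eq[OF z' n(2)] by simp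
  have sub: "orb (cls w') \<subseteq> orb (cls w)" if w: "w \<in> Z1" "w' \<in> Z1" "k \<in> N" "cls w' = cls (star L G k w)" for w w' k
  proof
    fix C assume "C \<in> orb (cls w')"
    then obtain m where m: "m \<in> N" "C = cls (star L G m w')" using orbit_cls[OF w(2)] by auto
    then have "C = star_class L G m (cls (star L G k w))" using star_class_cls[OF m(1) w(2)] w(4) by simp
    also have "\<dots> = cls (star L G (m \<cdot> k) w)"
      using star_class_cls[OF m(1) star_cocycle[OF w(3,1)]] star_mult[OF m(1) w(3,1)] by simp
    finally show "C \<in> orb (cls w)" using orbit_cls[OF w(1)] N_mult[OF m(1) w(3)] by blast
  qed
  note n' = N_inv[OF n(1)]
  have "cls z = star_class L G (n\<^sup>-) (cls (star L G n z))"
    using star_class_cls[OF n' star_cocycle[OF n(1) z]] star_mult[OF n' n(1) z] star_one[OF z]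
      Aut0_inv(3)[OF N_Aut0[OF n(1)]] by simp
  then have "cls z = cls (star L G (n\<^sup>-) z')" using eq star_class_cls[OF n' z'] by simp
  then show "orb (cls z) = orb (cls z')"
    using sub[OF z z' n(1) eq] sub[OF z' z n'] by blast
qed


section \<open>Conjugacy of the lifted groups\<close>

text \<open>Let \<open>F x = A x + t\<close>, and let \<open>\<gamma> x = g x + d\<close> and \<open>\<gamma>' x = a x + c\<close> be lifts belonging to \<open>z\<close> and \<open>z'\<close>.
  Then \<open>F \<circ> \<gamma> = \<gamma>' \<circ> F\<close> says that \<open>A g = a A\<close> and \<open>A d = c + a t - t\<close>.  The first equation says that
  \<open>A\<close> conjugates \<open>g\<close> to \<open>a\<close>, the second that \<open>n * z\<close> is \<open>z'\<close> plus the coboundary of \<open>t\<close>.\<close>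

lemma conjugate_iff_star:
  assumes z: "z \<in> Z1" and z': "z' \<in> Z1"
  shows "(\<exists>n\<in>N. star L G n z \<in> cls z') \<longleftrightarrow>
    (\<exists>A t F F'. lattice_aut A \<and> F = (\<lambda>x. A x + t) \<and> (\<forall>x. F (F' x) = x) \<and> (\<forall>x. F' (F x) = x) \<and>
      (\<forall>\<gamma>\<in>deck z. F \<circ> \<gamma> \<circ> F' \<in> deck z') \<and> (\<forall>\<gamma>\<in>deck z'. F' \<circ> \<gamma> \<circ> F \<in> deck z))"
proof
  assume "\<exists>n\<in>N. star L G n z \<in> cls z'"
  then obtain n where n: "n \<in> N" and s: "star L G n z \<in> cls z'" by blast
  obtain m where "star L G n z \<in> extensional G"
    and m: "\<And>g c. g \<in> G \<Longrightarrow> q c = z' g \<Longrightarrow> star L G n z g = q (c + lift g m - m)"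
    by (rule classE[OF cocycle_fun[OF z'] s]) iprover
  obtain B where B: "lattice_aut B" "\<And>x. lift n (B x) = x" "\<And>x. B (lift n x) = x"
    using lattice_aut_inverse[OF lift_N[OF n]] by blast
  let ?F = "\<lambda>x. lift n x + m" and ?F' = "\<lambda>x. B (x - m)"
  note lin = complex_linear_add complex_linear_diff lift_N_linear[OF n] lattice_aut_linear[OF B(1)]
  have key: "lift n d - (c + lift a m - m) \<in> L"
    if a: "a \<in> G" and d: "q d = z (conj_by n a)" and c: "q c = z' a" for a c d
    using trans[OF sym[OF star_apply[where z = z, OF n a d]] m[OF a c]] by (simp only: q_eq_iff)
  have "?F \<circ> \<gamma> \<circ> ?F' \<in> deck z'" if \<gamma>: "\<gamma> \<in> deck z" for \<gamma>
  proof -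
    obtain g d where g: "g \<in> G" "q d = z g" "\<gamma> = (\<lambda>x. lift g x + d)" using \<gamma> by (rule deckE)
    define a where "a = n \<cdot> g \<cdot> n\<^sup>-"
    have a: "a \<in> G" using n g(1) by (simp add: a_def normalizer_iff)
    have ga: "conj_by n a = g"
      using conj_by_eq_iff[OF N_Aut0[OF n] G_Aut0[OF a] G_Aut0[OF g(1)]] a_def by blast
    obtain c where c: "q c = z' a" using cocycle_rep[OF z' a] by blast
    have "q (lift n d + m - lift a m) = z' a"
      using key[OF a _ c, of d] g(2) ga c q_eq_iff[of "lift n d + m - lift a m" c] by (simp add: algebra_simps)
    then have "(\<lambda>x. lift a x + (lift n d + m - lift a m)) \<in> deck z'" using deckI[OF a, of _ z'] by blast
    moreover have "lift n (lift g x) = lift a (lift n x)" for x using lift_conj_by[OF n a] ga by simp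
    then have "?F \<circ> \<gamma> \<circ> ?F' = (\<lambda>x. lift a x + (lift n d + m - lift a m))"
      using a by (simp add: fun_eq_iff g(3) lin B(2))
    ultimately show ?thesis by simp
  qed
  moreover have "?F' \<circ> \<gamma> \<circ> ?F \<in> deck z" if \<gamma>: "\<gamma> \<in> deck z'" for \<gamma>
  proof -
    obtain a c where a: "a \<in> G" "q c = z' a" "\<gamma> = (\<lambda>x. lift a x + c)" using \<gamma> by (rule deckE)
    let ?g = "conj_by n a" and ?e = "B (c + lift a m - m)"
    obtain d where d: "q d = z ?g" using cocycle_rep[OF z conj_by_G[OF n a(1)]] by blast
    have "B (lift n d - (c + lift a m - m)) \<in> L"
      by (rule lattice_aut_mem[OF B(1) key[OF a(1) d a(2)]])
    then have "d - ?e \<in> L" by (simp add: complex_linear_diff[OF lattice_aut_linear[OF B(1)]] B(3))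
    then have "q ?e = z ?g" using d q_eq_iff[of d ?e] by simp
    then have "(\<lambda>x. lift ?g x + ?e) \<in> deck z" using deckI[OF conj_by_G[OF n a(1)], of _ z] by blast
    moreover have "B (lift a (lift n x)) = lift ?g x" for x
      using lift_conj_by[OF n a(1), of x] B(3) by metis
    then have "?F' \<circ> \<gamma> \<circ> ?F = (\<lambda>x. lift ?g x + ?e)"
      using a by (simp add: fun_eq_iff lin algebra_simps)
    ultimately show ?thesis by simp
  qed
  moreover have "?F (?F' x) = x" "?F' (?F x) = x" for x by (simp_all add: B(2,3))
  ultimately show "\<exists>A t F F'. lattice_aut A \<and> F = (\<lambda>x. A x + t) \<and> (\<forall>x. F (F' x) = x) \<and> (\<forall>x. F' (F x) = x) \<and>
      (\<forall>\<gamma>\<in>deck z. F \<circ> \<gamma> \<circ> F' \<in> deck z') \<and> (\<forall>\<gamma>\<in>deck z'. F' \<circ> \<gamma> \<circ> F \<in> deck z)"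
    using lift_N[OF n] by (intro exI[of _ "lift n"] exI[of _ m] exI[of _ ?F] exI[of _ ?F']) simp
next
  assume "\<exists>A t F F'. lattice_aut A \<and> F = (\<lambda>x. A x + t) \<and> (\<forall>x. F (F' x) = x) \<and> (\<forall>x. F' (F x) = x) \<and>
      (\<forall>\<gamma>\<in>deck z. F \<circ> \<gamma> \<circ> F' \<in> deck z') \<and> (\<forall>\<gamma>\<in>deck z'. F' \<circ> \<gamma> \<circ> F \<in> deck z)"
  then obtain A t F F' where H: "lattice_aut A \<and> F = (\<lambda>x. A x + t) \<and> (\<forall>x. F (F' x) = x) \<and> (\<forall>x. F' (F x) = x) \<and>
      (\<forall>\<gamma>\<in>deck z. F \<circ> \<gamma> \<circ> F' \<in> deck z') \<and> (\<forall>\<gamma>\<in>deck z'. F' \<circ> \<gamma> \<circ> F \<in> deck z)"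
    by (elim exE) (rule that)
  have A: "lattice_aut A" and F: "F = (\<lambda>x. A x + t)"
    and FF': "\<And>x. F (F' x) = x" "\<And>x. F' (F x) = x"
    and "\<forall>\<gamma>\<in>deck z. F \<circ> \<gamma> \<circ> F' \<in> deck z'" "\<forall>\<gamma>\<in>deck z'. F' \<circ> \<gamma> \<circ> F \<in> deck z"
    using H by iprover+
  note conj = this(5,6)[rule_format]
  note lin = lattice_aut_linear[OF A]
  define n where "n = aff A 0"
  have n0: "n \<in> carrier (torus_Aut0 L)" using A by (auto simp: n_def torus_Aut0_iff)
  have lift_n: "lift n = A" using A by (simp add: n_def)
  have intertwine: "a \<cdot> n = n \<cdot> g \<and> A d = c + lift a t - t"
    if a: "a \<in> G" and g: "g \<in> G" and eq: "\<And>x. lift a (F x) + c = F (lift g x + d)" for a g c d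
  proof -
    have e: "lift a (A x) + lift a t + c = A (lift g x) + A d + t" for x
      using eq[of x] a by (simp add: F complex_linear_add lin)
    have e0: "lift a t + c = A d + t"
      using e[of 0] a g by (simp add: complex_linear_zero lin)
    then have "lift a (A x) = A (lift g x)" for x using e[of x] by (simp add: add.assoc)
    then show ?thesis
      using e0 commute_lift_iff[OF n0 G_Aut0[OF a] G_Aut0[OF g]] by (simp add: lift_n algebra_simps)
  qed
  have pull: "\<exists>g\<in>G. \<exists>d. q d = z g \<and> a \<cdot> n = n \<cdot> g \<and> A d = c + lift a t - t"
    if a: "a \<in> G" and c: "q c = z' a" for a c
  proof -
    have "F' \<circ> (\<lambda>x. lift a x + c) \<circ> F \<in> deck z" using conj(2) deckI[OF a, of c z'] c by blast
    then obtain g d where g: "g \<in> G" "q d = z g" "F' \<circ> (\<lambda>x. lift a x + c) \<circ> F = (\<lambda>x. lift g x + d)"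
      by (rule deckE)
    have "lift a (F x) + c = F (lift g x + d)" for x
      using fun_cong[OF g(3), of x] FF'(1) by (metis comp_apply)
    then show ?thesis using intertwine[OF a g(1)] g(1,2) by blast
  qed
  have push: "\<exists>a\<in>G. a \<cdot> n = n \<cdot> g" if g: "g \<in> G" for g
  proof -
    obtain d where d: "q d = z g" using cocycle_rep[OF z g] by blast
    have "F \<circ> (\<lambda>x. lift g x + d) \<circ> F' \<in> deck z'" using conj(1) deckI[OF g, of d z] d by blast
    then obtain a c where a: "a \<in> G" "q c = z' a" "F \<circ> (\<lambda>x. lift g x + d) \<circ> F' = (\<lambda>x. lift a x + c)"
      by (rule deckE)
    have "lift a (F x) + c = F (lift g x + d)" for x
      using fun_cong[OF a(3), of "F x"] FF'(2) by simp
    then show ?thesis using intertwine[OF a(1) g] a(1) by blast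
  qed
  have nN: "n \<in> N"
    unfolding normalizer_iff
  proof (intro conjI ballI)
    fix a assume a: "a \<in> G"
    obtain c where "q c = z' a" using cocycle_rep[OF z' a] by blast
    then obtain g where g: "g \<in> G" "a \<cdot> n = n \<cdot> g" using pull[OF a] by blast
    then have "n\<^sup>- \<cdot> a \<cdot> n = g"
      using conj_by_eq_iff(1)[OF n0 G_Aut0[OF a] G_Aut0[OF g(1)]] by (simp add: conj_by_def)
    then show "n\<^sup>- \<cdot> a \<cdot> n \<in> G" using g(1) by simp
    obtain b where b: "b \<in> G" "b \<cdot> n = n \<cdot> a" using push[OF a] by blast
    then have "n \<cdot> a \<cdot> n\<^sup>- = b"
      using conj_by_eq_iff(2)[OF n0 G_Aut0[OF b(1)] G_Aut0[OF a]] by simp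
    then show "n \<cdot> a \<cdot> n\<^sup>- \<in> G" using b(1) by simp
  qed (rule n0)
  have "star L G n z a = q (c + lift a t - t)" if a: "a \<in> G" and c: "q c = z' a" for a c
  proof -
    obtain g d where g: "g \<in> G" "q d = z g" "a \<cdot> n = n \<cdot> g" "A d = c + lift a t - t"
      using pull[OF a c] by blast
    have "conj_by n a = g" using conj_by_eq_iff(1)[OF n0 G_Aut0[OF a] G_Aut0[OF g(1)]] g(3) by simp
    then show ?thesis using star_apply[OF nN a, of d z] g(2,4) lift_n by simp
  qed
  then have "star L G n z \<in> cls z'"
    unfolding class_rep_iff[OF cocycle_fun[OF z']] using star_extensional by blast
  then show "\<exists>n\<in>N. star L G n z \<in> cls z'" using nN by blast
qed

text \<open>All \<open>|G|\<close>-th powers of deck transformations are translations, and those of the lattice translations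
  span \<open>V\<close>; so a deck transformation commuting with them has trivial linear part.\<close>

lemma shifts_iff_commute:
  assumes z: "z \<in> Z1" and \<gamma>: "\<gamma> \<in> deck z"
  shows "\<gamma> \<in> shifts \<longleftrightarrow> (\<forall>\<delta>\<in>deck z. \<gamma> \<circ> (\<delta> ^^ card G) = (\<delta> ^^ card G) \<circ> \<gamma>)"
proof
  assume "\<gamma> \<in> shifts"
  then obtain l where l: "\<gamma> = (\<lambda>x. l + x)" by blast
  show "\<forall>\<delta>\<in>deck z. \<gamma> \<circ> (\<delta> ^^ card G) = (\<delta> ^^ card G) \<circ> \<gamma>"
  proof
    fix \<delta> assume "\<delta> \<in> deck z"
    then obtain m where "\<And>x. (\<delta> ^^ card G) x = x + m" using deck_power_translation[OF z] by metis
    then show "\<gamma> \<circ> (\<delta> ^^ card G) = (\<delta> ^^ card G) \<circ> \<gamma>" by (simp add: l fun_eq_iff)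
  qed
next
  assume comm: "\<forall>\<delta>\<in>deck z. \<gamma> \<circ> (\<delta> ^^ card G) = (\<delta> ^^ card G) \<circ> \<gamma>"
  obtain g c where g: "g \<in> G" "q c = z g" "\<gamma> = (\<lambda>x. lift g x + c)" using \<gamma> by (rule deckE)
  have lin: "linear (lift g)" using g(1) by (simp add: complex_linear_imp_linear)
  have "lift g l = l" if l: "l \<in> L" for l
  proof -
    have pow: "((\<lambda>x. x + l) ^^ k) x = x + real k *\<^sub>R l" for k x
      by (induction k) (simp_all add: scaleR_add_left)
    have "\<gamma> (((\<lambda>x. x + l) ^^ card G) 0) = ((\<lambda>x. x + l) ^^ card G) (\<gamma> 0)"
      using comm translation_deck[OF z l] by (metis comp_apply)
    then have "real (card G) *\<^sub>R lift g l = real (card G) *\<^sub>R l"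
      by (simp add: pow g(3) linear_0[OF lin] linear_scale[OF lin])
    then show ?thesis using card_G_pos by simp
  qed
  then have "lift g x = id x" for x
    using linear_eq_on[OF lin linear_id, of x L] is_lattice by (simp add: is_lattice_def)
  then have "g = \<e>" using lift_inj[OF g(1) G_one] by (auto simp: fun_eq_iff)
  then have "c \<in> L" "\<gamma> = (\<lambda>x. c + x)"
    using g(2,3) cocycle_one[OF z] by (simp_all add: q_eq_iff add.commute)
  then show "\<gamma> \<in> shifts" by blast
qed

lemma shifts_deck: "z \<in> Z1 \<Longrightarrow> \<gamma> \<in> shifts \<Longrightarrow> \<gamma> \<in> deck z"
  using translation_deck by (auto simp: add.commute)

text \<open>The characterization by commutation with \<open>|G|\<close>-th powers is preserved by conjugation.\<close>

lemma conjugation_preserves_shifts: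
  assumes z: "z \<in> Z1" and z': "z' \<in> Z1" and FF': "\<And>x. F (F' x) = x" "\<And>x. F' (F x) = x"
    and conj: "\<And>\<gamma>. \<gamma> \<in> deck z \<Longrightarrow> F \<circ> \<gamma> \<circ> F' \<in> deck z'" "\<And>\<gamma>. \<gamma> \<in> deck z' \<Longrightarrow> F' \<circ> \<gamma> \<circ> F \<in> deck z"
    and \<gamma>: "\<gamma> \<in> shifts"
  shows "F \<circ> \<gamma> \<circ> F' \<in> shifts"
  unfolding shifts_iff_commute[OF z' conj(1)[OF shifts_deck[OF z \<gamma>]]]
proof
  fix \<delta> assume \<delta>: "\<delta> \<in> deck z'"
  define \<delta>' where "\<delta>' = F' \<circ> \<delta> \<circ> F"
  have "(\<delta> ^^ k) x = F ((\<delta>' ^^ k) (F' x))" for k x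
    by (induction k) (simp_all add: FF' \<delta>'_def)
  moreover have "\<gamma> ((\<delta>' ^^ card G) x) = (\<delta>' ^^ card G) (\<gamma> x)" for x
    using \<gamma> shifts_iff_commute[OF z shifts_deck[OF z \<gamma>]] conj(2)[OF \<delta>] unfolding \<delta>'_def by (metis comp_apply)
  ultimately show "(F \<circ> \<gamma> \<circ> F') \<circ> (\<delta> ^^ card G) = (\<delta> ^^ card G) \<circ> (F \<circ> \<gamma> \<circ> F')"
    by (simp add: fun_eq_iff FF')
qed

end


section \<open>Invariant inner products\<close>

text \<open>A maximal orthonormal set is a basis: a vector outside its span could be projected and normalized to
  enlarge it.\<close>

lemma orthonormal_coordinates:
  fixes \<beta> :: "'a::euclidean_space \<Rightarrow> 'a \<Rightarrow> real"
  assumes lin: "\<And>y. linear (\<lambda>x. \<beta> x y)" and sym: "\<And>x y. \<beta> x y = \<beta> y x"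
    and pos: "\<And>x. x \<noteq> 0 \<Longrightarrow> \<beta> x x > 0"
    and dim: "DIM('a) = DIM('e::euclidean_space)"
  obtains B :: "'a \<Rightarrow> 'e::euclidean_space" where "linear B" "bij B" "\<And>x y. B x \<bullet> B y = \<beta> x y"
proof -
  note \<beta>_simps = linear_add[OF lin] linear_scale[OF lin] linear_sum[OF lin] linear_0[OF lin] linear_diff[OF lin]
  define orthonormal where "orthonormal S \<longleftrightarrow>
    finite S \<and> (\<forall>s\<in>S. \<forall>t\<in>S. \<beta> s t = (if s = t then 1 else 0))" for S
  have coeff: "\<beta> (\<Sum>s\<in>S. u s *\<^sub>R s) t = u t" if S: "orthonormal S" "t \<in> S" for S u t
  proof -
    have "\<beta> (\<Sum>s\<in>S. u s *\<^sub>R s) t = (\<Sum>s\<in>S. u s * \<beta> s t)" by (simp add: \<beta>_simps)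
    also have "\<dots> = (\<Sum>s\<in>S. if s = t then u t else 0)"
      by (rule sum.cong[OF refl]) (use S in \<open>simp add: orthonormal_def\<close>)
    finally show ?thesis using S by (simp add: orthonormal_def)
  qed
  have indep: "independent S" if S: "orthonormal S" for S
  proof -
    have fin: "finite S" using S by (simp add: orthonormal_def)
    have "u v = 0" if "(\<Sum>v\<in>S. u v *\<^sub>R v) = 0" "v \<in> S" for u v
      using coeff[OF S that(2), of u] that(1) \<beta>_simps(4) by simp
    then show ?thesis using independent_if_scalars_zero[OF fin, of] by blast
  qed
  have bound: "card S \<le> DIM('a)" if "orthonormal S" for S
    using independent_card_le[OF indep[OF that]] .
  have "orthonormal {}" by (simp add: orthonormal_def)
  then obtain S where S: "orthonormal S" "\<And>T. orthonormal T \<Longrightarrow> card T \<le> card S"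
    using ex_has_greatest_nat[of orthonormal "{}" card "Suc (DIM('a))"] bound by (auto simp: less_Suc_eq_le)
  have fin: "finite S" using S(1) by (simp add: orthonormal_def)
  have expand: "x = (\<Sum>s\<in>S. \<beta> x s *\<^sub>R s)" for x
  proof (rule ccontr)
    assume "x \<noteq> (\<Sum>s\<in>S. \<beta> x s *\<^sub>R s)"
    define y where "y = x - (\<Sum>s\<in>S. \<beta> x s *\<^sub>R s)"
    define u where "u = (1 / sqrt (\<beta> y y)) *\<^sub>R y"
    have "y \<noteq> 0" using \<open>x \<noteq> _\<close> by (simp add: y_def)
    then have py: "\<beta> y y > 0" by (rule pos)
    have ys: "\<beta> y s = 0" if "s \<in> S" for s
      using coeff[OF S(1) that] by (simp add: y_def \<beta>_simps)
    have us: "\<beta> u s = 0" "\<beta> s u = 0" if "s \<in> S" for s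
      using ys[OF that] sym[of s u] by (simp_all add: u_def \<beta>_simps)
    have "\<beta> u u = (1 / sqrt (\<beta> y y)) * ((1 / sqrt (\<beta> y y)) * \<beta> y y)"
      using sym[of y u] by (simp add: u_def \<beta>_simps)
    then have uu: "\<beta> u u = 1" using py by (simp add: divide_simps flip: power2_eq_square)
    have "u \<notin> S" using us(1) uu by fastforce
    moreover have "orthonormal (insert u S)"
      using S(1) us uu \<open>u \<notin> S\<close> by (auto simp: orthonormal_def)
    ultimately show False using S(2)[of "insert u S"] fin by simp
  qed
  have "span S = UNIV"
  proof -
    have "x \<in> span S" for x
      using expand[of x] span_sum[of S "\<lambda>s. \<beta> x s *\<^sub>R s" S] span_scale span_base by metis
    then show ?thesis by blast
  qed
  then have "card S = DIM('e)"
    using indep[OF S(1)] dim by (metis dim_UNIV dim_eq_card_independent dim_span)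
  then obtain h where h: "bij_betw h S (Basis :: 'e set)"
    using fin finite_same_card_bij finite_Basis by blast
  have h_inner: "h s \<bullet> h t = (if s = t then 1 else 0)" if "s \<in> S" "t \<in> S" for s t
  proof -
    have "h s \<in> Basis" "h t \<in> Basis" "h s = h t \<longleftrightarrow> s = t"
      using h that by (auto simp: bij_betw_def inj_on_eq_iff)
    then show ?thesis using inner_Basis[of "h s" "h t"] by simp
  qed
  define B where "B x = (\<Sum>s\<in>S. \<beta> x s *\<^sub>R h s)" for x
  have lB: "linear B"
    by (rule linearI) (simp_all add: B_def \<beta>_simps scaleR_add_left sum.distrib scaleR_sum_right)
  have Bh: "B x \<bullet> h t = \<beta> x t" if t: "t \<in> S" for x t
  proof -
    have "B x \<bullet> h t = (\<Sum>s\<in>S. \<beta> x s * (h s \<bullet> h t))" by (simp add: B_def inner_sum_left)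
    also have "\<dots> = (\<Sum>s\<in>S. if s = t then \<beta> x t else 0)"
      by (rule sum.cong[OF refl]) (use t in \<open>simp add: h_inner\<close>)
    finally show ?thesis using fin t by simp
  qed
  have inner: "B x \<bullet> B y = \<beta> x y" for x y
  proof -
    have "B x \<bullet> B y = (\<Sum>s\<in>S. \<beta> y s * \<beta> x s)"
      by (simp add: B_def[of y] inner_sum_right Bh)
    also have "\<dots> = (\<Sum>s\<in>S. \<beta> (\<beta> y s *\<^sub>R s) x)"
      by (simp add: \<beta>_simps sym[of x])
    also have "\<dots> = \<beta> (\<Sum>s\<in>S. \<beta> y s *\<^sub>R s) x" by (simp add: \<beta>_simps)
    also have "\<dots> = \<beta> x y" using expand[of y] sym[of x y] by simp
    finally show ?thesis .
  qed
  have "inj B"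
  proof (rule injI)
    fix x y assume "B x = B y"
    then have "\<beta> (x - y) (x - y) = 0"
      using inner[of "x - y" "x - y"] by (simp add: linear_diff[OF lB])
    then show "x = y" using pos[of "x - y"] by fastforce
  qed
  moreover have "v \<in> range B" for v
  proof -
    have "B (\<Sum>s\<in>S. (v \<bullet> h s) *\<^sub>R s) = (\<Sum>s\<in>S. (v \<bullet> h s) *\<^sub>R h s)"
      unfolding B_def using coeff[OF S(1)] by (auto intro!: sum.cong)
    also have "\<dots> = (\<Sum>b\<in>Basis. (v \<bullet> b) *\<^sub>R b)"
      by (rule sum.reindex_bij_betw[OF h])
    finally show ?thesis by (metis euclidean_representation rangeI)
  qed
  ultimately have "bij B" by (auto simp: bij_def)
  then show ?thesis using that lB inner by blast
qed

text \<open>Average the inner product over \<open>\<A>\<close>; composing with a fixed element of \<open>\<A>\<close> permutes the summands.\<close>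

lemma invariant_coordinates:
  fixes \<A> :: "('a::euclidean_space \<Rightarrow> 'a) set"
  assumes fin: "finite \<A>" "\<A> \<noteq> {}" and A: "\<And>A. A \<in> \<A> \<Longrightarrow> linear A" "\<And>A. A \<in> \<A> \<Longrightarrow> bij A"
    and comp: "\<And>A C. A \<in> \<A> \<Longrightarrow> C \<in> \<A> \<Longrightarrow> C \<circ> A \<in> \<A>"
    and dim: "DIM('a) = DIM('e::euclidean_space)"
  obtains B :: "'a \<Rightarrow> 'e::euclidean_space" where "linear B" "bij B" "\<And>A x. A \<in> \<A> \<Longrightarrow> norm (B (A x)) = norm (B x)"
proof -
  define \<beta> where "\<beta> x y = (\<Sum>A\<in>\<A>. A x \<bullet> A y)" for x y
  have lin: "linear (\<lambda>x. \<beta> x y)" for y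
    by (rule linearI)
       (simp_all add: \<beta>_def linear_add[OF A(1)] linear_scale[OF A(1)] inner_add_left sum.distrib sum_distrib_left)
  have sym: "\<beta> x y = \<beta> y x" for x y by (simp add: \<beta>_def inner_commute)
  have pos: "\<beta> x x > 0" if "x \<noteq> 0" for x
  proof -
    have "A x \<bullet> A x > 0" if "A \<in> \<A>" for A
      using A[OF that] \<open>x \<noteq> 0\<close> linear_0[OF A(1)[OF that]] by (metis bij_is_inj injD inner_gt_zero_iff)
    then show ?thesis unfolding \<beta>_def by (rule sum_pos[OF fin])
  qed
  have inv: "\<beta> (A x) (A x) = \<beta> x x" if a: "A \<in> \<A>" for A x
  proof -
    have "inj_on (\<lambda>C. C \<circ> A) \<A>"
      using bij_is_surj[OF A(2)[OF a]] by (auto intro!: inj_onI simp: fun_eq_iff) (metis surjD)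
    moreover have "(\<lambda>C. C \<circ> A) ` \<A> \<subseteq> \<A>" using comp[OF a] by auto
    ultimately have "bij_betw (\<lambda>C. C \<circ> A) \<A> \<A>"
      using endo_inj_surj[OF fin(1)] by (simp add: bij_betw_def)
    from sum.reindex_bij_betw[OF this, of "\<lambda>C. C x \<bullet> C x"] show ?thesis by (simp add: \<beta>_def)
  qed
  obtain B :: "'a \<Rightarrow> 'e" where B: "linear B" "bij B" "\<And>x y. B x \<bullet> B y = \<beta> x y"
    using orthonormal_coordinates[OF lin sym pos dim] by blast
  have "norm (B (A x)) = norm (B x)" if "A \<in> \<A>" for A x
    using inv[OF that] by (simp add: norm_eq_sqrt_inner B(3))
  then show ?thesis using that B by blast
qed

context torus_group
begin

lemma invariant_coordinates_exist:
  obtains B :: "complex ^ 'n \<Rightarrow> real ^ ('n + 'n)"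
  where "linear B" "bij B" "\<And>g x. g \<in> G \<Longrightarrow> norm (B (lift g x)) = norm (B x)"
proof (rule invariant_coordinates[of "lift ` G"])
  show "finite (lift ` G)" "lift ` G \<noteq> {}" using finite_G G_one by auto
  show "linear A" "bij A" if A: "A \<in> lift ` G" for A
  proof -
    obtain g where "g \<in> G" "A = lift g" using A by blast
    then show "linear A" "bij A"
      using lift_G[of g] by (simp_all add: complex_linear_imp_linear lattice_aut_def)
  qed
  show "C \<circ> A \<in> lift ` G" if AC: "A \<in> lift ` G" "C \<in> lift ` G" for A C
  proof -
    obtain g h where "g \<in> G" "A = lift g" "h \<in> G" "C = lift h" using AC by blast
    then show ?thesis using G_mult by (intro image_eqI[of _ _ "h \<cdot> g"]) (auto simp: fun_eq_iff)
  qed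
  show "DIM(complex ^ 'n) = DIM(real ^ ('n + 'n))" by (simp add: card_UNIV_sum)
qed (use that in blast)

end


section \<open>Flat Kaehler structures\<close>

lemma motion_mult: "motion (a \<otimes>\<^bsub>motion_group\<^esub> b) = motion a \<circ> motion b"
  by (cases a; cases b) (simp add: motion_def motion_group_def fun_eq_iff matrix_vector_mul_assoc
      matrix_vector_right_distrib add.assoc)

lemma motion_one: "motion \<one>\<^bsub>motion_group\<^esub> = id"
  by (simp add: motion_def motion_group_def fun_eq_iff)

lemma motion_inj: "motion a = motion b \<Longrightarrow> a = b"
proof -
  assume eq: "motion a = motion b"
  obtain A x B y where ab: "a = (A, x)" "b = (B, y)" by (cases a, cases b)
  have e: "A *v v + x = B *v v + y" for v using fun_cong[OF eq, of v] by (simp add: ab motion_def)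
  have "x = y" using e[of 0] by simp
  then have "A = B" using e by (simp add: matrix_eq)
  then show "a = b" using \<open>x = y\<close> ab by simp
qed

lemma group_motion_group: "group (motion_group :: 'm::finite motion monoid)"
proof (rule groupI)
  fix a :: "'m motion" assume "a \<in> carrier motion_group"
  then obtain A x where a: "a = (A, x)" "orthogonal_matrix A" by (auto simp: motion_group_def)
  let ?b = "(transpose A, - (transpose A *v x))"
  have "?b \<in> carrier motion_group" using a(2) by (simp add: motion_group_def orthogonal_matrix_transpose)
  moreover have "?b \<otimes>\<^bsub>motion_group\<^esub> a = \<one>\<^bsub>motion_group\<^esub>"
    using a by (simp add: motion_group_def orthogonal_matrix_def)
  ultimately show "\<exists>b\<in>carrier motion_group. b \<otimes>\<^bsub>motion_group\<^esub> a = \<one>\<^bsub>motion_group\<^esub>" by blast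
next
  fix a b :: "'m motion" assume "a \<in> carrier motion_group" "b \<in> carrier motion_group"
  then show "a \<otimes>\<^bsub>motion_group\<^esub> b \<in> carrier motion_group"
    by (auto simp: motion_group_def orthogonal_matrix_mul)
next
  show "\<one>\<^bsub>motion_group\<^esub> \<in> carrier (motion_group :: 'm motion monoid)"
    by (simp add: motion_group_def orthogonal_matrix_id)
qed (auto intro!: motion_inj simp: motion_mult motion_one comp_assoc)

lemma complex_linearI:
  assumes "linear h" "\<And>x. h (\<i> *s x) = \<i> *s h x"
  shows "complex_linear h"
  unfolding complex_linear_iff
proof (intro conjI allI)
  show "h (x + y) = h x + h y" for x y by (rule linear_add[OF assms(1)])
  fix c x
  have c: "c *s v = Re c *\<^sub>R v + Im c *\<^sub>R (\<i> *s v)" for v :: "complex ^ 'k"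
    unfolding vec_eq_iff vector_scaleR_component vector_smult_component vector_add_component
    by (simp add: complex_eq_iff)
  show "h (c *s x) = c *s h x"
    unfolding c[of x] c[of "h x"] by (simp add: linear_add[OF assms(1)] linear_scale[OF assms(1)] assms(2))
qed

lemma biholomorphic_if_conjugate:
  assumes u: "uniformized M p \<Gamma>" and u': "uniformized M' p' \<Gamma>'"
    and e: "entire F" "entire G" and FG: "\<And>x. F (G x) = x" "\<And>x. G (F x) = x"
    and conj: "\<And>\<gamma>. \<gamma> \<in> \<Gamma> \<Longrightarrow> F \<circ> \<gamma> \<circ> G \<in> \<Gamma>'" "\<And>\<gamma>. \<gamma> \<in> \<Gamma>' \<Longrightarrow> G \<circ> \<gamma> \<circ> F \<in> \<Gamma>"
  shows "biholomorphic M M'"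
proof -
  define f where "f = (\<lambda>m. p' (F (inv_into UNIV p m)))"
  have "p' (F x) = f (p x)" for x
  proof -
    have "p x = p (inv_into UNIV p (p x))" by (simp add: f_inv_into_f)
    then obtain \<gamma> where \<gamma>: "\<gamma> \<in> \<Gamma>" "inv_into UNIV p (p x) = \<gamma> x" using uniformized_eq_iff[OF u] by blast
    then have "F (inv_into UNIV p (p x)) = (F \<circ> \<gamma> \<circ> G) (F x)" by (simp add: FG)
    then show ?thesis unfolding f_def using uniformized_eq_iff[OF u', of "F x"] conj(1)[OF \<gamma>(1)] by blast
  qed
  then have "biholomorphic_map M M' f"
    using biholomorphic_map_descends[OF u u' e FG _ conj(2)] by blast
  then show ?thesis by (auto simp: biholomorphic_def)
qed

text \<open>The charts are all \<open>J\<close>-linear coordinates; they differ from the inverse of the uniformizing map by complex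
  linear automorphisms.\<close>

lemma uniformized_real_space:
  fixes J :: "real ^ ('n::finite + 'n) ^ ('n + 'n)" and B' :: "complex ^ 'n \<Rightarrow> real ^ ('n + 'n)"
  assumes B': "linear B'" "\<And>x. C' (B' x) = x" "\<And>y. B' (C' y) = y" and J: "\<And>x. J *v B' x = B' (\<i> *s x)"
  shows "uniformized (real_space_with J) B' {id}"
proof -
  have linC: "linear C'"
  proof (rule linearI)
    show "C' (x + y) = C' x + C' y" for x y
      using linear_add[OF B'(1), of "C' x" "C' y"] B'(2)[of "C' x + C' y"] B'(3) by simp
    show "C' (r *\<^sub>R x) = r *\<^sub>R C' x" for r x
      using linear_scale[OF B'(1), of r "C' x"] B'(2)[of "r *\<^sub>R C' x"] B'(3) by simp
  qed
  have cont: "continuous_on UNIV B'" "continuous_on UNIV C'"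
    using B'(1) linC by (simp_all add: linear_continuous_on linear_conv_bounded_linear)
  have rng: "range B' = UNIV" using B'(3) by (metis surjI)
  have bijC: "bij C'" using B'(2,3) by (intro o_bij[of B']) (auto simp: fun_eq_iff)
  have top: "open U \<longleftrightarrow> open (B' -` U)" for U
  proof
    assume "open (B' -` U)"
    then have "open (C' -` (B' -` U))" using open_vimage cont(2) by blast
    moreover have "C' -` (B' -` U) = U" using B'(3) by auto
    ultimately show "open U" by simp
  qed (use open_vimage cont(1) in blast)
  have charts: "\<exists>\<tau> \<sigma>. entire \<tau> \<and> entire \<sigma> \<and> (\<forall>x. \<sigma> (\<tau> x) = x) \<and> (\<forall>x. \<tau> (\<sigma> x) = x) \<and>
      (\<forall>w\<in>UNIV. B' (\<tau> (h w)) = w)" if h: "linear h" "bij h" "\<forall>v. h (J *v v) = \<i> *s h v" for h :: "real ^ ('n + 'n) \<Rightarrow> complex ^ 'n"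
  proof -
    define \<sigma> where "\<sigma> = h \<circ> B'"
    define \<tau> where "\<tau> = C' \<circ> inv_into UNIV h"
    have hi: "inv_into UNIV h (h x) = x" "h (inv_into UNIV h y) = y" for x y
      using h(2) by (simp_all add: bij_is_inj bij_is_surj surj_f_inv_f)
    have st: "\<sigma> (\<tau> x) = x" "\<tau> (\<sigma> x) = x" for x by (simp_all add: \<sigma>_def \<tau>_def B' hi)
    have "complex_linear \<sigma>"
    proof (rule complex_linearI)
      show "linear \<sigma>" unfolding \<sigma>_def by (rule linear_compose[OF B'(1) h(1)])
      show "\<sigma> (\<i> *s x) = \<i> *s \<sigma> x" for x using h(3) J by (simp add: \<sigma>_def flip: J)
    qed
    moreover from this have "complex_linear \<tau>" by (rule complex_linear_inverse) (rule st)+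
    moreover have "B' (\<tau> (h w)) = w" for w by (simp add: \<tau>_def B' hi)
    ultimately show ?thesis
      using entire_affine[of \<sigma> 0] entire_affine[of \<tau> 0] st by (intro exI[of _ \<tau>] exI[of _ \<sigma>]) simp
  qed
  have CJ: "C' (J *v v) = \<i> *s C' v" for v
    using J[of "C' v"] B'(2)[of "\<i> *s C' v"] B'(3) by simp
  have at: "atlas (real_space_with J) = {(UNIV, h) | h. linear h \<and> bij h \<and> (\<forall>v. h (J *v v) = \<i> *s h v)}"
    by (simp add: real_space_with_def)
  show ?thesis
    unfolding uniformized_def
  proof (intro conjI)
    show "\<forall>U. openin (mtop (real_space_with J)) U \<longleftrightarrow> U \<subseteq> range B' \<and> open (B' -` U)"
      using top by (simp add: real_space_with_def rng)
    show "\<forall>(W, \<psi>)\<in>atlas (real_space_with J). open (\<psi> ` W) \<and> (\<exists>\<tau> \<sigma>. entire \<tau> \<and> entire \<sigma> \<and> (\<forall>x. \<sigma> (\<tau> x) = x) \<and>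
        (\<forall>x. \<tau> (\<sigma> x) = x) \<and> (\<forall>w\<in>W. B' (\<tau> (\<psi> w)) = w))"
    proof
      fix c assume "c \<in> atlas (real_space_with J)"
      then obtain h where h: "c = (UNIV, h)" "linear h" "bij h" "\<forall>v. h (J *v v) = \<i> *s h v"
        unfolding at by blast
      have "open (range h)" using bij_is_surj[OF h(3)] by simp
      then show "case c of (W, \<psi>) \<Rightarrow> open (\<psi> ` W) \<and> (\<exists>\<tau> \<sigma>. entire \<tau> \<and> entire \<sigma> \<and> (\<forall>x. \<sigma> (\<tau> x) = x) \<and>
        (\<forall>x. \<tau> (\<sigma> x) = x) \<and> (\<forall>w\<in>W. B' (\<tau> (\<psi> w)) = w))"
        unfolding h(1) prod.case using charts[OF h(2-4)] by (rule conjI)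
    qed
    show "\<forall>x. \<exists>(W, \<psi>)\<in>atlas (real_space_with J). x \<in> \<psi> ` W \<and> (\<forall>w\<in>W. B' (\<psi> w) = w)"
    proof
      fix x
      have "(UNIV, C') \<in> atlas (real_space_with J)" unfolding at using linC bijC CJ by blast
      moreover have "x \<in> range C'" using B'(2) by (metis rangeI)
      ultimately show "\<exists>(W, \<psi>)\<in>atlas (real_space_with J). x \<in> \<psi> ` W \<and> (\<forall>w\<in>W. B' (\<psi> w) = w)"
        using B'(3) by (intro bexI[of _ "(UNIV, C')"]) simp_all
    qed
    show "\<forall>\<gamma>\<in>{id}. entire \<gamma>" by (simp add: entire_id)
    show "\<forall>x y. (B' x = B' y) = (\<exists>\<gamma>\<in>{id}. y = \<gamma> x)"
      using B'(2) by (metis id_apply singletonD singletonI)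
  qed
qed

lemma matrix_apply:
  fixes f :: "real ^ 'm \<Rightarrow> real ^ 'k"
  shows "linear f \<Longrightarrow> matrix f *v x = f x"
  using fun_cong[OF matrix_vector_mul(2)] .

lemma minus_matrix_apply: "(- A) *v x = - (A *v (x :: real ^ 'm))"
  by (simp add: matrix_vector_mult_def vec_eq_iff sum_negf)

lemma matrix_apply_minus: "A *v (- x) = - (A *v (x :: real ^ 'm))"
  by (simp add: matrix_vector_mult_def vec_eq_iff sum_negf)

context torus_group
begin

context
  fixes z :: "'n torus_map \<Rightarrow> (complex ^ 'n) set" and B :: "complex ^ 'n \<Rightarrow> real ^ ('n + 'n)"
  assumes z: "z \<in> Z1" and free: "\<forall>\<gamma>\<in>deck z. \<forall>x. \<gamma> x = x \<longrightarrow> \<gamma> = id"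
    and B: "linear B" "bij B" "\<And>g x. g \<in> G \<Longrightarrow> norm (B (lift g x)) = norm (B x)"
begin

interpretation D: deck_group "deck z" B
  by (rule deck_group_deck[OF z free B])

text \<open>The rigid motion \<open>B \<circ> \<gamma> \<circ> B\<inverse>\<close>, split into linear part and value at \<open>0\<close>.\<close>

definition motion_of :: "(complex ^ 'n \<Rightarrow> complex ^ 'n) \<Rightarrow> ('n + 'n) motion" where
  "motion_of \<gamma> = (matrix (\<lambda>v. B (\<gamma> (D.C v)) - B (\<gamma> 0)), B (\<gamma> 0))"

lemma motion_of_linear:
  assumes g: "g \<in> G"
  shows "motion_of (\<lambda>x. lift g x + c) = (matrix (\<lambda>v. B (lift g (D.C v))), B c)"
    and "linear (\<lambda>v. B (lift g (D.C v)))"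
proof -
  show "motion_of (\<lambda>x. lift g x + c) = (matrix (\<lambda>v. B (lift g (D.C v))), B c)"
    using g by (simp add: motion_of_def complex_linear_zero linear_add[OF B(1)])
  show "linear (\<lambda>v. B (lift g (D.C v)))"
    using linear_compose[OF linear_compose[OF D.linear_C complex_linear_imp_linear[OF lift_G_linear[OF g]]] B(1)]
    by (simp add: comp_def)
qed

lemma motion_motion_of:
  assumes "\<gamma> \<in> deck z"
  shows "motion (motion_of \<gamma>) = B \<circ> \<gamma> \<circ> D.C"
proof -
  obtain g c where g: "g \<in> G" "\<gamma> = (\<lambda>x. lift g x + c)" using assms by (rule deckE)
  show ?thesis
    unfolding g(2) motion_of_linear(1)[OF g(1)]
    by (simp add: motion_def fun_eq_iff matrix_apply[OF motion_of_linear(2)[OF g(1)]] linear_add[OF B(1)])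
qed

lemma motion_of_carrier:
  assumes "\<gamma> \<in> deck z"
  shows "motion_of \<gamma> \<in> carrier motion_group"
proof -
  obtain g c where g: "g \<in> G" "\<gamma> = (\<lambda>x. lift g x + c)" using assms by (rule deckE)
  let ?f = "\<lambda>v. B (lift g (D.C v))"
  have "orthogonal_transformation ?f"
    unfolding orthogonal_transformation
    using motion_of_linear(2)[OF g(1)] B(3)[OF g(1)] by simp
  then have "orthogonal_matrix (matrix ?f)" by (simp add: orthogonal_transformation_matrix)
  then show ?thesis unfolding g(2) motion_of_linear(1)[OF g(1)] by (simp add: motion_group_def)
qed

lemma motion_of_mult:
  assumes "\<gamma> \<in> deck z" "\<eta> \<in> deck z"
  shows "motion_of \<gamma> \<otimes>\<^bsub>motion_group\<^esub> motion_of \<eta> = motion_of (\<gamma> \<circ> \<eta>)"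
  by (rule motion_inj)
     (simp add: motion_mult motion_motion_of assms deck_comp[OF z assms] fun_eq_iff)

lemma motion_of_id: "motion_of id = \<one>\<^bsub>motion_group\<^esub>"
  by (rule motion_inj) (simp add: motion_one motion_motion_of[OF id_deck[OF z]] fun_eq_iff)

lemma motion_of_inj:
  assumes "\<gamma> \<in> deck z" "\<eta> \<in> deck z" "motion_of \<gamma> = motion_of \<eta>"
  shows "\<gamma> = \<eta>"
proof
  fix x
  have "(B \<circ> \<gamma> \<circ> D.C) (B x) = (B \<circ> \<eta> \<circ> D.C) (B x)"
    using assms motion_motion_of by metis
  then show "\<gamma> x = \<eta> x" by simp
qed

lemma motion_image: "motion ` motion_of ` deck z = D.\<Delta>"
  unfolding D.\<Delta>_def image_image by (rule image_cong[OF refl]) (rule motion_motion_of)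

lemma subgroup_motion_of: "subgroup (motion_of ` deck z) motion_group"
proof (rule group.subgroupI[OF group_motion_group])
  show "motion_of ` deck z \<subseteq> carrier motion_group" using motion_of_carrier by blast
  show "motion_of ` deck z \<noteq> {}" using id_deck[OF z] by blast
  fix a assume "a \<in> motion_of ` deck z"
  then obtain \<gamma> where \<gamma>: "\<gamma> \<in> deck z" "a = motion_of \<gamma>" by blast
  obtain \<delta> where \<delta>: "\<delta> \<in> deck z" "\<delta> \<circ> \<gamma> = id" using deck_left_inverse[OF z \<gamma>(1)] by blast
  have "motion_of \<delta> \<otimes>\<^bsub>motion_group\<^esub> a = \<one>\<^bsub>motion_group\<^esub>"
    using motion_of_mult[OF \<delta>(1) \<gamma>(1)] \<delta>(2) \<gamma>(2) motion_of_id by simp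
  then have "inv\<^bsub>motion_group\<^esub> a = motion_of \<delta>"
    using motion_of_carrier \<gamma> \<delta>(1) by (intro group.inv_equality[OF group_motion_group]) auto
  then show "inv\<^bsub>motion_group\<^esub> a \<in> motion_of ` deck z" using \<delta>(1) by blast
  fix b assume "b \<in> motion_of ` deck z"
  then obtain \<eta> where "\<eta> \<in> deck z" "b = motion_of \<eta>" by blast
  then show "a \<otimes>\<^bsub>motion_group\<^esub> b \<in> motion_of ` deck z"
    using motion_of_mult[OF \<gamma>(1)] deck_comp[OF z \<gamma>(1)] \<gamma>(2) by auto
qed

text \<open>A motion is already isolated by its translation part, because deck transformations move the origin by
  a minimal distance.\<close>

lemma discrete_motion_of: "discrete (motion_of ` deck z)"
proof (rule discreteI)
  fix a assume "a \<in> motion_of ` deck z"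
  then obtain \<gamma> where \<gamma>: "\<gamma> \<in> deck z" "a = motion_of \<gamma>" by blast
  obtain r where r: "r > 0" "\<And>\<delta>. \<delta> \<in> deck z \<Longrightarrow> \<delta> \<noteq> id \<Longrightarrow> r \<le> dist (B 0) (B (\<delta> 0))"
    using D.displacement[of 0] by blast
  obtain \<gamma>' where \<gamma>': "\<gamma>' \<in> deck z" "\<And>x. \<gamma>' (\<gamma> x) = x" "\<And>x. \<gamma> (\<gamma>' x) = x"
    using D.two_sided_inverse[OF \<gamma>(1)] by blast
  let ?T = "UNIV \<times> ball (B (\<gamma> 0)) r :: ('n + 'n) motion set"
  have "b = a" if b: "b \<in> ?T" "b \<in> motion_of ` deck z" for b
  proof -
    obtain \<delta> where \<delta>: "\<delta> \<in> deck z" "b = motion_of \<delta>" using b(2) by blast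
    have "dist (B (\<gamma> 0)) (B (\<delta> 0)) < r" using b(1) \<delta>(2) by (simp add: motion_of_def)
    moreover have "dist (B (\<gamma> 0)) (B (\<delta> 0)) = dist (B 0) (B ((\<gamma>' \<circ> \<delta>) 0))"
      using D.isometric[OF \<gamma>'(1), of "\<gamma> 0" "\<delta> 0"] \<gamma>'(2) by simp
    ultimately have "\<gamma>' \<circ> \<delta> = id" using r(2)[OF deck_comp[OF z \<gamma>'(1) \<delta>(1)]] by force
    then have "\<delta> x = \<gamma> x" for x using \<gamma>'(3)[of "\<delta> x"] by (simp add: fun_eq_iff)
    then have "\<delta> = \<gamma>" by (rule ext)
    then show ?thesis using \<gamma>(2) \<delta>(2) by simp
  qed
  moreover have "a \<in> ?T" using r(1) \<gamma>(2) by (simp add: motion_of_def)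
  ultimately have "?T \<inter> motion_of ` deck z = {a}" using \<open>a \<in> motion_of ` deck z\<close> by blast
  moreover have "open ?T" by (simp add: open_Times)
  ultimately show "a isolated_in motion_of ` deck z"
    unfolding isolated_in_def using \<open>a \<in> motion_of ` deck z\<close> by blast
qed

lemma torsion_free_motion_of: "torsion_free (motion_group\<lparr>carrier := motion_of ` deck z\<rparr>)"
  unfolding torsion_free_def
proof (intro ballI allI impI)
  let ?M = "motion_group\<lparr>carrier := motion_of ` deck z\<rparr>"
  fix a and k :: nat assume "a \<in> carrier ?M" and k: "0 < k \<and> a [^]\<^bsub>?M\<^esub> k = \<one>\<^bsub>?M\<^esub>"
  then obtain \<gamma> where \<gamma>: "\<gamma> \<in> deck z" "a = motion_of \<gamma>" by auto
  have "a [^]\<^bsub>?M\<^esub> i = motion_of (\<gamma> ^^ i)" for i :: nat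
  proof (induction i)
    case (Suc i)
    have "a [^]\<^bsub>?M\<^esub> Suc i = motion_of (\<gamma> ^^ i) \<otimes>\<^bsub>motion_group\<^esub> motion_of \<gamma>"
      using Suc \<gamma>(2) by simp
    also have "\<dots> = motion_of (\<gamma> ^^ i \<circ> \<gamma>)"
      by (rule motion_of_mult[OF deck_funpow[OF z \<gamma>(1)] \<gamma>(1)])
    also have "\<gamma> ^^ i \<circ> \<gamma> = \<gamma> ^^ Suc i" by (rule funpow_Suc_right[symmetric])
    finally show ?case .
  next
    case 0
    show ?case unfolding funpow.simps(1) motion_of_id by simp
  qed
  then have "motion_of (\<gamma> ^^ k) = motion_of id" using k by (simp add: motion_of_id)
  then have "\<gamma> ^^ k = id" by (rule motion_of_inj[OF deck_funpow[OF z \<gamma>(1)] id_deck[OF z]])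
  then have "\<gamma> = id" using deck_torsion_free_iff[OF z] free \<gamma>(1) k by blast
  then show "a = \<one>\<^bsub>?M\<^esub>" using \<gamma>(2) by (simp add: motion_of_id)
qed

definition J :: "real ^ ('n + 'n) ^ ('n + 'n)" where
  "J = matrix (\<lambda>v. B (\<i> *s D.C v))"

lemma J_apply: "J *v v = B (\<i> *s D.C v)"
proof -
  have "linear (\<lambda>x :: complex ^ 'n. \<i> *s x)"
    by (rule complex_linear_imp_linear)
       (simp add: complex_linear_iff vec.scale_right_distrib vec.scale_left_commute)
  then have "linear (\<lambda>v. B (\<i> *s D.C v))"
    using linear_compose[OF linear_compose[OF D.linear_C] B(1)] by (simp add: comp_def)
  then show ?thesis unfolding J_def by (rule matrix_apply)
qed

lemma J_square: "J ** J = - mat 1"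
proof -
  have "J *v (J *v v) = - v" for v
  proof -
    have "\<i> *s (\<i> *s D.C v) = - D.C v" by (simp add: vec_eq_iff)
    then have "J *v (J *v v) = B (- D.C v)" by (simp add: J_apply)
    then show ?thesis by (simp add: linear_neg[OF B(1)])
  qed
  then show ?thesis
    by (simp add: matrix_eq matrix_vector_mul_assoc[symmetric] minus_matrix_apply)
qed

lemma J_commutes:
  assumes "(A, a) \<in> motion_of ` deck z"
  shows "A ** J = J ** A"
proof -
  obtain \<gamma> where \<gamma>: "\<gamma> \<in> deck z" "(A, a) = motion_of \<gamma>" using assms by blast
  obtain g c where g: "g \<in> G" "\<gamma> = (\<lambda>x. lift g x + c)" using \<gamma>(1) by (rule deckE)
  have "A = matrix (\<lambda>v. B (lift g (D.C v)))"
    using \<gamma>(2) unfolding g(2) motion_of_linear(1)[OF g(1)] by simp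
  then have A: "A *v v = B (lift g (D.C v))" for v
    using matrix_apply[OF motion_of_linear(2)[OF g(1)]] by simp
  have "lift g (\<i> *s x) = \<i> *s lift g x" for x
    using lift_G_linear[OF g(1)] by (simp add: complex_linear_iff)
  then show ?thesis
    by (simp add: matrix_eq matrix_vector_mul_assoc[symmetric] A J_apply)
qed

lemma uniformized_flat_model:
  "uniformized (flat_kaehler_model (motion_of ` deck z) J) (orbit_of (motion ` motion_of ` deck z) \<circ> B) (deck z)"
  unfolding flat_kaehler_model_def motion_image
proof (rule uniformized_quotient_manifold)
  show "uniformized (real_space_with J) B {id}"
    by (rule uniformized_real_space[where C' = D.C]) (simp_all add: B(1) J_apply)
  fix x y
  show "orbit_of D.\<Delta> (B x) = orbit_of D.\<Delta> (B y) \<longleftrightarrow> (\<exists>\<gamma>\<in>deck z. y = \<gamma> x)"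
  proof
    assume eq: "orbit_of D.\<Delta> (B x) = orbit_of D.\<Delta> (B y)"
    have "B y \<in> orbit_of D.\<Delta> (B y)" unfolding mem_orbit_of by (rule bexI[OF _ D.E.id_mem]) simp
    then have "B y \<in> orbit_of D.\<Delta> (B x)" by (simp only: eq)
    then show "\<exists>\<gamma>\<in>deck z. y = \<gamma> x" by (auto simp: mem_orbit_of D.\<Delta>_def)
  next
    assume "\<exists>\<gamma>\<in>deck z. y = \<gamma> x"
    then obtain \<gamma> where "\<gamma> \<in> deck z" "y = \<gamma> x" by blast
    then have "B \<circ> \<gamma> \<circ> D.C \<in> D.\<Delta>" "B y = (B \<circ> \<gamma> \<circ> D.C) (B x)" by (simp_all add: D.\<Delta>_def)
    then show "orbit_of D.\<Delta> (B x) = orbit_of D.\<Delta> (B y)" using D.E.orbit_of_image by metis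
  qed
  show "\<exists>U. open U \<and> x \<in> U \<and> (\<forall>\<gamma>\<in>deck z. \<forall>y\<in>U. \<gamma> y \<in> U \<longrightarrow> \<gamma> y = y)"
    by (rule D.wandering_neighbourhood)
qed (rule deck_entire)

text \<open>A ball meeting all cosets of \<open>L\<close> maps onto the quotient.\<close>

lemma compact_flat_model: "compact_space (mtop (flat_kaehler_model (motion_of ` deck z) J))"
proof -
  let ?M = "flat_kaehler_model (motion_of ` deck z) J" and ?p = "orbit_of (motion ` motion_of ` deck z) \<circ> B"
  obtain R where R: "\<And>x. \<exists>l\<in>L. norm (x - l) \<le> R" using cobounded by blast
  have "?p x \<in> ?p ` cball 0 R" for x
  proof -
    obtain l where l: "l \<in> L" "norm (x - l) \<le> R" using R by blast
    have "(\<lambda>x. x + l) \<in> deck z" by (rule translation_deck[OF z l(1)])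
    then have "?p (x - l) = ?p x"
      unfolding uniformized_eq_iff[OF uniformized_flat_model] by (intro bexI[of _ "\<lambda>x. x + l"]) simp_all
    moreover have "x - l \<in> cball 0 R" using l(2) by simp
    ultimately show ?thesis by (metis imageI)
  qed
  then have "topspace (mtop ?M) = ?p ` cball 0 R"
    unfolding uniformized_topspace[OF uniformized_flat_model] by blast
  moreover have "compactin (mtop ?M) (?p ` cball 0 R)"
    by (rule image_compactin[OF _ uniformized_continuous_map[OF uniformized_flat_model]])
       (simp add: compact_cball)
  ultimately show ?thesis by (simp add: compact_space_def)
qed

lemma flat_kaehler_torus_quotient: "flat_kaehler_manifold (torus_quotient L (affine_group z))"
proof -
  have "biholomorphic (torus_quotient L (affine_group z)) (flat_kaehler_model (motion_of ` deck z) J)"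
    by (rule biholomorphic_if_conjugate[OF uniformized_torus_quotient[OF z D.deck_group_axioms]
          uniformized_flat_model entire_id entire_id]) simp_all
  moreover have "invertible J"
  proof -
    have "J ** - J = mat 1" "- J ** J = mat 1"
      using J_square by (simp_all add: matrix_eq matrix_vector_mul_assoc[symmetric]
          minus_matrix_apply matrix_apply_minus)
    then show ?thesis unfolding invertible_def by blast
  qed
  moreover have "\<forall>(A, a)\<in>motion_of ` deck z. A ** J = J ** A" using J_commutes by blast
  ultimately show ?thesis
    unfolding flat_kaehler_manifold_def
    using subgroup_motion_of discrete_motion_of torsion_free_motion_of compact_flat_model J_square
    by (intro exI[of _ "motion_of ` deck z"] exI[of _ J]) simp
qed

end


section \<open>The classification\<close>

text \<open>A lifted biholomorphism conjugates the deck groups, hence preserves the lattice translations and is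
  affine; conversely an affine conjugacy descends.\<close>

lemma biholomorphic_iff_conjugate:
  assumes z: "z \<in> Z1" and free: "affine_group z \<in> free_lifts L G"
    and z': "z' \<in> Z1" and free': "affine_group z' \<in> free_lifts L G"
  shows "biholomorphic (torus_quotient L (affine_group z)) (torus_quotient L (affine_group z')) \<longleftrightarrow>
    (\<exists>n\<in>N. star L G n z \<in> cls z')"
proof -
  have fp: "\<forall>\<gamma>\<in>deck z. \<forall>x. \<gamma> x = x \<longrightarrow> \<gamma> = id" "\<forall>\<gamma>\<in>deck z'. \<forall>x. \<gamma> x = x \<longrightarrow> \<gamma> = id"
    using acts_freely_iff[OF z] acts_freely_iff[OF z'] free free' by (auto simp: free_lifts_def)
  obtain B :: "complex ^ 'n \<Rightarrow> real ^ ('n + 'n)"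
    where B: "linear B" "bij B" "\<And>g x. g \<in> G \<Longrightarrow> norm (B (lift g x)) = norm (B x)"
    using invariant_coordinates_exist by blast
  note d = deck_group_deck[OF z fp(1) B] deck_group_deck[OF z' fp(2) B]
  note u = uniformized_torus_quotient[OF z d(1)] and u' = uniformized_torus_quotient[OF z' d(2)]
  show ?thesis
    unfolding conjugate_iff_star[OF z z']
  proof
    assume "biholomorphic (torus_quotient L (affine_group z)) (torus_quotient L (affine_group z'))"
    then obtain f where f: "biholomorphic_map (torus_quotient L (affine_group z)) (torus_quotient L (affine_group z')) f"
      by (auto simp: biholomorphic_def)
    obtain F F' where F: "entire F" "entire F'" "\<And>x. F (F' x) = x" "\<And>x. F' (F x) = x"
      "\<And>x. (orbit_of (affine_group z') \<circ> q) (F x) = f ((orbit_of (affine_group z) \<circ> q) x)"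
      "\<And>\<gamma>. \<gamma> \<in> deck z \<Longrightarrow> F \<circ> \<gamma> \<circ> F' \<in> deck z'" "\<And>\<gamma>. \<gamma> \<in> deck z' \<Longrightarrow> F' \<circ> \<gamma> \<circ> F \<in> deck z"
      using biholomorphic_map_lifts[OF d u u' f] by blast
    have "F \<circ> \<gamma> \<circ> F' \<in> shifts" if "\<gamma> \<in> shifts" for \<gamma>
      by (rule conjugation_preserves_shifts[OF z z' F(3,4,6,7) that])
    moreover have "F' \<circ> \<gamma> \<circ> F \<in> shifts" if "\<gamma> \<in> shifts" for \<gamma>
      by (rule conjugation_preserves_shifts[OF z' z F(4,3,7,6) that])
    ultimately obtain A t where "lattice_aut A" "F = (\<lambda>x. A x + t)"
      using conjugates_shifts_imp_lattice_aut[OF F(1,3,4)] by blast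
    then show "\<exists>A t F F'. lattice_aut A \<and> F = (\<lambda>x. A x + t) \<and> (\<forall>x. F (F' x) = x) \<and> (\<forall>x. F' (F x) = x) \<and>
      (\<forall>\<gamma>\<in>deck z. F \<circ> \<gamma> \<circ> F' \<in> deck z') \<and> (\<forall>\<gamma>\<in>deck z'. F' \<circ> \<gamma> \<circ> F \<in> deck z)"
      using F(3,4,6,7) by (intro exI[of _ A] exI[of _ t] exI[of _ F] exI[of _ F']) simp
  next
    assume "\<exists>A t F F'. lattice_aut A \<and> F = (\<lambda>x. A x + t) \<and> (\<forall>x. F (F' x) = x) \<and> (\<forall>x. F' (F x) = x) \<and>
      (\<forall>\<gamma>\<in>deck z. F \<circ> \<gamma> \<circ> F' \<in> deck z') \<and> (\<forall>\<gamma>\<in>deck z'. F' \<circ> \<gamma> \<circ> F \<in> deck z)"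
    then obtain A t F F' where H: "lattice_aut A \<and> F = (\<lambda>x. A x + t) \<and> (\<forall>x. F (F' x) = x) \<and> (\<forall>x. F' (F x) = x) \<and>
      (\<forall>\<gamma>\<in>deck z. F \<circ> \<gamma> \<circ> F' \<in> deck z') \<and> (\<forall>\<gamma>\<in>deck z'. F' \<circ> \<gamma> \<circ> F \<in> deck z)"
      by (elim exE) (rule that)
    have A: "lattice_aut A" and F: "F = (\<lambda>x. A x + t)" and FF': "\<And>x. F (F' x) = x" "\<And>x. F' (F x) = x"
      and "\<forall>\<gamma>\<in>deck z. F \<circ> \<gamma> \<circ> F' \<in> deck z'" "\<forall>\<gamma>\<in>deck z'. F' \<circ> \<gamma> \<circ> F \<in> deck z"
      using H by iprover+
    note conj = this(5,6)[rule_format]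
    obtain C where C: "lattice_aut C" "\<And>x. A (C x) = x" "\<And>x. C (A x) = x"
      using lattice_aut_inverse[OF A] by blast
    have "F' x = C x + - C t" for x
    proof -
      have "F (C x + - C t) = x"
        using A C by (simp add: F complex_linear_diff lattice_aut_linear)
      then show ?thesis using FF'(2)[of "C x + - C t"] by simp
    qed
    then have F'_eq: "F' = (\<lambda>x. C x + - C t)" by (rule ext)
    have e: "entire F" unfolding F by (rule entire_affine[OF lattice_aut_linear[OF A]])
    have e': "entire F'" unfolding F'_eq by (rule entire_affine[OF lattice_aut_linear[OF C(1)]])
    show "biholomorphic (torus_quotient L (affine_group z)) (torus_quotient L (affine_group z'))"
      by (rule biholomorphic_if_conjugate[OF u u' e e' FF' conj])
  qed
qed

lemma flat_kaehler_quotients_eq: "flat_kaehler_quotients L G = torus_quotient L ` free_lifts L G"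
proof
  show "torus_quotient L ` free_lifts L G \<subseteq> flat_kaehler_quotients L G"
  proof
    fix M assume "M \<in> torus_quotient L ` free_lifts L G"
    then obtain H where H: "H \<in> free_lifts L G" "M = torus_quotient L H" by blast
    then obtain z where z: "z \<in> Z1" "H = affine_group z" "acts_freely_on_torus L H"
      using free_lifts_iff by blast
    obtain B :: "complex ^ 'n \<Rightarrow> real ^ ('n + 'n)"
      where B: "linear B" "bij B" "\<And>g x. g \<in> G \<Longrightarrow> norm (B (lift g x)) = norm (B x)"
      using invariant_coordinates_exist by blast
    have fp: "\<forall>\<gamma>\<in>deck z. \<forall>x. \<gamma> x = x \<longrightarrow> \<gamma> = id"
      using acts_freely_iff[OF z(1)] z(2,3) by simp
    have "flat_kaehler_manifold (torus_quotient L (affine_group z))"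
      by (rule flat_kaehler_torus_quotient[OF z(1) fp B])
    then show "M \<in> flat_kaehler_quotients L G"
      using H z(2) by (auto simp: flat_kaehler_quotients_def)
  qed
qed (auto simp: flat_kaehler_quotients_def)

lemma biholomorphic_iff_orbit:
  assumes H: "H \<in> free_lifts L G" and H': "H' \<in> free_lifts L G"
  shows "biholomorphic (torus_quotient L H) (torus_quotient L H') \<longleftrightarrow>
    orb (lift_class L G H) = orb (lift_class L G H')"
proof -
  obtain z z' where z: "z \<in> Z1" "H = affine_group z" and z': "z' \<in> Z1" "H' = affine_group z'"
    using H H' free_lifts_iff by metis
  show ?thesis
    using biholomorphic_iff_conjugate[OF z(1) _ z'(1)] orbit_eq_iff[OF z(1) z'(1)] H H'
    by (simp add: z z' lift_class_affine_group)
qed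

lemma special_classes_eq: "special_classes L G = lift_class L G ` free_lifts L G"
proof
  show "special_classes L G \<subseteq> lift_class L G ` free_lifts L G"
  proof
    fix C assume C: "C \<in> special_classes L G"
    then obtain z where z: "z \<in> Z1" "C = cls z"
      using carrier_torus_H1 by (auto simp: special_classes_def)
    then have "affine_group z \<in> free_lifts L G" using C special_class_iff by simp
    then show "C \<in> lift_class L G ` free_lifts L G"
      using lift_class_affine_group[OF z(1)] z(2) by (intro image_eqI[of _ _ "affine_group z"]) simp_all
  qed
  show "lift_class L G ` free_lifts L G \<subseteq> special_classes L G"
  proof
    fix C assume "C \<in> lift_class L G ` free_lifts L G"
    then obtain H where H: "H \<in> free_lifts L G" "C = lift_class L G H" by blast
    then obtain z where z: "z \<in> Z1" "H = affine_group z" using free_lifts_iff by blast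
    then show "C \<in> special_classes L G"
      using special_class_iff[OF z(1)] H lift_class_affine_group[OF z(1)] by simp
  qed
qed

end

theorem theorem4p1:
  fixes L :: "(complex ^ 'n::finite) set"
    and G :: "'n torus_map set"
  assumes "is_lattice L"
    and "subgroup G (torus_Aut0 L)"
    and "finite G"
  shows "\<exists>\<Phi>. bij_betw \<Phi> (biholomorphism_classes (flat_kaehler_quotients L G))
                  (orbits (normalizer_group L G) (special_classes L G) (star_class L G)) \<and>
              (\<forall>X \<in> biholomorphism_classes (flat_kaehler_quotients L G). \<forall>H \<in> free_lifts L G.
                  torus_quotient L H \<in> X \<longrightarrow>
                  \<Phi> X = orbit (normalizer_group L G) (star_class L G) (lift_class L G H))"
proof -
  interpret torus_group L G
    by (rule torus_group.intro[OF lattice.intro[OF assms(1)] torus_group_axioms.intro[OF assms(2,3)]])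
  let ?S = "flat_kaehler_quotients L G"
  let ?R = "{(M, M') \<in> ?S \<times> ?S. biholomorphic M M'}"
  define o' where "o' H = orb (lift_class L G H)" for H
  define \<Phi> where "\<Phi> X = o' (SOME H. H \<in> free_lifts L G \<and> torus_quotient L H \<in> X)" for X
  have S: "?S = torus_quotient L ` free_lifts L G" by (rule flat_kaehler_quotients_eq)
  have bih: "biholomorphic (torus_quotient L H) (torus_quotient L H') \<longleftrightarrow> o' H = o' H'"
    if "H \<in> free_lifts L G" "H' \<in> free_lifts L G" for H H'
    unfolding o'_def by (rule biholomorphic_iff_orbit[OF that])
  have classE: "\<exists>H0\<in>free_lifts L G. X = {torus_quotient L H | H. H \<in> free_lifts L G \<and> o' H = o' H0}"
    if X: "X \<in> biholomorphism_classes ?S" for X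
  proof -
    obtain H0 where H0: "H0 \<in> free_lifts L G" "X = ?R `` {torus_quotient L H0}"
      using X unfolding biholomorphism_classes_def quotient_def S by blast
    have "X = {torus_quotient L H | H. H \<in> free_lifts L G \<and> o' H = o' H0}"
    proof (intro Set.set_eqI iffI)
      fix M assume "M \<in> X"
      then have "M \<in> ?S" "biholomorphic (torus_quotient L H0) M" using H0(2) by auto
      then show "M \<in> {torus_quotient L H | H. H \<in> free_lifts L G \<and> o' H = o' H0}"
        unfolding S using bih[OF H0(1)] by auto
    next
      fix M assume "M \<in> {torus_quotient L H | H. H \<in> free_lifts L G \<and> o' H = o' H0}"
      then obtain H where H: "H \<in> free_lifts L G" "M = torus_quotient L H" "o' H = o' H0" by blast
      then show "M \<in> X" using H0 bih[OF H0(1) H(1)] unfolding H0(2) S by simp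
    qed
    then show ?thesis using H0(1) by blast
  qed
  have member: "o' H = o' H0"
    if X: "X = {torus_quotient L H | H. H \<in> free_lifts L G \<and> o' H = o' H0}"
      and H: "H \<in> free_lifts L G" "torus_quotient L H \<in> X" for X H H0
  proof -
    obtain H1 where H1: "torus_quotient L H = torus_quotient L H1" "H1 \<in> free_lifts L G" "o' H1 = o' H0"
      using X H(2) by blast
    have "o' H = o' H1" using bih[OF H(1) H1(2)] bih[OF H1(2) H1(2)] H1(1) by simp
    then show ?thesis using H1(3) by simp
  qed
  have \<Phi>: "\<Phi> X = o' H" if X: "X \<in> biholomorphism_classes ?S" and H: "H \<in> free_lifts L G" "torus_quotient L H \<in> X"
    for X H
  proof -
    let ?H = "SOME H. H \<in> free_lifts L G \<and> torus_quotient L H \<in> X"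
    have sel: "?H \<in> free_lifts L G \<and> torus_quotient L ?H \<in> X"
      by (rule someI[of _ H]) (use H in simp)
    obtain H0 where H0: "H0 \<in> free_lifts L G" "X = {torus_quotient L H | H. H \<in> free_lifts L G \<and> o' H = o' H0}"
      using classE[OF X] by blast
    have "o' ?H = o' H0" using member[OF H0(2)] sel by blast
    moreover have "o' H = o' H0" using member[OF H0(2)] H by blast
    ultimately show ?thesis by (simp add: \<Phi>_def)
  qed
  have rep: "\<exists>H0\<in>free_lifts L G. torus_quotient L H0 \<in> X \<and> \<Phi> X = o' H0 \<and>
      X = {torus_quotient L H | H. H \<in> free_lifts L G \<and> o' H = o' H0}"
    if X: "X \<in> biholomorphism_classes ?S" for X
  proof -
    obtain H0 where H0: "H0 \<in> free_lifts L G" "X = {torus_quotient L H | H. H \<in> free_lifts L G \<and> o' H = o' H0}"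
      using classE[OF X] by blast
    then have "torus_quotient L H0 \<in> X" by blast
    then show ?thesis using \<Phi>[OF X H0(1)] H0 by blast
  qed
  have "bij_betw \<Phi> (biholomorphism_classes ?S) (orbits (normalizer_group L G) (special_classes L G) (star_class L G))"
    unfolding bij_betw_def
  proof
    show "inj_on \<Phi> (biholomorphism_classes ?S)"
    proof (rule inj_onI)
      fix X Y assume X: "X \<in> biholomorphism_classes ?S" and Y: "Y \<in> biholomorphism_classes ?S"
        and eq: "\<Phi> X = \<Phi> Y"
      obtain H0 where H0: "\<Phi> X = o' H0" "X = {torus_quotient L H | H. H \<in> free_lifts L G \<and> o' H = o' H0}"
        using rep[OF X] by blast
      obtain H1 where H1: "\<Phi> Y = o' H1" "Y = {torus_quotient L H | H. H \<in> free_lifts L G \<and> o' H = o' H1}"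
        using rep[OF Y] by blast
      have "o' H0 = o' H1" using eq H0(1) H1(1) by simp
      then show "X = Y" unfolding H0(2) H1(2) by simp
    qed
    have orbits: "orbits (normalizer_group L G) (special_classes L G) (star_class L G) = o' ` free_lifts L G"
      unfolding orbits_def special_classes_eq o'_def by blast
    show "\<Phi> ` biholomorphism_classes ?S = orbits (normalizer_group L G) (special_classes L G) (star_class L G)"
      unfolding orbits
    proof
      show "\<Phi> ` biholomorphism_classes ?S \<subseteq> o' ` free_lifts L G" using rep by blast
      show "o' ` free_lifts L G \<subseteq> \<Phi> ` biholomorphism_classes ?S"
      proof
        fix C assume "C \<in> o' ` free_lifts L G"
        then obtain H where H: "H \<in> free_lifts L G" "C = o' H" by blast
        let ?X = "?R `` {torus_quotient L H}"
        have HS: "torus_quotient L H \<in> ?S" unfolding S using H(1) by blast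
        then have X: "?X \<in> biholomorphism_classes ?S"
          unfolding biholomorphism_classes_def by (rule quotientI)
        have "torus_quotient L H \<in> ?X" using HS bih[OF H(1) H(1)] by simp
        then show "C \<in> \<Phi> ` biholomorphism_classes ?S" using \<Phi>[OF X H(1)] X H(2) by blast
      qed
    qed
  qed
  then show ?thesis using \<Phi> unfolding o'_def by blast
qed

end
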